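(* Let $W$ be a finite Coxeter group, $c$ a standard Coxeter element, and $u_1,u_2\in W_c^+$. The following are equivalent: (1) $\mathcal D_c(u_1)=\mathcal D_c(u_2)$; (2) $\mathrm{Class}_c(u_1)=\mathrm{Class}_c(u_2)$; (3) the Bruhat intervals $[u_1,u_1c]_{\mathrm B}$ and $[u_2,u_2c]_{\mathrm B}$ are reflection isomorphic; (4) $u_1^{-1}$ and $u_2^{-1}$ belong to the same $c^{-1}$-Cambrian class.
   Context: Let $W$ be a finite Coxeter group of rank $r$ with simple reflections $S$ and reflections $T$; $\ell_S,\ell_T$ are lengths with respect to $S,T$. Bruhat order $\leq_{\mathrm B}$ has covers $u\lessdot_{\mathrm B}v$ iff $v=ut$, $t\in T$, $\ell_S(v)=\ell_S(u)+1$. Absolute order: $u\leq_T v$ iff $\ell_T(u)+\ell_T(u^{-1}v)=\ell_T(v)$. A standard Coxeter element $c$ is a product of all elements of $S$ each once; $W_c^+=\{u:\ell_S(uc)=\ell_S(u)+r\}$. $\mathsf{MC}(W,c)$ is the set of maximal chains $\vec\pi=\{e=\pi_0\lessdot_T\cdots\lessdot_T\pi_r=c\}$ of $[e,c]_T$, with word $\mathrm{rw}(\vec\pi)=t_1\cdots t_r$, $t_i=\pi_{i-1}^{-1}\pi_i$. Chains are commutation equivalent if their words differ by swaps of adjacent commuting letters. $u\in W_c^+$ and $\vec\pi$ are concordant if $u\pi_0\leq_{\mathrm B}\cdots\leq_{\mathrm B}u\pi_r$; $\mathrm{Class}_c(u)$ is the set of commutation classes of chains concordant with $u$. The order $\preceq_c$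 on $T$: fixing a reduced $S$-word $\mathsf c$ for $c$, the $c$-sorting word of $w$ is the lexicographically first subword of $\mathsf c^\infty=\mathsf c\mathsf c\cdots$ that is a reduced word for $w$; the inversion sequence of $s_1\cdots s_k$ is $(t_i)$ with $t_i=s_1\cdots s_{i-1}s_is_{i-1}\cdots s_1$; $t\preceq_c t'$ iff $t$ is left of $t'$ in the inversion sequence of every word commutation equivalent to the $c$-sorting word of the longest element. A chain is $\preceq_c$-decreasing if there are no $i<j$ with $t_i\preceq_c t_j$. For $u\in W_c^+$, $\mathrm{Class}_c(u)$ contains exactly one $\preceq_c$-decreasing class, denoted $\mathcal D_c(u)$. Two Bruhat intervals $[u_1,v_1]_{\mathrm B},[u_2,v_2]_{\mathrm B}$ are reflection isomorphic if there is a poset isomorphism $\varphi$ between them with $x^{-1}y=\varphi(x)^{-1}\varphi(y)$ for every cover $x\lessdot_{\mathrm B}y$. Right weak order: $u\leq_R v$ iff some reduced $S$-word of $v$ has a reduced word of $u$ as a prefix. For a standard Coxeter element $c'$ with reduced word $\mathsf c'$, let $I^{(k)}(w)$ be the set of letters of the $k$-th copy of $\mathsf c'$ in $\mathsf c'^\infty$ used by the $c'$-sorting word of $w$; $w$ is $c'$-sortable if $I^{(1)}(w)\supseteq I^{(2)}(w)\supseteq\cdots$. For each $x\in W$ the set of $c'$-sortable $v$ with $v\leq_R x$ has a maximum $\pi_{c'}^\downarrow(x)$; the $c'$-Cambrian classes are the fibers of $\pi_{c'}^\downarrow$. *)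

theory Defs
  imports "HOL-Algebra.Generated_Groups"
begin

text \<open>Coxeter systems. Words are lists of group elements.\<close>

definition word_prod :: "('a, 'b) monoid_scheme \<Rightarrow> 'a list \<Rightarrow> 'a" where
  "word_prod W ws = foldr (\<otimes>\<^bsub>W\<^esub>) ws \<one>\<^bsub>W\<^esub>"

text \<open>
  Entry \<open>0\<close> of a Coxeter matrix encodes \<open>\<infinity>\<close>; the corresponding relation
  \<open>(s t)\<^sup>0 = 1\<close> is void.
\<close>
definition coxeter_matrix :: "'a set \<Rightarrow> ('a \<Rightarrow> 'a \<Rightarrow> nat) \<Rightarrow> bool" where
  "coxeter_matrix S m \<longleftrightarrow>
     (\<forall>s\<in>S. m s s = 1) \<and> (\<forall>s\<in>S. \<forall>t\<in>S. m s t = m t s \<and> (s \<noteq> t \<longrightarrow> m s t \<noteq> 1))"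

text \<open>
  The congruence on words generated by the relations \<open>(s t)^(m s t) = 1\<close>. Since
  \<open>s s = 1\<close> is among them, every letter is its own inverse in the quotient of the free
  monoid, which is therefore the group with these generators and relations.
\<close>
inductive coxeter_cong :: "'a set \<Rightarrow> ('a \<Rightarrow> 'a \<Rightarrow> nat) \<Rightarrow> 'a list \<Rightarrow> 'a list \<Rightarrow> bool"
  for S :: "'a set" and m :: "'a \<Rightarrow> 'a \<Rightarrow> nat" where
  refl: "xs \<in> lists S \<Longrightarrow> coxeter_cong S m xs xs"
| sym: "coxeter_cong S m xs ys \<Longrightarrow> coxeter_cong S m ys xs"
| trans: "coxeter_cong S m xs ys \<Longrightarrow> coxeter_cong S m ys zs \<Longrightarrow> coxeter_cong S m xs zs"
| relator: "s \<in> S \<Longrightarrow> t \<in> S \<Longrightarrow> xs \<in> lists S \<Longrightarrow> ys \<in> lists S \<Longrightarrow>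
    coxeter_cong S m (xs @ concat (replicate (m s t) [s, t]) @ ys) (xs @ ys)"

locale coxeter_system = group W for W (structure) +
  fixes S :: "'a set"
  assumes simple_subset: "S \<subseteq> carrier W"
    and simple_generate: "generate W S = carrier W"
    and presentation: "\<exists>m. coxeter_matrix S m \<and>
      (\<forall>xs\<in>lists S. \<forall>ys\<in>lists S.
         word_prod W xs = word_prod W ys \<longleftrightarrow> coxeter_cong S m xs ys)"

definition reflections :: "('a, 'b) monoid_scheme \<Rightarrow> 'a set \<Rightarrow> 'a set" where
  "reflections W S = {w \<otimes>\<^bsub>W\<^esub> s \<otimes>\<^bsub>W\<^esub> inv\<^bsub>W\<^esub> w | w s. w \<in> carrier W \<and> s \<in> S}"

definition word_length :: "('a, 'b) monoid_scheme \<Rightarrow> 'a set \<Rightarrow> 'a \<Rightarrow> nat" where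
  "word_length W A w = (LEAST n. \<exists>ws\<in>lists A. length ws = n \<and> word_prod W ws = w)"

definition reduced_word :: "('a, 'b) monoid_scheme \<Rightarrow> 'a set \<Rightarrow> 'a \<Rightarrow> 'a list \<Rightarrow> bool" where
  "reduced_word W S w ws \<longleftrightarrow>
     ws \<in> lists S \<and> word_prod W ws = w \<and> length ws = word_length W S w"

definition standard_coxeter_element :: "('a, 'b) monoid_scheme \<Rightarrow> 'a set \<Rightarrow> 'a \<Rightarrow> bool" where
  "standard_coxeter_element W S c \<longleftrightarrow>
     (\<exists>ws. distinct ws \<and> set ws = S \<and> word_prod W ws = c)"


section \<open>Orders\<close>

definition bruhat_cover :: "('a, 'b) monoid_scheme \<Rightarrow> 'a set \<Rightarrow> 'a \<Rightarrow> 'a \<Rightarrow> bool" where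
  "bruhat_cover W S u v \<longleftrightarrow> u \<in> carrier W \<and>
     (\<exists>t\<in>reflections W S. v = u \<otimes>\<^bsub>W\<^esub> t) \<and> word_length W S v = word_length W S u + 1"

definition bruhat_le :: "('a, 'b) monoid_scheme \<Rightarrow> 'a set \<Rightarrow> 'a \<Rightarrow> 'a \<Rightarrow> bool" where
  "bruhat_le W S = (bruhat_cover W S)\<^sup>*\<^sup>*"

definition bruhat_interval :: "('a, 'b) monoid_scheme \<Rightarrow> 'a set \<Rightarrow> 'a \<Rightarrow> 'a \<Rightarrow> 'a set" where
  "bruhat_interval W S u v = {x \<in> carrier W. bruhat_le W S u x \<and> bruhat_le W S x v}"

definition absolute_le :: "('a, 'b) monoid_scheme \<Rightarrow> 'a set \<Rightarrow> 'a \<Rightarrow> 'a \<Rightarrow> bool" where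
  "absolute_le W S u v \<longleftrightarrow> u \<in> carrier W \<and> v \<in> carrier W \<and>
     word_length W (reflections W S) u + word_length W (reflections W S) (inv\<^bsub>W\<^esub> u \<otimes>\<^bsub>W\<^esub> v)
       = word_length W (reflections W S) v"

definition absolute_cover :: "('a, 'b) monoid_scheme \<Rightarrow> 'a set \<Rightarrow> 'a \<Rightarrow> 'a \<Rightarrow> bool" where
  "absolute_cover W S u v \<longleftrightarrow> absolute_le W S u v \<and> u \<noteq> v \<and>
     (\<forall>x. absolute_le W S u x \<and> absolute_le W S x v \<longrightarrow> x = u \<or> x = v)"

definition right_weak_le :: "('a, 'b) monoid_scheme \<Rightarrow> 'a set \<Rightarrow> 'a \<Rightarrow> 'a \<Rightarrow> bool" where
  "right_weak_le W S u v \<longleftrightarrow>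
     (\<exists>xs ys. reduced_word W S v (xs @ ys) \<and> reduced_word W S u xs)"

definition reflection_isomorphic ::
    "('a, 'b) monoid_scheme \<Rightarrow> 'a set \<Rightarrow> 'a \<Rightarrow> 'a \<Rightarrow> 'a \<Rightarrow> 'a \<Rightarrow> bool" where
  "reflection_isomorphic W S u1 v1 u2 v2 \<longleftrightarrow>
     (\<exists>\<phi>. bij_betw \<phi> (bruhat_interval W S u1 v1) (bruhat_interval W S u2 v2) \<and>
        (\<forall>x\<in>bruhat_interval W S u1 v1. \<forall>y\<in>bruhat_interval W S u1 v1.
           (bruhat_le W S x y \<longleftrightarrow> bruhat_le W S (\<phi> x) (\<phi> y)) \<and>
           (bruhat_cover W S x y \<longrightarrow>
              inv\<^bsub>W\<^esub> x \<otimes>\<^bsub>W\<^esub> y = inv\<^bsub>W\<^esub> (\<phi> x) \<otimes>\<^bsub>W\<^esub> \<phi> y)))"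


section \<open>Sorting words\<close>

text \<open>
  For a word \<open>cs\<close>, the letter at position \<open>p\<close> (counted from \<open>0\<close>) of the infinite word
  \<open>cs cs cs \<dots>\<close> is \<open>cs ! (p mod length cs)\<close>, and it lies in copy number \<open>p div length cs\<close>.
  Subwords are given by their increasing lists of positions; all reduced words of \<open>w\<close> have
  the same length, so the lexicographic order on lists of positions is total on them.
\<close>
definition periodic_letter :: "'a list \<Rightarrow> nat \<Rightarrow> 'a" where
  "periodic_letter cs p = cs ! (p mod length cs)"

definition reduced_positions ::
    "('a, 'b) monoid_scheme \<Rightarrow> 'a set \<Rightarrow> 'a list \<Rightarrow> 'a \<Rightarrow> nat list set" where
  "reduced_positions W S cs w =
     {ps. sorted_wrt (<) ps \<and> reduced_word W S w (map (periodic_letter cs) ps)}"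

definition sorting_positions ::
    "('a, 'b) monoid_scheme \<Rightarrow> 'a set \<Rightarrow> 'a list \<Rightarrow> 'a \<Rightarrow> nat list" where
  "sorting_positions W S cs w =
     (THE ps. ps \<in> reduced_positions W S cs w \<and>
        (\<forall>qs\<in>reduced_positions W S cs w. qs = ps \<or> (ps, qs) \<in> lex less_than))"

definition sorting_word :: "('a, 'b) monoid_scheme \<Rightarrow> 'a set \<Rightarrow> 'a list \<Rightarrow> 'a \<Rightarrow> 'a list" where
  "sorting_word W S cs w = map (periodic_letter cs) (sorting_positions W S cs w)"

definition inversion_sequence :: "('a, 'b) monoid_scheme \<Rightarrow> 'a list \<Rightarrow> 'a list" where
  "inversion_sequence W ws =
     map (\<lambda>i. word_prod W (take i ws @ [ws ! i] @ rev (take i ws))) [0..<length ws]"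

definition longest_element :: "('a, 'b) monoid_scheme \<Rightarrow> 'a set \<Rightarrow> 'a" where
  "longest_element W S =
     (THE w. w \<in> carrier W \<and> (\<forall>v\<in>carrier W. word_length W S v \<le> word_length W S w))"

definition commutation_step :: "('a, 'b) monoid_scheme \<Rightarrow> 'a list \<Rightarrow> 'a list \<Rightarrow> bool" where
  "commutation_step W xs ys \<longleftrightarrow>
     (\<exists>us a b vs. xs = us @ [a, b] @ vs \<and> ys = us @ [b, a] @ vs \<and>
        a \<otimes>\<^bsub>W\<^esub> b = b \<otimes>\<^bsub>W\<^esub> a)"

definition commutation_equiv :: "('a, 'b) monoid_scheme \<Rightarrow> 'a list \<Rightarrow> 'a list \<Rightarrow> bool" where
  "commutation_equiv W = (commutation_step W)\<^sup>*\<^sup>*"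

text \<open>
  The order on reflections attached to a reduced word \<open>cs\<close> of the Coxeter element. It is a
  (reflexive) partial order, hence \<open>i \<le> j\<close>.
\<close>
definition reflection_le ::
    "('a, 'b) monoid_scheme \<Rightarrow> 'a set \<Rightarrow> 'a list \<Rightarrow> 'a \<Rightarrow> 'a \<Rightarrow> bool" where
  "reflection_le W S cs t t' \<longleftrightarrow>
     (\<forall>ws. commutation_equiv W (sorting_word W S cs (longest_element W S)) ws \<longrightarrow>
        (\<exists>i j. i \<le> j \<and> j < length (inversion_sequence W ws) \<and>
           inversion_sequence W ws ! i = t \<and> inversion_sequence W ws ! j = t'))"


section \<open>Maximal chains of the noncrossing partition lattice\<close>

definition coxeter_plus :: "('a, 'b) monoid_scheme \<Rightarrow> 'a set \<Rightarrow> 'a \<Rightarrow> 'a set" where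
  "coxeter_plus W S c =
     {u \<in> carrier W. word_length W S (u \<otimes>\<^bsub>W\<^esub> c) = word_length W S u + card S}"

definition max_chains :: "('a, 'b) monoid_scheme \<Rightarrow> 'a set \<Rightarrow> 'a \<Rightarrow> 'a list set" where
  "max_chains W S c =
     {\<pi>. length \<pi> = card S + 1 \<and> \<pi> ! 0 = \<one>\<^bsub>W\<^esub> \<and> \<pi> ! card S = c \<and>
        (\<forall>i<card S. absolute_cover W S (\<pi> ! i) (\<pi> ! (i + 1)))}"

definition chain_word :: "('a, 'b) monoid_scheme \<Rightarrow> 'a list \<Rightarrow> 'a list" where
  "chain_word W \<pi> =
     map (\<lambda>i. inv\<^bsub>W\<^esub> (\<pi> ! i) \<otimes>\<^bsub>W\<^esub> \<pi> ! (i + 1)) [0..<length \<pi> - 1]"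

definition chain_class ::
    "('a, 'b) monoid_scheme \<Rightarrow> 'a set \<Rightarrow> 'a \<Rightarrow> 'a list \<Rightarrow> 'a list set" where
  "chain_class W S c \<pi> =
     {\<pi>' \<in> max_chains W S c. commutation_equiv W (chain_word W \<pi>) (chain_word W \<pi>')}"

definition concordant :: "('a, 'b) monoid_scheme \<Rightarrow> 'a set \<Rightarrow> 'a \<Rightarrow> 'a list \<Rightarrow> bool" where
  "concordant W S u \<pi> \<longleftrightarrow>
     (\<forall>i. i + 1 < length \<pi> \<longrightarrow>
        bruhat_le W S (u \<otimes>\<^bsub>W\<^esub> \<pi> ! i) (u \<otimes>\<^bsub>W\<^esub> \<pi> ! (i + 1)))"

definition concordant_classes ::
    "('a, 'b) monoid_scheme \<Rightarrow> 'a set \<Rightarrow> 'a \<Rightarrow> 'a \<Rightarrow> 'a list set set" where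
  "concordant_classes W S c u =
     {chain_class W S c \<pi> | \<pi>. \<pi> \<in> max_chains W S c \<and> concordant W S u \<pi>}"

definition decreasing_chain ::
    "('a, 'b) monoid_scheme \<Rightarrow> 'a set \<Rightarrow> 'a list \<Rightarrow> 'a list \<Rightarrow> bool" where
  "decreasing_chain W S cs \<pi> \<longleftrightarrow>
     \<not> (\<exists>i j. i < j \<and> j < length (chain_word W \<pi>) \<and>
          reflection_le W S cs (chain_word W \<pi> ! i) (chain_word W \<pi> ! j))"

text \<open>
  A commutation class is decreasing if it contains a decreasing chain. Being decreasing is
  not invariant under commutation equivalence (commuting reflections can be comparable, for
  instance in type \<open>A\<^sub>4\<close> with a linear Coxeter element), and requiring all chains of the class
  to be decreasing would leave some elements without a decreasing class.
\<close>
definition decreasing_class ::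
    "('a, 'b) monoid_scheme \<Rightarrow> 'a set \<Rightarrow> 'a \<Rightarrow> 'a list \<Rightarrow> 'a \<Rightarrow> 'a list set" where
  "decreasing_class W S c cs u =
     (THE C. C \<in> concordant_classes W S c u \<and> (\<exists>\<pi>\<in>C. decreasing_chain W S cs \<pi>))"


section \<open>Cambrian classes\<close>

definition sorting_block ::
    "('a, 'b) monoid_scheme \<Rightarrow> 'a set \<Rightarrow> 'a list \<Rightarrow> nat \<Rightarrow> 'a \<Rightarrow> 'a set" where
  "sorting_block W S cs k w =
     {periodic_letter cs p | p. p \<in> set (sorting_positions W S cs w) \<and> p div length cs = k}"

definition sortable :: "('a, 'b) monoid_scheme \<Rightarrow> 'a set \<Rightarrow> 'a list \<Rightarrow> 'a \<Rightarrow> bool" where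
  "sortable W S cs w \<longleftrightarrow> w \<in> carrier W \<and>
     (\<forall>k. sorting_block W S cs (k + 1) w \<subseteq> sorting_block W S cs k w)"

definition cambrian_proj :: "('a, 'b) monoid_scheme \<Rightarrow> 'a set \<Rightarrow> 'a list \<Rightarrow> 'a \<Rightarrow> 'a" where
  "cambrian_proj W S cs x =
     (THE v. sortable W S cs v \<and> right_weak_le W S v x \<and>
        (\<forall>v'. sortable W S cs v' \<and> right_weak_le W S v' x \<longrightarrow> right_weak_le W S v' v))"

definition cambrian_classes :: "('a, 'b) monoid_scheme \<Rightarrow> 'a set \<Rightarrow> 'a list \<Rightarrow> 'a set set" where
  "cambrian_classes W S cs =
     {{y \<in> carrier W. cambrian_proj W S cs y = cambrian_proj W S cs x} | x. x \<in> carrier W}"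

end

theory Submission
  imports Defs Complex_Main
begin

text \<open>
  A chain with word \<open>t\<^sub>1 \<dots> t\<^sub>r\<close> is concordant with \<open>u\<close> iff \<open>u t\<^sub>1 \<dots> t\<^sub>i\<^sub>-\<^sub>1\<close> sends the positive root of
  \<open>t\<^sub>i\<close> to a positive root, for every \<open>i\<close>. Let \<open>s\<close> be the last letter of \<open>c\<close>. If \<open>u s\<close> is longer than
  \<open>u\<close>, then every chain concordant with \<open>u\<close> uses \<open>s\<close>, and removing it leaves a chain for \<open>c s\<close>
  concordant with \<open>u\<close>; if \<open>u s\<close> is shorter, none uses \<open>s\<close>, and conjugation by \<open>s\<close> gives the chains
  for \<open>s c s\<close> concordant with \<open>u s\<close>. The \<open>c\<^sup>-\<^sup>1\<close>-Cambrian projection of \<open>u\<^sup>-\<^sup>1\<close> satisfies the same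
  recursion, so it determines the concordant chains. Conversely it is determined by the decreasing
  class alone: the order of two reflections of such a factorization along the sorting word of the
  longest element is governed by the sign of the Euler form of their roots, whence a factorization
  is decreasing iff its roots have pairwise nonnegative inner products, and this condition is compatible with both cases of the recursion. Finally, the edge labels
  of the Bruhat interval from \<open>u\<close> to \<open>u c\<close> are read off its concordant chains, which are exactly its
  maximal chains.
\<close>

text \<open>The pivot is the set \<open>Conc bs u\<close> of concordant factorizations: each of the
  four conditions is matched with equality of these sets.

  The descent case hides a difficulty. A concordant factorization may contain \<open>s\<close>
  although \<open>u s\<close> is shorter than \<open>u\<close>: in type A_2 with
  \<open>c = s2 s1\<close> and \<open>u = s = s1\<close>, the factorization \<open>(s2, s1)\<close>
  is an example. Only the acute ones avoid \<open>s\<close> there, so \<open>Conc_down\<close>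
  carries a second clause for factorizations that contain \<open>s\<close>.

  The Euler form enters because it vanishes on the roots of \<open>(t, t')\<close> whenever
  \<open>t\<close> precedes \<open>t'\<close> in a factorization. Its value on
  \<open>(t', t)\<close> is then twice the inner product, and the sign of this value is what the
  inversion sequence of the longest element sees.

  Two definite descriptions, the decreasing class and the Cambrian projection, have to be resolved
  on the way, and the longest element has to be shown sortable. All three rest on acute
  factorizations, which exist and are unique up to commutation for every \<open>u\<close> in
  \<open>W_c^+\<close>.\<close>

section \<open>Words in a group and word length\<close>

lemma word_prod_Nil [simp]: "word_prod G [] = \<one>\<^bsub>G\<^esub>"
  by (simp add: word_prod_def)

lemma word_prod_Cons [simp]: "word_prod G (x # xs) = x \<otimes>\<^bsub>G\<^esub> word_prod G xs"
  by (simp add: word_prod_def)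

context group
begin

lemma word_prod_closed [simp, intro]: "set xs \<subseteq> carrier G \<Longrightarrow> word_prod G xs \<in> carrier G"
  by (induction xs) auto

lemma word_prod_append [simp]:
  "set xs \<subseteq> carrier G \<Longrightarrow> set ys \<subseteq> carrier G \<Longrightarrow>
     word_prod G (xs @ ys) = word_prod G xs \<otimes> word_prod G ys"
  by (induction xs) (auto simp: m_assoc)

lemma word_length_le: "set xs \<subseteq> A \<Longrightarrow> word_length G A (word_prod G xs) \<le> length xs"
  unfolding word_length_def by (rule Least_le) auto

lemma word_length_word:
  assumes "\<exists>xs. set xs \<subseteq> A \<and> word_prod G xs = w"
  obtains xs where "set xs \<subseteq> A" "word_prod G xs = w" "length xs = word_length G A w"
proof -
  have "\<exists>n. \<exists>ws\<in>lists A. length ws = n \<and> word_prod G ws = w"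
    using assms by (auto simp: in_lists_conv_set subset_iff)
  then have "\<exists>ws\<in>lists A. length ws = word_length G A w \<and> word_prod G ws = w"
    unfolding word_length_def by (rule LeastI_ex)
  then show ?thesis using that by (auto simp: in_lists_conv_set subset_iff)
qed

end

section \<open>Words and length in a finite Coxeter system\<close>

locale finite_coxeter = coxeter_system +
  assumes finite_carrier: "finite (carrier W)"
begin

abbreviation prd :: "'a list \<Rightarrow> 'a" where "prd \<equiv> word_prod W"
abbreviation len :: "'a \<Rightarrow> nat" where "len \<equiv> word_length W S"

text \<open>The locale only asserts that some Coxeter matrix presents the group. One is fixed here
  so that the geometric representation has a bilinear form to refer to.\<close>

definition cm :: "'a \<Rightarrow> 'a \<Rightarrow> nat" where
  "cm = (SOME m. coxeter_matrix S m \<and>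
      (\<forall>xs\<in>lists S. \<forall>ys\<in>lists S. prd xs = prd ys \<longleftrightarrow> coxeter_cong S m xs ys))"

lemma cm_matrix: "coxeter_matrix S cm"
  and cm_cong: "set xs \<subseteq> S \<Longrightarrow> set ys \<subseteq> S \<Longrightarrow> prd xs = prd ys \<longleftrightarrow> coxeter_cong S cm xs ys"
proof -
  have "coxeter_matrix S cm \<and>
      (\<forall>xs\<in>lists S. \<forall>ys\<in>lists S. prd xs = prd ys \<longleftrightarrow> coxeter_cong S cm xs ys)"
    unfolding cm_def using presentation by (rule someI_ex)
  then show "coxeter_matrix S cm"
    and "set xs \<subseteq> S \<Longrightarrow> set ys \<subseteq> S \<Longrightarrow> prd xs = prd ys \<longleftrightarrow> coxeter_cong S cm xs ys"
    by (auto simp: subset_iff in_lists_conv_set)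
qed

lemma cm_self: "s \<in> S \<Longrightarrow> cm s s = 1"
  and cm_sym: "s \<in> S \<Longrightarrow> t \<in> S \<Longrightarrow> cm s t = cm t s"
  and cm_neq: "s \<in> S \<Longrightarrow> t \<in> S \<Longrightarrow> s \<noteq> t \<Longrightarrow> cm s t \<noteq> 1"
  using cm_matrix by (auto simp: coxeter_matrix_def)

lemma finite_S: "finite S"
  using finite_carrier simple_subset by (rule rev_finite_subset)

lemma simple_closed [simp, intro]: "s \<in> S \<Longrightarrow> s \<in> carrier W"
  using simple_subset by auto

lemma simple_word_closed: "set xs \<subseteq> S \<Longrightarrow> set xs \<subseteq> carrier W"
  using simple_subset by auto

lemma relation:
  assumes "s \<in> S" "t \<in> S" shows "prd (concat (replicate (cm s t) [s, t])) = \<one>"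
proof -
  have sub: "set (concat (replicate n [s, t])) \<subseteq> S" for n using assms by auto
  have "coxeter_cong S cm ([] @ concat (replicate (cm s t) [s, t]) @ []) ([] @ [])"
    using assms by (intro coxeter_cong.relator) auto
  then have "prd (concat (replicate (cm s t) [s, t])) = prd []"
    using sub by (subst cm_cong) auto
  then show ?thesis by simp
qed

lemma simple_square [simp]: "s \<in> S \<Longrightarrow> s \<otimes> s = \<one>"
  using relation[of s s] by (simp add: cm_self)

lemma simple_square' [simp]: "s \<in> S \<Longrightarrow> x \<in> carrier W \<Longrightarrow> s \<otimes> (s \<otimes> x) = x"
  by (simp flip: m_assoc)

lemma simple_inv [simp]: "s \<in> S \<Longrightarrow> inv s = s"
  by (rule inv_equality) auto

lemma word_rev_inv: "set xs \<subseteq> S \<Longrightarrow> inv (prd xs) = prd (rev xs)"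
proof (induction xs)
  case (Cons x xs)
  then have "inv (prd (x # xs)) = prd (rev xs) \<otimes> x"
    using simple_word_closed by (simp add: inv_mult_group)
  also have "\<dots> = prd (rev (x # xs))" using Cons.prems simple_word_closed by simp
  finally show ?case .
qed simp

lemma word_exists:
  assumes "w \<in> carrier W" shows "\<exists>xs. set xs \<subseteq> S \<and> prd xs = w"
proof -
  have "w \<in> generate W S" using assms simple_generate by simp
  then show ?thesis
  proof induction
    case one show ?case by (rule exI[of _ "[]"]) simp
  next
    case (incl h) then show ?case by (intro exI[of _ "[h]"]) simp
  next
    case (inv h) then show ?case by (intro exI[of _ "[h]"]) simp
  next
    case (eng h1 h2)
    then obtain xs ys where "set xs \<subseteq> S" "prd xs = h1" "set ys \<subseteq> S" "prd ys = h2" by auto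
    then show ?case using simple_word_closed by (intro exI[of _ "xs @ ys"]) simp
  qed
qed

lemma reduced_exists:
  assumes "w \<in> carrier W"
  obtains xs where "set xs \<subseteq> S" "prd xs = w" "length xs = len w"
  using word_length_word[OF word_exists[OF assms]] by blast

lemma len_le: "set xs \<subseteq> S \<Longrightarrow> len (prd xs) \<le> length xs"
  by (rule word_length_le)

lemma len_one [simp]: "len \<one> = 0"
  using len_le[of "[]"] by simp

lemma len_0: "w \<in> carrier W \<Longrightarrow> len w = 0 \<longleftrightarrow> w = \<one>"
  by (rule reduced_exists[of w]) auto

lemma len_mult:
  assumes "x \<in> carrier W" "y \<in> carrier W" shows "len (x \<otimes> y) \<le> len x + len y"
proof -
  obtain xs where "set xs \<subseteq> S" "prd xs = x" "length xs = len x" using reduced_exists[OF assms(1)] .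
  moreover obtain ys where "set ys \<subseteq> S" "prd ys = y" "length ys = len y" using reduced_exists[OF assms(2)] .
  ultimately show ?thesis using len_le[of "xs @ ys"] simple_word_closed by simp
qed

lemma len_inv [simp]: assumes "x \<in> carrier W" shows "len (inv x) = len x"
proof -
  have *: "len (inv x) \<le> len x" if "x \<in> carrier W" for x
  proof -
    obtain xs where "set xs \<subseteq> S" "prd xs = x" "length xs = len x" by (rule reduced_exists[of x]) (use \<open>x \<in> carrier W\<close> in auto)
    then show ?thesis using len_le[of "rev xs"] word_rev_inv[of xs] by simp
  qed
  show ?thesis using *[of x] *[of "inv x"] assms by simp
qed

text \<open>Relators have even length. This is the sign character, and it keeps
  \<open>len (w \<otimes> s)\<close> from being equal to \<open>len w\<close>.\<close>

lemma cong_parity: "coxeter_cong S cm xs ys \<Longrightarrow> even (length xs) = even (length ys)"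
proof (induction rule: coxeter_cong.induct)
  case (relator s t xs ys)
  have "length (concat (replicate n [s, t])) = 2 * n" for n by (induction n) auto
  then show ?case by simp
qed auto

lemma word_parity:
  assumes "set xs \<subseteq> S" shows "even (length xs) = even (len (prd xs))"
proof -
  obtain ys where ys: "set ys \<subseteq> S" "prd ys = prd xs" "length ys = len (prd xs)"
    by (rule reduced_exists[of "prd xs"]) (use assms simple_word_closed in auto)
  then show ?thesis using cong_parity[of xs ys] cm_cong[of xs ys] assms by auto
qed

lemma len_simple_mult:
  assumes "w \<in> carrier W" "s \<in> S"
  shows "len (w \<otimes> s) = len w + 1 \<or> len w = len (w \<otimes> s) + 1"
proof -
  obtain xs where xs: "set xs \<subseteq> S" "prd xs = w" "length xs = len w" using reduced_exists[OF assms(1)] .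
  have eq: "prd (xs @ [s]) = w \<otimes> s" using xs assms simple_word_closed by simp
  have "even (len w + 1) = even (len (w \<otimes> s))"
    using word_parity[of "xs @ [s]"] xs assms eq by simp
  moreover have "len (w \<otimes> s) \<le> len w + 1" using len_le[of "xs @ [s]"] xs assms eq by simp
  moreover have "len w \<le> len (w \<otimes> s) + 1"
    using len_mult[of "w \<otimes> s" s] len_le[of "[s]"] assms by (simp add: m_assoc)
  ultimately show ?thesis by presburger
qed

section \<open>The geometric representation\<close>

text \<open>
  An infinite entry of the Coxeter matrix is encoded by \<open>0\<close>, and \<open>pi / 0 = 0\<close> yields the
  usual value \<open>-1\<close>.
\<close>
definition bf :: "'a \<Rightarrow> 'a \<Rightarrow> real" where "bf s t = - cos (pi / real (cm s t))"

text \<open>Vectors are functions on the whole type, of which \<open>B\<close> reads only the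
  coordinates in \<open>S\<close>; for roots the others vanish by
  \<open>Phi_support\<close>.\<close>

definition B :: "('a \<Rightarrow> real) \<Rightarrow> ('a \<Rightarrow> real) \<Rightarrow> real" where
  "B x y = (\<Sum>l\<in>S. \<Sum>k\<in>S. x l * y k * bf l k)"

definition alpha :: "'a \<Rightarrow> 'a \<Rightarrow> real" where "alpha s = (\<lambda>l. if l = s then 1 else 0)"

definition refl :: "('a \<Rightarrow> real) \<Rightarrow> ('a \<Rightarrow> real) \<Rightarrow> 'a \<Rightarrow> real" where
  "refl b v = (\<lambda>l. v l - 2 * B v b * b l)"

definition act_word :: "'a list \<Rightarrow> ('a \<Rightarrow> real) \<Rightarrow> 'a \<Rightarrow> real" where
  "act_word ws v = foldr (\<lambda>s. refl (alpha s)) ws v"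

lemma act_word_simps [simp]:
  "act_word [] v = v" "act_word (s # ws) v = refl (alpha s) (act_word ws v)"
  "act_word (xs @ ys) v = act_word xs (act_word ys v)"
  by (simp_all add: act_word_def)

lemma bf_sym: "s \<in> S \<Longrightarrow> t \<in> S \<Longrightarrow> bf s t = bf t s"
  by (simp add: bf_def cm_sym)

lemma bf_self: "s \<in> S \<Longrightarrow> bf s s = 1"
  by (simp add: bf_def cm_self)

lemma bf_nonpos:
  assumes "s \<in> S" "t \<in> S" "s \<noteq> t" shows "bf s t \<le> 0"
proof (cases "cm s t = 0")
  case False
  then have "real (cm s t) \<ge> 2" using cm_neq[OF assms] by linarith
  then have "pi / real (cm s t) \<le> pi / 2" by (intro divide_left_mono) auto
  moreover have "- (pi / 2) \<le> pi / real (cm s t)" by (rule order_trans[of _ 0]) auto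
  ultimately show ?thesis unfolding bf_def by (simp add: cos_ge_zero del: le_divide_eq_numeral1 divide_le_eq_numeral1)
qed (simp add: bf_def)

lemma B_sym: "B x y = B y x"
  unfolding B_def by (subst sum.swap) (auto intro!: sum.cong simp: bf_sym)

lemma B_lin1: "B (\<lambda>l. a * x l + b * y l) z = a * B x z + b * B y z"
  by (simp add: B_def sum.distrib sum_distrib_left algebra_simps)

lemma B_lin2: "B z (\<lambda>l. a * x l + b * y l) = a * B z x + b * B z y"
  using B_lin1[of a x b y z] by (simp add: B_sym)

lemma B_add1: "B (\<lambda>l. x l + y l) z = B x z + B y z"
  using B_lin1[of 1 x 1 y z] by simp
lemma B_diff1: "B (\<lambda>l. x l - y l) z = B x z - B y z"
  using B_lin1[of 1 x "-1" y z] by simp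
lemma B_scale1: "B (\<lambda>l. a * x l) z = a * B x z"
  using B_lin1[of a x 0 x z] by simp
lemma B_neg1: "B (\<lambda>l. - x l) z = - B x z"
  using B_scale1[of "-1" x z] by simp
lemma B_add2: "B z (\<lambda>l. x l + y l) = B z x + B z y"
  using B_lin2[of z 1 x 1 y] by simp
lemma B_diff2: "B z (\<lambda>l. x l - y l) = B z x - B z y"
  using B_lin2[of z 1 x "-1" y] by simp
lemma B_scale2: "B z (\<lambda>l. a * x l) = a * B z x"
  using B_lin2[of z a x 0 x] by simp
lemma B_neg2: "B z (\<lambda>l. - x l) = - B z x"
  using B_scale2[of z "-1" x] by simp

lemma B_scale1': "B (\<lambda>l. x l * a) z = a * B x z"
  using B_scale1[of a x z] by (simp add: mult.commute)
lemma B_scale2': "B z (\<lambda>l. x l * a) = a * B z x"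
  using B_scale2[of z a x] by (simp add: mult.commute)

lemmas B_simps = B_add1 B_diff1 B_scale1 B_scale1' B_neg1 B_add2 B_diff2 B_scale2 B_scale2' B_neg2

lemma B_refl1: "B (refl b v) z = B v z - 2 * B v b * B b z"
  unfolding refl_def by (simp only: B_diff1 B_scale1)
lemma B_refl2: "B z (refl b v) = B z v - 2 * B v b * B z b"
  unfolding refl_def by (simp only: B_diff2 B_scale2)

lemma B_alpha: assumes "s \<in> S" shows "B x (alpha s) = (\<Sum>l\<in>S. x l * bf l s)"
proof -
  have "(\<Sum>k\<in>S. x l * alpha s k * bf l k) = x l * bf l s" for l
    using assms finite_S by (simp add: alpha_def if_distrib[of "\<lambda>z. _ * z"] if_distrib[of "\<lambda>z. z * _"]
        cong: if_cong)
  then show ?thesis by (simp add: B_def)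
qed

lemma B_expand: "B x y = (\<Sum>k\<in>S. y k * B x (alpha k))"
proof -
  have "B x y = (\<Sum>k\<in>S. \<Sum>l\<in>S. x l * y k * bf l k)" unfolding B_def by (rule sum.swap)
  also have "\<dots> = (\<Sum>k\<in>S. y k * B x (alpha k))"
    by (rule sum.cong) (auto simp: B_alpha sum_distrib_left algebra_simps)
  finally show ?thesis .
qed

lemma B_alpha_alpha: "s \<in> S \<Longrightarrow> t \<in> S \<Longrightarrow> B (alpha s) (alpha t) = bf s t"
  using finite_S by (simp add: B_alpha, simp add: alpha_def if_distrib[of "\<lambda>z. z * _"] cong: if_cong)

lemma refl_lin: "refl b (\<lambda>l. p * x l + q * y l) = (\<lambda>l. p * refl b x l + q * refl b y l)"
  by (rule ext) (simp only: refl_def B_lin1, simp add: algebra_simps)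

lemma B_refl: "B b b = 1 \<Longrightarrow> B (refl b x) (refl b y) = B x y"
  using B_sym[of b y] by (simp add: B_refl1 B_refl2 algebra_simps)

lemma refl_refl: "B b b = 1 \<Longrightarrow> refl b (refl b x) = x"
  by (rule ext) (simp add: refl_def[of b "refl b x"] B_refl1, simp add: refl_def)

lemma refl_self: "B b b = 1 \<Longrightarrow> refl b b = (\<lambda>l. - b l)"
  by (rule ext) (simp add: refl_def)

text \<open>The pairings of the iterates of \<open>v\<close> with the two simple roots satisfy the
  recurrence of sine and cosine at multiples of \<open>pi / m\<close>. The displacement after
  \<open>m\<close> rounds is made of sums of such values over a full period, hence zero.\<close>

lemma dihedral_relation:
  assumes "s \<in> S" "t \<in> S" shows "act_word (concat (replicate (cm s t) [s, t])) v = v"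
proof (cases "s = t \<or> cm s t = 0")
  case True
  then show ?thesis using assms by (auto simp: cm_self refl_refl B_alpha_alpha bf_self)
next
  case False
  define m where "m = cm s t"
  define th where "th = pi / real m"
  define C where "C = cos th"
  define a where "a = B v (alpha s)"
  define b where "b = B v (alpha t)"
  \<comment> \<open>\<open>h\<close> solves the recurrence \<open>rec\<close>, and \<open>Q\<close>
    is fixed by the initial values \<open>h 0 = b\<close> and \<open>h (-1) = - a\<close>.
    \<open>H\<close> is a discrete antiderivative of \<open>h\<close> (see \<open>tele\<close>), so
    its periodicity makes the sums vanish.\<close>
  define Q where "Q = (a + b * C) / sin th"
  define h where "h = (\<lambda>x::real. b * cos (x * th) + Q * sin (x * th))"
  define H where "H = (\<lambda>x::real. b * sin (x * th) - Q * cos (x * th))"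
  define f where "f = (\<lambda>v. refl (alpha s) (refl (alpha t) v))"
  have m2: "m \<ge> 2" using False cm_neq[OF assms] by (auto simp: m_def)
  have mth: "real m * th = pi" using m2 by (simp add: th_def)
  have "0 < th" "th < pi" using m2 by (simp_all add: th_def divide_less_eq)
  then have sin0: "sin th \<noteq> 0" using sin_gt_zero by force
  have bst: "bf s t = - C" "bf t s = - C"
    using assms by (simp_all add: bf_def C_def th_def m_def cm_sym)
  note bs = bst bf_self[OF assms(1)] bf_self[OF assms(2)]
  have rec: "h (x + 1) = 2 * C * h x - h (x - 1)" for x
    unfolding h_def C_def by (simp add: cos_add sin_add cos_diff sin_diff algebra_simps)
  have tele: "2 * sin th * h x = H (x + 1) - H (x - 1)" for x
    unfolding h_def H_def by (simp add: cos_add sin_add cos_diff sin_diff algebra_simps)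
  have h0: "h 0 = b" "h (-1) = - a"
    using sin0 by (simp_all add: h_def Q_def C_def)
  have main: "(f ^^ k) v = (\<lambda>l. v l - 2 * (\<Sum>j<k. h (2 * real j)) * alpha t l
       - 2 * (\<Sum>j<k. h (2 * real j + 1)) * alpha s l)
     \<and> B ((f ^^ k) v) (alpha t) = h (2 * real k) \<and> B ((f ^^ k) v) (alpha s) = - h (2 * real k - 1)" for k
  proof (induction k)
    case 0 show ?case using h0 by (simp add: a_def b_def)
  next
    case (Suc k)
    define w where "w = (f ^^ k) v"
    have wt: "B w (alpha t) = h (2 * real k)" and ws: "B w (alpha s) = - h (2 * real k - 1)"
      using Suc by (auto simp: w_def)
    have r1: "h (2 * real k + 1) = 2 * C * h (2 * real k) - h (2 * real k - 1)" by (rule rec)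
    have r2: "h (2 * real k + 2) = 2 * C * h (2 * real k + 1) - h (2 * real k)"
      using rec[of "2 * real k + 1"] by (simp add: algebra_simps)
    have "B (refl (alpha t) w) (alpha s) = h (2 * real k + 1)"
      using r1 by (simp add: B_refl1 wt ws B_alpha_alpha assms bs)
    then have fw: "f w = (\<lambda>l. w l - 2 * h (2 * real k) * alpha t l - 2 * h (2 * real k + 1) * alpha s l)"
      unfolding f_def refl_def[of "alpha s"] by (simp add: refl_def wt)
    have "(f ^^ Suc k) v = f w" by (simp add: w_def)
    moreover have "B (f w) (alpha t) = h (2 * real (Suc k))"
      unfolding fw using r2 by (simp add: B_simps wt ws B_alpha_alpha assms bs algebra_simps)
    moreover have "B (f w) (alpha s) = - h (2 * real (Suc k) - 1)"
      unfolding fw using r1 by (simp add: B_simps wt ws B_alpha_alpha assms bs algebra_simps)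
    moreover have "f w = (\<lambda>l. v l - 2 * (\<Sum>j<Suc k. h (2 * real j)) * alpha t l
       - 2 * (\<Sum>j<Suc k. h (2 * real j + 1)) * alpha s l)"
      unfolding fw using Suc by (auto simp: w_def algebra_simps)
    ultimately show ?case by simp
  qed
  have "(2 * real m + x) * th = x * th + 2 * pi" for x using mth by (simp add: algebra_simps)
  then have per: "H (2 * real m + x) = H x" for x unfolding H_def by simp
  have s1: "2 * sin th * (\<Sum>j<k. h (2 * real j)) = H (2 * real k - 1) - H (-1)" for k
  proof (induction k)
    case (Suc k) then show ?case using tele[of "2 * real k"] by (simp add: algebra_simps)
  qed simp
  have s2: "2 * sin th * (\<Sum>j<k. h (2 * real j + 1)) = H (2 * real k) - H 0" for k
  proof (induction k)
    case (Suc k) then show ?case using tele[of "2 * real k + 1"] by (simp add: algebra_simps)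
  qed simp
  have z1: "(\<Sum>j<m. h (2 * real j)) = 0" using s1[of m] per[of "-1"] sin0 by simp
  have z2: "(\<Sum>j<m. h (2 * real j + 1)) = 0" using s2[of m] per[of 0] sin0 by simp
  have "(f ^^ m) v = v" using main[of m] z1 z2 by simp
  moreover have "act_word (concat (replicate k [s, t])) v = (f ^^ k) v" for k
    by (induction k) (simp_all add: f_def)
  ultimately show ?thesis by (simp add: m_def)
qed

lemma cong_act_word: "coxeter_cong S cm xs ys \<Longrightarrow> act_word xs v = act_word ys v"
proof (induction arbitrary: v rule: coxeter_cong.induct)
  case (relator s t xs ys)
  then show ?case by (simp add: dihedral_relation)
qed (metis+)

definition act :: "'a \<Rightarrow> ('a \<Rightarrow> real) \<Rightarrow> 'a \<Rightarrow> real" where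
  "act w v = act_word (SOME xs. set xs \<subseteq> S \<and> prd xs = w) v"

lemma act_prd: assumes "set xs \<subseteq> S" shows "act (prd xs) v = act_word xs v"
proof -
  define ys where "ys = (SOME ys. set ys \<subseteq> S \<and> prd ys = prd xs)"
  have "set ys \<subseteq> S \<and> prd ys = prd xs" unfolding ys_def by (rule someI) (use assms in auto)
  then show ?thesis using assms cong_act_word[of ys xs v] cm_cong[of ys xs] by (simp add: act_def ys_def)
qed

lemma act_one [simp]: "act \<one> v = v"
  using act_prd[of "[]"] by simp

lemma act_mult [simp]:
  assumes "x \<in> carrier W" "y \<in> carrier W" shows "act (x \<otimes> y) v = act x (act y v)"
proof -
  obtain xs ys where "set xs \<subseteq> S" "prd xs = x" "set ys \<subseteq> S" "prd ys = y"
    using word_exists[OF assms(1)] word_exists[OF assms(2)] by blast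
  then show ?thesis using act_prd[of "xs @ ys"] act_prd[of xs] act_prd[of ys] simple_word_closed by simp
qed

lemma act_simple: "s \<in> S \<Longrightarrow> act s v = refl (alpha s) v"
  using act_prd[of "[s]"] simple_closed by simp

lemma act_inv [simp]: "w \<in> carrier W \<Longrightarrow> act (inv w) (act w v) = v"
  "w \<in> carrier W \<Longrightarrow> act w (act (inv w) v) = v"
  by (simp_all flip: act_mult)

lemma act_word_lin: "act_word xs (\<lambda>l. p * x l + q * y l) = (\<lambda>l. p * act_word xs x l + q * act_word xs y l)"
  by (induction xs) (simp_all add: refl_lin)

lemma act_lin: "act w (\<lambda>l. p * x l + q * y l) = (\<lambda>l. p * act w x l + q * act w y l)"
  by (simp add: act_def act_word_lin)

lemma act_scale: "act w (\<lambda>l. p * x l) = (\<lambda>l. p * act w x l)"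
  using act_lin[of w p x 0 x] by simp

lemma act_neg: "act w (\<lambda>l. - x l) = (\<lambda>l. - act w x l)"
  using act_scale[of w "-1" x] by simp

lemma act_diff: "act w (\<lambda>l. x l - y l) = (\<lambda>l. act w x l - act w y l)"
  using act_lin[of w 1 x "-1" y] by simp

lemma act_add: "act w (\<lambda>l. x l + y l) = (\<lambda>l. act w x l + act w y l)"
  using act_lin[of w 1 x 1 y] by simp

lemma B_act: assumes "w \<in> carrier W" shows "B (act w x) (act w y) = B x y"
proof -
  obtain xs where xs: "set xs \<subseteq> S" "prd xs = w" using word_exists[OF assms] by blast
  have "B (act_word xs x) (act_word xs y) = B x y" using xs(1)
    by (induction xs) (simp_all add: B_refl B_alpha_alpha bf_self)
  then show ?thesis using xs act_prd by metis
qed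

end

section \<open>Alternating words in two letters\<close>

fun alternating :: "'a \<Rightarrow> 'a \<Rightarrow> nat \<Rightarrow> 'a list" where
  "alternating a b 0 = []"
| "alternating a b (Suc n) = a # alternating b a n"

lemma set_alternating: "set (alternating a b n) \<subseteq> {a, b}"
  by (induction n arbitrary: a b) auto

lemma length_alternating [simp]: "length (alternating a b n) = n"
  by (induction n arbitrary: a b) auto

lemma alternating_add: "\<exists>ys. alternating a b (m + n) = alternating a b m @ ys \<and> set ys \<subseteq> {a, b} \<and> length ys = n"
proof (induction m arbitrary: a b)
  case 0 then show ?case using set_alternating by fastforce
next
  case (Suc m)
  then obtain ys where "alternating b a (m + n) = alternating b a m @ ys" "set ys \<subseteq> {b, a}" "length ys = n"
    by blast
  then show ?case by (intro exI[of _ ys]) auto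
qed

lemma alternating_rev: "alternating a b n @ rev (alternating b a n) = concat (replicate n [a, b])"
proof (induction n arbitrary: a b)
  case (Suc n)
  have "concat (replicate k [b, a]) @ [b] = b # concat (replicate k [a, b])" for k
    by (induction k) auto
  then have "a # concat (replicate n [b, a]) @ [b] = concat (replicate (Suc n) [a, b])" by simp
  have "alternating a b (Suc n) @ rev (alternating b a (Suc n))
      = a # (alternating b a n @ rev (alternating a b n)) @ [b]" by simp
  also have "\<dots> = concat (replicate (Suc n) [a, b])" unfolding Suc using \<open>a # concat (replicate n [b, a]) @ [b] = _\<close> by simp
  finally show ?case .
qed simp

context finite_coxeter
begin

text \<open>The relator splits into one alternating word followed by the inverse of the
  other.\<close>

lemma alternating_braid:
  assumes "s \<in> S" "t \<in> S"
  shows "prd (alternating s t (cm s t)) = prd (alternating t s (cm s t))"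
proof -
  let ?n = "cm s t"
  have sub: "set (alternating s t ?n) \<subseteq> S" "set (alternating t s ?n) \<subseteq> S"
    using set_alternating assms by fastforce+
  have "prd (alternating s t ?n) \<otimes> inv (prd (alternating t s ?n)) = \<one>"
    using relation[OF assms] alternating_rev[of s t ?n] sub
    by (simp add: word_rev_inv simple_word_closed flip: word_prod_append)
  then show ?thesis using sub simple_word_closed
    by (metis inv_closed inv_inv inv_equality word_prod_closed)
qed

text \<open>Equal neighbours would cancel, so a shortest word has to alternate.\<close>

lemma reduced_alternating:
  assumes "a \<in> S" "b \<in> S" "set ys \<subseteq> {a, b}"
    and "\<And>zs. set zs \<subseteq> {a, b} \<Longrightarrow> prd zs = prd ys \<Longrightarrow> length ys \<le> length zs"
  shows "ys = alternating a b (length ys) \<or> ys = alternating b a (length ys)"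
  using assms(3,4)
proof (induction ys)
  case (Cons y ys)
  have red: "length ys \<le> length zs" if "set zs \<subseteq> {a, b}" "prd zs = prd ys" for zs
    using Cons.prems(2)[of "y # zs"] Cons.prems(1) that by simp
  then have IH: "ys = alternating a b (length ys) \<or> ys = alternating b a (length ys)"
    using Cons by simp
  show ?case
  proof (cases ys)
    case Nil then show ?thesis using Cons.prems(1) by auto
  next
    case (Cons z zs)
    have "y \<noteq> z"
    proof
      assume "y = z"
      then have "prd zs = prd (y # ys)"
        using Cons \<open>set (y # ys) \<subseteq> {a, b}\<close> assms(1,2)
        by (subgoal_tac "z \<in> S \<and> set zs \<subseteq> carrier W") auto
      then have "length (y # ys) \<le> length zs" using Cons.prems(2)[of zs] Cons \<open>set (y # ys) \<subseteq> {a, b}\<close> by auto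
      then show False using Cons by simp
    qed
    then show ?thesis using IH Cons Cons.prems(1) by auto
  qed
qed simp

lemma len_simple_mult_left:
  assumes "w \<in> carrier W" "s \<in> S"
  shows "len (s \<otimes> w) = len w + 1 \<or> len w = len (s \<otimes> w) + 1"
proof -
  have "len (s \<otimes> w) = len (inv w \<otimes> s)" using assms len_inv[of "s \<otimes> w"] by (simp add: inv_mult_group)
  then show ?thesis using len_simple_mult[of "inv w" s] assms by simp
qed

lemma inv_cancel_left [simp]:
  "x \<in> carrier W \<Longrightarrow> y \<in> carrier W \<Longrightarrow> inv x \<otimes> (x \<otimes> y) = y"
  "x \<in> carrier W \<Longrightarrow> y \<in> carrier W \<Longrightarrow> x \<otimes> (inv x \<otimes> y) = y"
  by (simp_all flip: m_assoc)

section \<open>Roots\<close>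

definition pos :: "('a \<Rightarrow> real) \<Rightarrow> bool" where "pos v \<longleftrightarrow> (\<forall>l\<in>S. 0 \<le> v l)"
definition neg :: "('a \<Rightarrow> real) \<Rightarrow> bool" where "neg v \<longleftrightarrow> (\<forall>l\<in>S. v l \<le> 0)"

lemma pos_neg [simp]: "pos (\<lambda>l. - v l) = neg v" "neg (\<lambda>l. - v l) = pos v"
  by (auto simp: pos_def neg_def)

lemma refl_neg: "refl (\<lambda>l. - b l) v = refl b v"
  by (simp add: refl_def B_simps)

lemma pos_alpha [simp]: "pos (alpha s)"
  by (simp add: pos_def alpha_def)

lemma pos_comb: "pos v \<Longrightarrow> pos w \<Longrightarrow> 0 \<le> p \<Longrightarrow> 0 \<le> q \<Longrightarrow> pos (\<lambda>l. p * v l + q * w l)"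
  by (simp add: pos_def)

text \<open>Reflecting in turn produces vectors whose coefficients in the two simple roots are
  consecutive values of \<open>U\<close>, the Chebyshev numbers
  \<open>sin (k * pi / m) / sin (pi / m)\<close>. These are nonnegative up to \<open>k = m\<close>.
  For an infinite entry of the Coxeter matrix, encoded by \<open>m = 0\<close>, their limit
  \<open>k\<close> takes over.\<close>

lemma dihedral_pos:
  assumes "a \<in> S" "b \<in> S" "a \<noteq> b" "n < cm a b \<or> cm a b = 0"
  shows "\<exists>p q. 0 \<le> p \<and> 0 \<le> q \<and>
     act_word (rev (alternating a b n)) (alpha b) = (\<lambda>l. p * alpha a l + q * alpha b l)"
proof -
  define m where "m = cm a b"
  define U :: "nat \<Rightarrow> real" where
    "U k = (if m = 0 then real k else sin (real k * (pi / real m)) / sin (pi / real m))" for k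
  have m2: "m \<ge> 2 \<or> m = 0" using cm_neq[OF assms(1-3)] by (auto simp: m_def)
  have sin0: "sin (pi / real m) > 0" if "m \<ge> 2"
    using that by (intro sin_gt_zero) (auto simp: divide_less_eq)
  have U0: "U 0 = 0" by (simp add: U_def)
  have U1: "U 1 = 1" using m2 sin0 by (auto simp: U_def)
  have Upos: "0 \<le> U k" if "k \<le> m \<or> m = 0" for k
  proof (cases "m = 0")
    case False
    then have "real k * (pi / real m) \<le> pi" using that by (simp add: divide_simps mult.commute)
    then have "0 \<le> sin (real k * (pi / real m))" by (intro sin_ge_zero) auto
    then show ?thesis using sin0 m2 False by (simp add: U_def)
  qed (simp add: U_def)
  have Urec: "U (k + 2) = - 2 * bf a b * U (k + 1) - U k" for k
  proof (cases "m = 0")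
    case True then show ?thesis by (simp add: U_def bf_def m_def)
  next
    case False
    define x where "x = real k * (pi / real m)"
    define th where "th = pi / real m"
    have "sin (x + 2 * th) = 2 * cos th * sin (x + th) - sin x"
    proof -
      have "sin (x + 2 * th) + sin x = sin ((x + th) + th) + sin ((x + th) - th)" by (simp add: algebra_simps)
      also have "\<dots> = 2 * cos th * sin (x + th)"
        unfolding sin_add[of "x + th"] sin_diff by simp
      finally show ?thesis by simp
    qed
    moreover have "real (k + 2) * (pi / real m) = x + 2 * th" "real (k + 1) * (pi / real m) = x + th"
      by (simp_all add: x_def th_def algebra_simps add_divide_distrib)
    ultimately have "sin (real (k + 2) * (pi / real m))
        = 2 * cos th * sin (real (k + 1) * (pi / real m)) - sin (real k * (pi / real m))"
      by (simp add: x_def)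
    then show ?thesis using False by (simp only: U_def if_False) (simp add: bf_def m_def th_def diff_divide_distrib)
  qed
  have "\<exists>p q. 0 \<le> p \<and> 0 \<le> q \<and>
     act_word (rev (alternating x y j)) (\<lambda>l. U (k + 1) * alpha y l + U k * alpha x l)
       = (\<lambda>l. p * alpha a l + q * alpha b l)"
    if "j + k + 1 \<le> m \<or> m = 0" "{x, y} = {a, b}" for j k x y
    using that
  proof (induction j arbitrary: k x y)
    case 0
    have pos: "0 \<le> U (k + 1)" "0 \<le> U k" using Upos 0 by auto
    show ?case
    proof (cases "x = a")
      case True then have "y = b" using 0(2) by (auto simp: doubleton_eq_iff)
      then show ?thesis using True pos by (intro exI[of _ "U k"] exI[of _ "U (k + 1)"]) (simp add: add.commute)
    next
      case False then have "y = a" "x = b" using 0(2) by (auto simp: doubleton_eq_iff)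
      then show ?thesis using pos by (intro exI[of _ "U (k + 1)"] exI[of _ "U k"]) simp
    qed
  next
    case (Suc j)
    have xy: "x \<in> S" "y \<in> S" "bf y x = bf a b"
      using Suc.prems(2) assms bf_sym[of a b] by (auto simp: doubleton_eq_iff)
    have e: "U (k + 1 + 1) = - 2 * bf a b * U (k + 1) - U k" using Urec[of k] by simp
    have "refl (alpha x) (\<lambda>l. U (k + 1) * alpha y l + U k * alpha x l)
        = (\<lambda>l. U (k + 1 + 1) * alpha x l + U (k + 1) * alpha y l)"
      unfolding e using xy by (intro ext) (simp add: refl_def B_simps B_alpha_alpha bf_self algebra_simps)
    moreover have "\<exists>p q. 0 \<le> p \<and> 0 \<le> q \<and>
     act_word (rev (alternating y x j)) (\<lambda>l. U (k + 1 + 1) * alpha x l + U (k + 1) * alpha y l)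
       = (\<lambda>l. p * alpha a l + q * alpha b l)"
      using Suc.prems by (intro Suc.IH) auto
    ultimately show ?case by simp
  qed
  from this[of n 0 a b] show ?thesis using assms U0 U1 by (simp add: m_def Suc_le_eq)
qed

text \<open>A left descent \<open>t\<close> of \<open>w\<close> is chosen, and \<open>w\<close> is
  split as \<open>y v\<close> with \<open>y\<close> a word in \<open>s\<close> and \<open>t\<close>
  and \<open>v\<close> as short as possible. By induction \<open>inv v\<close> sends both simple
  roots to positive vectors. The word \<open>y\<close> alternates, does not start with
  \<open>s\<close> and is too short for the braid relation, which is the situation of
  \<open>dihedral_pos\<close>.\<close>

lemma root_pos_left:
  assumes "w \<in> carrier W" "s \<in> S" "len w < len (s \<otimes> w)"
  shows "pos (act (inv w) (alpha s))"
  using assms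
proof (induction "len w" arbitrary: w s rule: less_induct)
  case less
  show ?case
  proof (cases "w = \<one>")
    case True then show ?thesis by (simp add: pos_def alpha_def)
  next
    case False
    obtain xs where xs: "set xs \<subseteq> S" "prd xs = w" "length xs = len w" using reduced_exists[OF less.prems(1)] .
    with False obtain t zs where t: "xs = t # zs" by (cases xs) auto
    have tS: "t \<in> S" "set zs \<subseteq> S" using xs t by auto
    have tw: "t \<otimes> w = prd zs" using xs t tS simple_word_closed by force
    then have ltw: "len (t \<otimes> w) < len w" using len_le[OF tS(2)] xs t by simp
    then have st: "s \<noteq> t" using less.prems by auto
    \<comment> \<open>\<open>P\<close> holds for what remains of \<open>w\<close> after splitting
      off on the left, with additive lengths, a word in \<open>s\<close> and \<open>t\<close>. A
      shortest such remainder has neither \<open>s\<close> nor \<open>t\<close> as a left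
      descent.\<close>
    define P where "P = (\<lambda>v. v \<in> carrier W \<and> (\<exists>ys. set ys \<subseteq> {s, t} \<and> w = prd ys \<otimes> v \<and> len w = length ys + len v))"
    have "P (t \<otimes> w)" unfolding P_def
      using tS less.prems ltw len_simple_mult_left[OF less.prems(1) tS(1)] by (intro conjI exI[of _ "[t]"]) auto
    then obtain v where v: "P v" and vmin: "\<And>v'. P v' \<Longrightarrow> len v \<le> len v'"
      using ex_has_least_nat[of P "t \<otimes> w" len] by blast
    then obtain ys where ys: "set ys \<subseteq> {s, t}" "w = prd ys \<otimes> v" "len w = length ys + len v"
      and vW: "v \<in> carrier W" unfolding P_def by blast
    have ysS: "set ys \<subseteq> S" using ys less.prems tS by auto
    have up: "len v < len (x \<otimes> v)" if "x \<in> {s, t}" for x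
    proof (rule ccontr)
      assume *: "\<not> len v < len (x \<otimes> v)"
      have xS: "x \<in> S" using that less.prems tS by auto
      have l: "len v = len (x \<otimes> v) + 1" using len_simple_mult_left[OF vW xS] * by auto
      have "P (x \<otimes> v)" unfolding P_def
        using xS vW ys that ysS simple_word_closed l by (intro conjI exI[of _ "ys @ [x]"]) (auto simp: m_assoc)
      then show False using vmin[of "x \<otimes> v"] l by simp
    qed
    have lv: "len v < len w" using vmin[OF \<open>P (t \<otimes> w)\<close>] ltw by simp
    \<comment> \<open>Pulling \<open>s\<close> out of \<open>ys\<close> on the left at the cost of a
      letter would make \<open>s \<otimes> w\<close> shorter than \<open>w\<close>.\<close>
    have nos: "False" if "set zs' \<subseteq> S" "prd ys = s \<otimes> prd zs'" "length zs' < length ys" for zs'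
    proof -
      have "s \<otimes> w = prd zs' \<otimes> v" using that ys(2) less.prems(2) vW simple_word_closed by (simp add: m_assoc)
      then have "len (s \<otimes> w) \<le> length zs' + len v"
        using len_mult[of "prd zs'" v] len_le[of zs'] that vW simple_word_closed
        by (metis add_le_mono1 le_trans word_prod_closed)
      then show False using that ys(3) less.prems(3) by simp
    qed
    have "ys = alternating s t (length ys) \<or> ys = alternating t s (length ys)"
    proof (rule reduced_alternating)
      fix zs' assume zs': "set zs' \<subseteq> {s, t}" "prd zs' = prd ys"
      then have "set zs' \<subseteq> S" using less.prems tS by auto
      then have "len w \<le> length zs' + len v"
        using len_mult[of "prd zs'" v] len_le[of zs'] vW simple_word_closed zs' ys(2)
        by (metis add_le_mono1 le_trans word_prod_closed)
      then show "length ys \<le> length zs'" using ys by simp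
    qed (use less.prems tS ys in auto)
    moreover have "ys \<noteq> alternating s t (length ys)" if "ys \<noteq> []"
    proof
      assume a: "ys = alternating s t (length ys)"
      from that obtain n where n: "length ys = Suc n" by (cases ys) auto
      define zs' where "zs' = alternating t s n"
      have "ys = s # zs'" using a n by (simp add: zs'_def)
      then show False using nos[of zs'] ysS by auto
    qed
    ultimately have ya: "ys = alternating t s (length ys)" by (cases "ys = []") auto
    \<comment> \<open>Otherwise \<open>ys\<close> begins with a full alternating word, which the
      braid relation rewrites to start with \<open>s\<close>.\<close>
    have "length ys < cm t s \<or> cm t s = 0"
    proof (rule ccontr)
      assume "\<not> ?thesis"
      then have c: "cm t s \<noteq> 0" "cm t s \<le> length ys" by auto
      obtain rs where rs: "ys = alternating t s (cm t s) @ rs" "set rs \<subseteq> {t, s}" "length rs = length ys - cm t s"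
        using alternating_add[of t s "cm t s" "length ys - cm t s"] c ya by auto
      obtain k where k: "cm t s = Suc k" using c by (cases "cm t s") auto
      have sub: "set rs \<subseteq> S" "set (alternating t s j) \<subseteq> S" "set (alternating s t j) \<subseteq> S" for j
        using rs set_alternating[of t s j] set_alternating[of s t j] less.prems tS by auto
      have "prd ys = prd (alternating s t (cm t s)) \<otimes> prd rs"
        unfolding rs(1) using alternating_braid[OF tS(1) less.prems(2)] sub simple_word_closed by simp
      also have "\<dots> = s \<otimes> prd (alternating t s k @ rs)"
        using k sub simple_word_closed less.prems by (simp add: m_assoc)
      finally have eq: "prd ys = s \<otimes> prd (alternating t s k @ rs)" .
      have "length (alternating t s k @ rs) < length ys" using rs(3) k c(2) by simp
      moreover have "set (alternating t s k @ rs) \<subseteq> S" using sub(1,2) by simp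
      ultimately show False using nos[OF _ eq] by blast
    qed
    then have "\<exists>p q. 0 \<le> p \<and> 0 \<le> q \<and> act_word (rev (alternating t s (length ys))) (alpha s)
        = (\<lambda>l. p * alpha t l + q * alpha s l)"
      by (rule dihedral_pos[OF tS(1) less.prems(2) st[symmetric]])
    then obtain p q where pq: "0 \<le> p" "0 \<le> q"
      "act_word (rev ys) (alpha s) = (\<lambda>l. p * alpha t l + q * alpha s l)"
      unfolding ya[symmetric] by (elim exE conjE) (rule that)
    have "inv w = inv v \<otimes> prd (rev ys)"
      using ys(2) ysS vW simple_word_closed by (simp add: inv_mult_group word_rev_inv)
    then have "act (inv w) (alpha s) = act (inv v) (act_word (rev ys) (alpha s))"
      using ysS vW simple_word_closed act_prd[of "rev ys"] by simp
    also have "\<dots> = (\<lambda>l. p * act (inv v) (alpha t) l + q * act (inv v) (alpha s) l)"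
      unfolding pq act_lin ..
    finally have eq: "act (inv w) (alpha s) = (\<lambda>l. p * act (inv v) (alpha t) l + q * act (inv v) (alpha s) l)" .
    have "pos (act (inv v) (alpha t))" "pos (act (inv v) (alpha s))"
      using less.hyps[OF lv vW] up tS less.prems by auto
    then show ?thesis unfolding eq using pq by (intro pos_comb)
  qed
qed

lemma simple_up_pos:
  assumes "w \<in> carrier W" "s \<in> S" "len w < len (w \<otimes> s)" shows "pos (act w (alpha s))"
proof -
  have "len (s \<otimes> inv w) = len (w \<otimes> s)" using assms len_inv[of "w \<otimes> s"] by (simp add: inv_mult_group)
  then show ?thesis using root_pos_left[of "inv w" s] assms by simp
qed

lemma refl_alpha_self: "s \<in> S \<Longrightarrow> refl (alpha s) (alpha s) = (\<lambda>l. - alpha s l)"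
  by (simp add: refl_self B_alpha_alpha bf_self)

lemma simple_down_neg:
  assumes "w \<in> carrier W" "s \<in> S" "len (w \<otimes> s) < len w" shows "neg (act w (alpha s))"
proof -
  have "pos (act (w \<otimes> s) (alpha s))" using assms by (intro simple_up_pos) (auto simp: m_assoc)
  then show ?thesis using assms by (simp add: act_simple refl_alpha_self act_neg)
qed

definition Phi :: "('a \<Rightarrow> real) set" where "Phi = {act w (alpha s) | w s. w \<in> carrier W \<and> s \<in> S}"

lemma PhiI: "w \<in> carrier W \<Longrightarrow> s \<in> S \<Longrightarrow> act w (alpha s) \<in> Phi"
  unfolding Phi_def by blast

lemma alpha_Phi: "s \<in> S \<Longrightarrow> alpha s \<in> Phi"
  using PhiI[of \<one> s] by simp

lemma act_Phi: assumes "w \<in> carrier W" "b \<in> Phi" shows "act w b \<in> Phi"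
proof -
  obtain x s where "x \<in> carrier W" "s \<in> S" "b = act x (alpha s)" using assms by (auto simp: Phi_def)
  then have "act w b = act (w \<otimes> x) (alpha s)" "w \<otimes> x \<in> carrier W" using assms by auto
  then show ?thesis using \<open>s \<in> S\<close> unfolding Phi_def by blast
qed

lemma Phi_neg: assumes "b \<in> Phi" shows "(\<lambda>l. - b l) \<in> Phi"
proof -
  obtain w s where ws: "w \<in> carrier W" "s \<in> S" "b = act w (alpha s)" using assms by (auto simp: Phi_def)
  have "(\<lambda>l. - b l) = act (w \<otimes> s) (alpha s)" using ws by (simp add: act_simple refl_alpha_self act_neg)
  then show ?thesis using ws unfolding Phi_def by blast
qed

lemma B_Phi: "b \<in> Phi \<Longrightarrow> B b b = 1"
  unfolding Phi_def by (auto simp: B_act B_alpha_alpha bf_self)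

lemma Phi_sign: assumes "b \<in> Phi" shows "pos b \<or> neg b"
proof -
  obtain w s where ws: "w \<in> carrier W" "s \<in> S" "b = act w (alpha s)" using assms by (auto simp: Phi_def)
  then show ?thesis using len_simple_mult[of w s] simple_up_pos[of w s] simple_down_neg[of w s] by auto
qed

lemma Phi_not_both: assumes "b \<in> Phi" "pos b" "neg b" shows False
proof -
  have "\<forall>l\<in>S. b l = 0" using assms by (auto simp: pos_def neg_def intro: antisym)
  then have "B b b = 0" by (simp add: B_def)
  then show False using B_Phi assms by simp
qed

lemma Phi_neg_iff: "b \<in> Phi \<Longrightarrow> neg b \<longleftrightarrow> \<not> pos b"
  using Phi_sign Phi_not_both by blast

lemma Phi_support: assumes "b \<in> Phi" "l \<notin> S" shows "b l = 0"
proof -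
  obtain w s where ws: "w \<in> carrier W" "s \<in> S" "b = act w (alpha s)" using assms by (auto simp: Phi_def)
  obtain xs where xs: "set xs \<subseteq> S" "prd xs = w" using word_exists[OF ws(1)] by blast
  have "act_word xs (alpha s) l = 0" using xs(1)
  proof (induction xs)
    case Nil
    have "l \<noteq> s" using ws(2) assms(2) by blast
    then show ?case by (simp add: alpha_def)
  next
    case (Cons x xs)
    then have "l \<noteq> x" using assms(2) by auto
    then show ?case using Cons by (simp add: refl_def alpha_def)
  qed
  then show ?thesis using ws(3) xs(2) act_prd[OF xs(1), of "alpha s"] by simp
qed

lemma Phi_parallel:
  assumes "b \<in> Phi" "b' \<in> Phi" "pos b" "pos b'" "b = (\<lambda>l. k * b' l)" shows "b = b'"
proof -
  have "B b b = k * k * B b' b'" unfolding assms(5) by (simp add: B_simps)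
  then have "k * k = 1" using B_Phi assms by simp
  then have "k = 1 \<or> k = -1" by (simp add: power2_eq_1_iff flip: power2_eq_square)
  moreover have "k \<noteq> -1"
  proof
    assume "k = -1"
    then have "neg b" using assms by simp
    then show False using Phi_not_both assms by blast
  qed
  ultimately show ?thesis using assms(5) by simp
qed

lemma refl_eq_root:
  assumes "b \<in> Phi" "b' \<in> Phi" "pos b" "pos b'" "refl b b = refl b' b" shows "b = b'"
proof -
  have e: "- b l = b l - 2 * B b b' * b' l" for l
    using fun_cong[OF assms(5), of l] assms B_Phi by (simp add: refl_self refl_def)
  have "b l = B b b' * b' l" for l using e[of l] by simp
  then have "b = (\<lambda>l. B b b' * b' l)" by (rule ext)
  then show ?thesis by (rule Phi_parallel[OF assms(1-4)])
qed

section \<open>Reflections and their positive roots\<close>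

definition T :: "'a set" where "T = reflections W S"

text \<open>Characterized by the action instead of a conjugating element, so that it depends on
  \<open>t\<close> alone; \<open>refl_eq_root\<close> gives uniqueness.\<close>

definition rt :: "'a \<Rightarrow> 'a \<Rightarrow> real" where
  "rt t = (SOME b. b \<in> Phi \<and> pos b \<and> (\<forall>v. act t v = refl b v))"

lemma T_I: "w \<in> carrier W \<Longrightarrow> s \<in> S \<Longrightarrow> w \<otimes> s \<otimes> inv w \<in> T"
  unfolding T_def reflections_def by blast

lemma T_E:
  assumes "t \<in> T" obtains w s where "w \<in> carrier W" "s \<in> S" "t = w \<otimes> s \<otimes> inv w"
  using assms unfolding T_def reflections_def by blast

lemma simple_T [simp, intro]: "s \<in> S \<Longrightarrow> s \<in> T"
  using T_I[of \<one> s] by simp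

lemma T_closed [simp, intro]: "t \<in> T \<Longrightarrow> t \<in> carrier W"
  by (erule T_E) simp

lemma T_conj [intro]: assumes "t \<in> T" "w \<in> carrier W" shows "w \<otimes> t \<otimes> inv w \<in> T"
proof -
  obtain x s where xs: "x \<in> carrier W" "s \<in> S" "t = x \<otimes> s \<otimes> inv x" using T_E[OF assms(1)] .
  then have "w \<otimes> t \<otimes> inv w = (w \<otimes> x) \<otimes> s \<otimes> inv (w \<otimes> x)" using assms by (simp add: m_assoc inv_mult_group)
  then show ?thesis using T_I[of "w \<otimes> x" s] xs assms by simp
qed

lemma T_square [simp]: assumes "t \<in> T" shows "t \<otimes> t = \<one>"
proof -
  obtain x s where xs: "x \<in> carrier W" "s \<in> S" "t = x \<otimes> s \<otimes> inv x" using T_E[OF assms] .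
  then show ?thesis by (simp add: m_assoc)
qed

lemma T_square' [simp]: "t \<in> T \<Longrightarrow> x \<in> carrier W \<Longrightarrow> t \<otimes> (t \<otimes> x) = x"
  by (simp flip: m_assoc)

lemma T_inv [simp]: "t \<in> T \<Longrightarrow> inv t = t"
  by (rule inv_equality) auto

lemma T_conj_T [simp]: "w \<in> T \<Longrightarrow> t \<in> T \<Longrightarrow> w \<otimes> t \<otimes> w \<in> T"
  using T_conj[of t w] by simp

lemma rt: assumes "t \<in> T" shows "rt t \<in> Phi" "pos (rt t)" "act t v = refl (rt t) v"
proof -
  obtain x s where xs: "x \<in> carrier W" "s \<in> S" "t = x \<otimes> s \<otimes> inv x" using T_E[OF assms] .
  define b where "b = act x (alpha s)"
  have bP: "b \<in> Phi" using xs by (auto simp: b_def Phi_def)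
  have rb: "act t v = refl b v" for v
  proof -
    have "act t v = act x (refl (alpha s) (act (inv x) v))" using xs by (simp add: act_simple)
    also have "\<dots> = (\<lambda>l. act x (act (inv x) v) l - 2 * B (act (inv x) v) (alpha s) * act x (alpha s) l)"
      unfolding refl_def act_diff act_scale ..
    also have "B (act (inv x) v) (alpha s) = B v b"
      using B_act[OF xs(1), of "act (inv x) v" "alpha s"] xs by (simp add: b_def)
    finally show ?thesis using xs by (simp add: refl_def b_def)
  qed
  have "\<exists>b. b \<in> Phi \<and> pos b \<and> (\<forall>v. act t v = refl b v)"
  proof (cases "pos b")
    case True then show ?thesis using bP rb by blast
  next
    case False
    then have "pos (\<lambda>l. - b l)" using Phi_sign[OF bP] by simp
    then show ?thesis using Phi_neg[OF bP] rb by (intro exI[of _ "\<lambda>l. - b l"]) (simp add: refl_neg)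
  qed
  then have "rt t \<in> Phi \<and> pos (rt t) \<and> (\<forall>v. act t v = refl (rt t) v)" unfolding rt_def by (rule someI_ex)
  then show "rt t \<in> Phi" "pos (rt t)" "act t v = refl (rt t) v" by auto
qed

lemma rt_eqI: assumes "t \<in> T" "b \<in> Phi" "pos b" "\<And>v. act t v = refl b v" shows "rt t = b"
  using refl_eq_root[of "rt t" b] rt[OF assms(1)] assms by metis

lemma rt_simple: "s \<in> S \<Longrightarrow> rt s = alpha s"
  by (rule rt_eqI) (auto simp: alpha_Phi act_simple)

lemma B_rt [simp]: "t \<in> T \<Longrightarrow> B (rt t) (rt t) = 1"
  using rt B_Phi by blast

lemma act_rt_self: "t \<in> T \<Longrightarrow> act t (rt t) = (\<lambda>l. - rt t l)"
  by (simp add: rt refl_self)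

lemma act_rt_Phi: "w \<in> carrier W \<Longrightarrow> t \<in> T \<Longrightarrow> act w (rt t) \<in> Phi"
  using rt act_Phi by blast

lemma act_conj_refl:
  assumes "w \<in> carrier W" "t \<in> T" shows "act (w \<otimes> t \<otimes> inv w) v = refl (act w (rt t)) v"
proof -
  have "act (w \<otimes> t \<otimes> inv w) v = act w (refl (rt t) (act (inv w) v))" using assms by (simp add: rt)
  also have "\<dots> = (\<lambda>l. act w (act (inv w) v) l - 2 * B (act (inv w) v) (rt t) * act w (rt t) l)"
    unfolding refl_def act_diff act_scale ..
  also have "B (act (inv w) v) (rt t) = B v (act w (rt t))"
    using B_act[OF assms(1), of "act (inv w) v" "rt t"] assms by simp
  finally show ?thesis using assms by (simp add: refl_def)
qed

lemma rt_conj: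
  assumes "w \<in> carrier W" "t \<in> T" "pos (act w (rt t))" shows "rt (w \<otimes> t \<otimes> inv w) = act w (rt t)"
  by (rule rt_eqI[OF T_conj act_rt_Phi _ act_conj_refl]) (use assms in auto)

lemma descent_exists:
  assumes "w \<in> carrier W" "w \<noteq> \<one>" obtains s where "s \<in> S" "len (w \<otimes> s) < len w"
proof -
  obtain xs where xs: "set xs \<subseteq> S" "prd xs = w" "length xs = len w" using reduced_exists[OF assms(1)] .
  with assms obtain ys s where ys: "xs = ys @ [s]" by (cases xs rule: rev_cases) auto
  have "w \<otimes> s = prd ys" using xs ys simple_word_closed by (auto simp: m_assoc)
  then have "len (w \<otimes> s) < len w" using len_le[of ys] xs ys by simp
  then show ?thesis using that xs ys by auto
qed

text \<open>A nontrivial element has a descent and so sends a simple root to a negative one. Applied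
  to quotients, this turns equal actions into equal elements.\<close>

lemma faithful: assumes "w \<in> carrier W" "\<And>s. s \<in> S \<Longrightarrow> pos (act w (alpha s))" shows "w = \<one>"
proof (rule ccontr)
  assume "w \<noteq> \<one>"
  then obtain s where s: "s \<in> S" "len (w \<otimes> s) < len w" using descent_exists assms(1) by blast
  then have "neg (act w (alpha s))" using simple_down_neg assms(1) by blast
  then show False using assms s Phi_not_both act_Phi alpha_Phi by blast
qed

lemma rt_inj: assumes "t \<in> T" "t' \<in> T" "rt t = rt t'" shows "t = t'"
proof -
  have "act (t \<otimes> t') v = v" for v using assms by (simp add: rt refl_refl)
  then have "t \<otimes> t' = \<one>" using assms by (intro faithful) (auto simp: pos_def alpha_def)
  then show ?thesis using assms T_closed T_inv inv_equality by metis
qed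

text \<open>A simple reflection changes only its own coordinate, so a positive root that it makes
  negative has no other nonzero coordinate.\<close>

lemma simple_neg_root:
  assumes "s \<in> S" "b \<in> Phi" "pos b" "neg (refl (alpha s) b)" shows "b = alpha s"
proof -
  have z: "b l = 0" if "l \<noteq> s" for l
  proof (cases "l \<in> S")
    case True
    have "refl (alpha s) b l = b l" using that by (simp add: refl_def alpha_def)
    moreover have "0 \<le> b l" "refl (alpha s) b l \<le> 0" using assms(3,4) True by (simp_all add: pos_def neg_def)
    ultimately show ?thesis by simp
  qed (use Phi_support assms in auto)
  have "b = (\<lambda>l. b s * alpha s l)" using z by (auto simp: alpha_def)
  moreover have "pos (alpha s)" by (simp add: pos_def alpha_def)
  ultimately show ?thesis using Phi_parallel[OF assms(2) alpha_Phi[OF assms(1)] assms(3)] by blast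
qed

text \<open>The root of \<open>t\<close> is followed through the word from right to left. At a
  letter that turns it negative it must be the simple root of that letter by
  \<open>simple_neg_root\<close>, and deleting this letter multiplies the product by
  \<open>t\<close>.\<close>

lemma strong_exchange:
  assumes "t \<in> T" "set xs \<subseteq> S" "neg (act (prd xs) (rt t))"
  shows "\<exists>ys. set ys \<subseteq> S \<and> length ys < length xs \<and> prd ys = prd xs \<otimes> t"
  using assms(2,3)
proof (induction xs)
  case Nil then show ?case using rt[OF assms(1)] Phi_not_both by auto
next
  case (Cons x xs)
  have xS: "x \<in> S" "set xs \<subseteq> S" "prd xs \<in> carrier W" using Cons simple_word_closed by auto
  show ?case
  proof (cases "neg (act (prd xs) (rt t))")
    case True
    then obtain ys where "set ys \<subseteq> S" "length ys < length xs" "prd ys = prd xs \<otimes> t" using Cons xS by blast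
    then show ?thesis using xS assms by (intro exI[of _ "x # ys"]) (auto simp: m_assoc)
  next
    case False
    then have p: "pos (act (prd xs) (rt t))" using Phi_sign act_rt_Phi xS assms by blast
    have "neg (refl (alpha x) (act (prd xs) (rt t)))" using Cons.prems xS by (simp add: act_simple)
    then have "act (prd xs) (rt t) = alpha x"
      using simple_neg_root p xS act_rt_Phi assms by blast
    then have "rt (prd xs \<otimes> t \<otimes> inv (prd xs)) = rt x" using rt_conj p xS assms rt_simple by simp
    then have "prd xs \<otimes> t \<otimes> inv (prd xs) = x" using rt_inj xS assms by auto
    then have "prd xs \<otimes> t = x \<otimes> prd xs" using xS assms by (auto simp: m_assoc)
    then have "prd (x # xs) \<otimes> t = prd xs" using xS assms by (simp add: m_assoc)
    then show ?thesis using xS by (intro exI[of _ xs]) auto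
  qed
qed

lemma len_refl_neg:
  assumes "u \<in> carrier W" "t \<in> T" "neg (act u (rt t))" shows "len (u \<otimes> t) < len u"
proof -
  obtain xs where xs: "set xs \<subseteq> S" "prd xs = u" "length xs = len u" using reduced_exists[OF assms(1)] .
  then obtain ys where "set ys \<subseteq> S" "length ys < length xs" "prd ys = u \<otimes> t"
    using strong_exchange[OF assms(2) xs(1)] assms(3) by auto
  then show ?thesis using len_le[of ys] xs by simp
qed

lemma len_refl_pos:
  assumes "u \<in> carrier W" "t \<in> T" "pos (act u (rt t))" shows "len u < len (u \<otimes> t)"
proof -
  have "neg (act (u \<otimes> t) (rt t))" using assms by (simp add: act_rt_self act_neg)
  then show ?thesis using len_refl_neg[of "u \<otimes> t" t] assms by (simp add: m_assoc)
qed

lemma pos_iff_len: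
  assumes "u \<in> carrier W" "t \<in> T" shows "pos (act u (rt t)) \<longleftrightarrow> len u < len (u \<otimes> t)"
  using len_refl_pos[OF assms] len_refl_neg[OF assms] Phi_sign[OF act_rt_Phi[OF assms]] by auto

lemma neg_iff_len:
  assumes "u \<in> carrier W" "t \<in> T" shows "neg (act u (rt t)) \<longleftrightarrow> len (u \<otimes> t) < len u"
  using len_refl_pos[OF assms] len_refl_neg[OF assms] Phi_sign[OF act_rt_Phi[OF assms]] by auto

lemma rt_conj_simple:
  assumes "s \<in> S" "t \<in> T" "t \<noteq> s"
  shows "rt (s \<otimes> t \<otimes> s) = refl (alpha s) (rt t)" "pos (refl (alpha s) (rt t))"
proof -
  have "\<not> neg (refl (alpha s) (rt t))"
    using simple_neg_root[of s "rt t"] rt[OF assms(2)] rt_inj[OF assms(2), of s] rt_simple assms by auto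
  then show p: "pos (refl (alpha s) (rt t))"
    using Phi_sign act_rt_Phi[of s t] assms by (auto simp: act_simple)
  then show "rt (s \<otimes> t \<otimes> s) = refl (alpha s) (rt t)" using rt_conj[of s t] assms by (simp add: act_simple)
qed

text \<open>If the reflections commute, \<open>t\<close> maps the root of \<open>t'\<close> to plus
  or minus itself, and minus would make the two roots parallel.\<close>

lemma commute_iff:
  assumes "t \<in> T" "t' \<in> T" "t \<noteq> t'" shows "t \<otimes> t' = t' \<otimes> t \<longleftrightarrow> B (rt t) (rt t') = 0"
proof
  assume c: "t \<otimes> t' = t' \<otimes> t"
  then have tt: "t \<otimes> t' \<otimes> inv t = t'" using assms by (simp add: m_assoc)
  have P: "act t (rt t') \<in> Phi" using assms act_rt_Phi by simp
  have "\<not> neg (act t (rt t'))"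
  proof
    assume "neg (act t (rt t'))"
    have "act t' v = refl (\<lambda>l. - act t (rt t') l) v" for v
      using act_conj_refl[OF T_closed[OF assms(1)] assms(2), of v] unfolding tt refl_neg .
    then have "rt t' = (\<lambda>l. - act t (rt t') l)"
      by (intro rt_eqI[OF assms(2) Phi_neg[OF P]]) (use \<open>neg (act t (rt t'))\<close> in simp_all)
    then have e: "rt t' l = - (rt t' l - 2 * B (rt t') (rt t) * rt t l)" for l
      using rt(3)[OF assms(1)] by (metis refl_def)
    have "rt t' l = B (rt t') (rt t) * rt t l" for l using e[of l] by simp
    then have "rt t' = (\<lambda>l. B (rt t') (rt t) * rt t l)" by (rule ext)
    then have "rt t' = rt t" by (rule Phi_parallel[rotated 4]) (use rt assms in auto)
    then show False using rt_inj assms by metis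
  qed
  then have "pos (act t (rt t'))" using P Phi_sign by blast
  then have "rt t' = act t (rt t')" using rt_conj[of t t'] assms tt by simp
  then have "B (rt t') (rt t) * rt t l = 0" for l
    using rt(3)[OF assms(1), of "rt t'"] by (auto simp: refl_def fun_eq_iff)
  moreover obtain l where "rt t l \<noteq> 0"
  proof -
    have "B (\<lambda>l. 0) (\<lambda>l. 0) = 0" by (simp add: B_def)
    then have "rt t \<noteq> (\<lambda>l. 0)" using B_rt[OF assms(1)] by auto
    then show ?thesis using that by auto
  qed
  ultimately show "B (rt t) (rt t') = 0" using B_sym by (metis mult_eq_0_iff)
next
  assume "B (rt t) (rt t') = 0"
  then have "act t (rt t') = rt t'" using assms B_sym[of "rt t"] by (simp add: rt refl_def)
  then have "rt (t \<otimes> t' \<otimes> inv t) = rt t'" using rt_conj[of t t'] rt[OF assms(2)] assms by simp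
  then have "t \<otimes> t' \<otimes> t = t'" using rt_inj[of "t \<otimes> t' \<otimes> inv t" t'] assms by auto
  then show "t \<otimes> t' = t' \<otimes> t" using assms
    by (metis T_closed T_square' m_assoc m_closed)
qed

end

section \<open>Linear algebra: nondegeneracy and reflection factorizations of Coxeter
  elements\<close>

text \<open>Gaussian elimination: \<open>h\<close> removes a variable \<open>k\<close> with
  \<open>f k \<noteq> 0\<close> from the remaining equations, and the value at \<open>k\<close> is
  recovered from the equation of \<open>f\<close>.\<close>

lemma common_zero:
  fixes fs :: "('a \<Rightarrow> real) list"
  assumes "finite A" "length fs < card A"
  shows "\<exists>x. (\<exists>l\<in>A. x l \<noteq> 0) \<and> (\<forall>f\<in>set fs. (\<Sum>l\<in>A. f l * x l) = 0)"
  using assms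
proof (induction fs arbitrary: A rule: measure_induct_rule[of length])
  case (less fs)
  show ?case
  proof (cases fs)
    case Nil
    then obtain k where "k \<in> A" using less.prems by fastforce
    then show ?thesis using Nil by (intro exI[of _ "\<lambda>l. 1"]) auto
  next
    case (Cons f gs)
    show ?thesis
    proof (cases "\<forall>l\<in>A. f l = 0")
      case True
      obtain x where x: "\<exists>l\<in>A. x l \<noteq> 0" "\<forall>g\<in>set gs. (\<Sum>l\<in>A. g l * x l) = 0"
        using less.IH[of gs A] less.prems Cons by auto
      have "(\<Sum>l\<in>A. f l * x l) = 0" using True by (intro sum.neutral) auto
      then show ?thesis using x Cons by auto
    next
      case False
      then obtain k where k: "k \<in> A" "f k \<noteq> 0" by blast
      define h where "h g = (\<lambda>l. g l - g k / f k * f l)" for g :: "'a \<Rightarrow> real"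
      have "length (map h gs) < card (A - {k})" using less.prems Cons k by simp
      then obtain x where x: "\<exists>l\<in>A - {k}. x l \<noteq> 0" "\<forall>g\<in>set (map h gs). (\<Sum>l\<in>A - {k}. g l * x l) = 0"
        using less.IH[of "map h gs" "A - {k}"] less.prems Cons by auto
      define c where "c = (\<Sum>l\<in>A - {k}. f l * x l)"
      define y where "y = x(k := - c / f k)"
      have sumy: "(\<Sum>l\<in>A. g l * y l) = - g k * c / f k + (\<Sum>l\<in>A - {k}. g l * x l)" for g
        using less.prems k by (subst sum.remove[of A k]) (auto simp: y_def intro!: sum.cong)
      have "(\<Sum>l\<in>A. g l * y l) = 0" if "g \<in> set gs" for g
      proof -
        have "0 = (\<Sum>l\<in>A - {k}. h g l * x l)" using x that by simp
        also have "\<dots> = (\<Sum>l\<in>A - {k}. g l * x l) - g k / f k * c"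
          unfolding h_def c_def sum_distrib_left sum_subtractf[symmetric]
          by (rule sum.cong) (auto simp: algebra_simps)
        finally show ?thesis unfolding sumy by simp
      qed
      moreover have "(\<Sum>l\<in>A. f l * y l) = 0" unfolding sumy using k by (simp flip: c_def)
      moreover have "\<exists>l\<in>A. y l \<noteq> 0" using x(1) by (auto simp: y_def)
      ultimately show ?thesis using Cons by auto
    qed
  qed
qed

context finite_coxeter
begin

lemma act_sum:
  assumes "finite A"
  shows "act w (\<lambda>l. \<Sum>s\<in>A. c s * v s l) = (\<lambda>l. \<Sum>s\<in>A. c s * act w (v s) l)"
  using assms
proof (induction A rule: finite_induct)
  case empty
  show ?case using act_scale[of w 0 "\<lambda>_. 0"] by simp
next
  case (insert s A)
  then show ?case by (simp add: act_add act_scale)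
qed

text \<open>
  A vector in the radical is fixed by \<open>W\<close>, so averaging a coordinate functional over the
  finite group does not change its value on the radical; but an invariant functional vanishes
  on every simple root.
\<close>
lemma nondegenerate:
  assumes "\<And>s. s \<in> S \<Longrightarrow> B x (alpha s) = 0" "l \<in> S" shows "x l = 0"
proof -
  define y where "y = (\<lambda>l. \<Sum>s\<in>S. x s * alpha s l)"
  define f where "f v = (\<Sum>w\<in>carrier W. act w v l)" for v
  have yx: "y k = (if k \<in> S then x k else 0)" for k
    using finite_S by (simp add: y_def alpha_def if_distrib[of "\<lambda>z. _ * z"] cong: if_cong)
  have By: "B y (alpha s) = 0" if "s \<in> S" for s
    using assms(1)[OF that] that by (simp add: B_alpha yx)
  have fix_y: "act w y = y" if w: "w \<in> carrier W" for w
  proof -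
    obtain xs where xs: "set xs \<subseteq> S" "prd xs = w" using word_exists[OF w] by blast
    have "act_word xs y = y" using xs(1) By by (induction xs) (auto simp: refl_def)
    then show ?thesis using xs(2) act_prd[OF xs(1)] by simp
  qed
  have f_inv: "f (act s v) = f v" if "s \<in> S" for s v
  proof -
    have "f (act s v) = (\<Sum>w\<in>carrier W. act (w \<otimes> s) v l)" using that by (simp add: f_def)
    also have "\<dots> = f v" unfolding f_def
      by (rule sum.reindex_bij_witness[of _ "\<lambda>w. w \<otimes> s" "\<lambda>w. w \<otimes> s"]) (use that in \<open>auto simp: m_assoc\<close>)
    finally show ?thesis .
  qed
  have f_alpha: "f (alpha s) = 0" if "s \<in> S" for s
  proof -
    have "f (act s (alpha s)) = - f (alpha s)"
      using that by (simp add: f_def act_simple refl_alpha_self act_neg sum_negf)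
    then show ?thesis using f_inv[OF that, of "alpha s"] by simp
  qed
  have "f y = (\<Sum>w\<in>carrier W. \<Sum>s\<in>S. x s * act w (alpha s) l)"
    unfolding f_def y_def by (simp add: act_sum[OF finite_S])
  also have "\<dots> = (\<Sum>s\<in>S. x s * f (alpha s))"
    unfolding f_def sum_distrib_left by (rule sum.swap)
  also have "\<dots> = 0" using f_alpha by simp
  finally have "f y = 0" .
  moreover have "f y = real (card (carrier W)) * y l" using fix_y by (simp add: f_def)
  moreover have "card (carrier W) \<noteq> 0" using finite_carrier one_closed by (auto simp: card_eq_0_iff)
  ultimately show ?thesis using yx[of l] assms(2) by simp
qed

lemma common_orthogonal:
  assumes "length bs < card S"
  obtains x where "\<exists>l\<in>S. x l \<noteq> 0" "\<And>b. b \<in> set bs \<Longrightarrow> B x b = 0"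
proof -
  obtain x where x: "\<exists>l\<in>S. x l \<noteq> 0"
      "\<forall>f\<in>set (map (\<lambda>b l. B b (alpha l)) bs). (\<Sum>l\<in>S. f l * x l) = 0"
    using common_zero[OF finite_S, of "map (\<lambda>b l. B b (alpha l)) bs"] assms by auto
  have "B x b = 0" if "b \<in> set bs" for b
  proof -
    have "(\<Sum>l\<in>S. B b (alpha l) * x l) = 0" using x(2) that by auto
    then show ?thesis using B_expand[of b x] B_sym[of x b] by (simp add: mult.commute)
  qed
  then show ?thesis using that x(1) by blast
qed

lemma act_word_diff: "set xs \<subseteq> S \<Longrightarrow> l \<notin> set xs \<Longrightarrow> act_word xs v l = v l"
  by (induction xs) (auto simp: refl_def alpha_def)

text \<open>Each letter alters only its own coordinate and occurs once, so nothing can undo its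
  effect: a vector fixed by the product is fixed by every letter.\<close>

lemma coxeter_fixed:
  assumes "distinct bs" "set bs \<subseteq> S" "\<And>l. l \<in> S \<Longrightarrow> act_word bs x l = x l" "s \<in> set bs"
  shows "B x (alpha s) = 0"
  using assms
proof (induction bs)
  case (Cons t bs)
  define y where "y = act_word bs x"
  have tS: "t \<in> S" using Cons by simp
  have "y t = x t" unfolding y_def using Cons.prems by (intro act_word_diff) auto
  then have By: "B y (alpha t) = 0" using Cons.prems(3)[of t] tS by (simp add: refl_def alpha_def flip: y_def)
  then have yx: "y l = x l" if "l \<in> S" for l using Cons.prems(3)[OF that] by (simp add: refl_def flip: y_def)
  then have "B x (alpha t) = B y (alpha t)" by (auto simp: B_def intro!: sum.cong)
  then show ?case using Cons yx By by (cases "s = t") (auto simp: y_def)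
qed simp

lemma act_word_refl_fixed:
  "set ts \<subseteq> T \<Longrightarrow> (\<And>t. t \<in> set ts \<Longrightarrow> B x (rt t) = 0) \<Longrightarrow> act (prd ts) x = x"
proof (induction ts)
  case (Cons t ts)
  then have "set ts \<subseteq> carrier W" by auto
  then show ?case using Cons by (simp add: rt refl_def)
qed simp

lemma T_word_closed: "set ts \<subseteq> T \<Longrightarrow> set ts \<subseteq> carrier W"
  by auto

text \<open>A vector orthogonal to the roots of a factorization is fixed by the product, and
  \<open>coxeter_fixed\<close> converts this back into orthogonality. All dimension counts for
  factorizations rest on this comparison.\<close>

lemma coxeter_orthogonal:
  assumes "distinct bs" "set bs \<subseteq> S" "set ts \<subseteq> T" "prd ts = prd bs"
    and "\<And>t. t \<in> set ts \<Longrightarrow> B x (rt t) = 0" "s \<in> set bs"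
  shows "B x (alpha s) = 0"
proof -
  have "act_word bs x = x" using act_prd[OF assms(2), of x] act_word_refl_fixed[OF assms(3), of x] assms by simp
  then show ?thesis using coxeter_fixed assms by simp
qed

text \<open>With fewer reflections, their roots and the simple roots outside \<open>bs\<close> would
  leave room for a nonzero vector orthogonal to all of them, hence to all simple roots.\<close>

lemma absolute_length_lower:
  assumes "distinct bs" "set bs \<subseteq> S" "set ts \<subseteq> T" "prd ts = prd bs"
  shows "length bs \<le> length ts"
proof (rule ccontr)
  assume *: "\<not> ?thesis"
  obtain cs where cs: "set cs = S - set bs" "distinct cs" using finite_distinct_list[of "S - set bs"] finite_S by auto
  have "length bs = card (set bs)" "length cs = card (S - set bs)"
    using assms cs by (simp_all add: distinct_card flip: cs(1))
  then have "length (map rt ts @ map alpha cs) < card S"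
    using * assms finite_S card_Diff_subset[of "set bs" S] card_mono[of S "set bs"] by simp
  then obtain x where x: "\<exists>l\<in>S. x l \<noteq> 0" "\<And>b. b \<in> set (map rt ts @ map alpha cs) \<Longrightarrow> B x b = 0"
    using common_orthogonal by blast
  have "B x (alpha s) = 0" if "s \<in> S" for s
  proof (cases "s \<in> set bs")
    case True then show ?thesis using coxeter_orthogonal[OF assms, of x] x(2) by auto
  next
    case False then show ?thesis using x(2) cs that by auto
  qed
  then show False using nondegenerate x(1) by blast
qed

text \<open>For a shortest factorization the count leaves room for dropping one more simple root:
  some nonzero \<open>x\<close> is orthogonal to all factors and to all simple roots except
  \<open>alpha k\<close>. Pairing it with \<open>rt t\<close> reads off the coordinate at
  \<open>k\<close>. So the factors stay in the parabolic subgroup of \<open>bs\<close>.\<close>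

lemma factorization_support:
  assumes "distinct bs" "set bs \<subseteq> S" "set ts \<subseteq> T" "prd ts = prd bs" "length ts = length bs"
    and "t \<in> set ts" "k \<notin> set bs"
  shows "rt t k = 0"
proof (cases "k \<in> S")
  case True
  obtain cs where cs: "set cs = S - set bs - {k}" "distinct cs"
    using finite_distinct_list[of "S - set bs - {k}"] finite_S by auto
  have "length bs = card (set bs)" "length cs = card (S - set bs - {k})"
    using assms cs by (simp_all add: distinct_card flip: cs(1))
  moreover have "card (S - set bs - {k}) < card (S - set bs)"
    using True assms finite_S by (intro psubset_card_mono) auto
  moreover have "card (S - set bs) + card (set bs) = card S"
    using assms finite_S card_Diff_subset[of "set bs" S] card_mono[of S "set bs"] by simp
  ultimately have "length (map rt ts @ map alpha cs) < card S" using assms by simp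
  then obtain x where x: "\<exists>l\<in>S. x l \<noteq> 0" "\<And>b. b \<in> set (map rt ts @ map alpha cs) \<Longrightarrow> B x b = 0"
    using common_orthogonal by blast
  have z: "B x (alpha s) = 0" if "s \<in> S" "s \<noteq> k" for s
  proof (cases "s \<in> set bs")
    case True then show ?thesis using coxeter_orthogonal[OF assms(1-4), of x] x(2) by auto
  next
    case False then show ?thesis using x(2) cs that by auto
  qed
  then have nz: "B x (alpha k) \<noteq> 0" using nondegenerate[of x] x(1) by metis
  have "0 = B x (rt t)" using x(2) assms(6) by simp
  also have "\<dots> = (\<Sum>j\<in>S. rt t j * B x (alpha j))" by (rule B_expand)
  also have "\<dots> = (\<Sum>j\<in>{k}. rt t j * B x (alpha j))"
    using z True finite_S by (intro sum.mono_neutral_right) auto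
  finally show ?thesis using nz by simp
next
  case False then show ?thesis using Phi_support rt(1) assms by blast
qed

section \<open>Concordant factorizations\<close>

definition coxeter_word :: "'a list \<Rightarrow> bool" where
  "coxeter_word bs \<longleftrightarrow> distinct bs \<and> set bs \<subseteq> S"

text \<open>
  The recursions peel off the last letter of \<open>c\<close>, so \<open>c\<close> is given by a word of its inverse.
\<close>
definition factorizations :: "'a list \<Rightarrow> 'a list set" where
  "factorizations bs = {ts. set ts \<subseteq> T \<and> length ts = length bs \<and> prd ts = prd (rev bs)}"

fun conc :: "'a \<Rightarrow> 'a list \<Rightarrow> bool" where
  "conc u [] \<longleftrightarrow> True"
| "conc u (t # ts) \<longleftrightarrow> pos (act u (rt t)) \<and> conc (u \<otimes> t) ts"

definition Conc :: "'a list \<Rightarrow> 'a \<Rightarrow> 'a list set" where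
  "Conc bs u = {ts \<in> factorizations bs. conc u ts}"

abbreviation conj :: "'a \<Rightarrow> 'a \<Rightarrow> 'a" where "conj s t \<equiv> s \<otimes> t \<otimes> s"

lemma coxeter_word_Cons:
  "coxeter_word (s # bs) \<Longrightarrow> s \<in> S \<and> s \<notin> set bs \<and> coxeter_word bs \<and> coxeter_word (bs @ [s])"
  by (auto simp: coxeter_word_def)

lemma conj_simple_neq: assumes "s \<in> S" "t \<in> T" "t \<noteq> s" shows "conj s t \<noteq> s"
proof
  assume "conj s t = s"
  then have "s \<otimes> (s \<otimes> t \<otimes> s) \<otimes> s = s" using assms by simp
  then show False using assms by (simp add: m_assoc)
qed

lemma conj_conj [simp]: "s \<in> S \<Longrightarrow> t \<in> T \<Longrightarrow> conj s (conj s t) = t"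
  by (simp add: m_assoc)

lemma conj_self [simp]: "s \<in> S \<Longrightarrow> conj s s = s"
  by simp

lemma map_conj_T: "s \<in> S \<Longrightarrow> set ts \<subseteq> T \<Longrightarrow> set (map (conj s) ts) \<subseteq> T"
  by auto

lemma map_conj_conj: "s \<in> S \<Longrightarrow> set ts \<subseteq> T \<Longrightarrow> map (conj s) (map (conj s) ts) = ts"
  by (induction ts) auto

lemma not_in_map_conj:
  assumes "s \<in> S" "set ts \<subseteq> T" "s \<notin> set ts" shows "s \<notin> set (map (conj s) ts)"
proof
  assume "s \<in> set (map (conj s) ts)"
  then show False unfolding set_map
  proof (rule imageE)
    fix t assume t: "s = conj s t" "t \<in> set ts"
    have "t \<in> T" "t \<noteq> s" using t(2) assms by auto
    from conj_simple_neq[OF assms(1) this] t(1) show False by metis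
  qed
qed

lemma prd_map_conj:
  assumes "s \<in> S" "set ts \<subseteq> T" shows "prd (map (conj s) ts) = s \<otimes> prd ts \<otimes> s"
  using assms(2)
proof (induction ts)
  case (Cons t ts)
  then have "t \<in> T" "prd ts \<in> carrier W" using T_word_closed by auto
  then show ?case using Cons assms(1) by (simp add: m_assoc)
qed (use assms in simp)

lemma conc_append:
  "u \<in> carrier W \<Longrightarrow> set xs \<subseteq> T \<Longrightarrow> conc u (xs @ ys) \<longleftrightarrow> conc u xs \<and> conc (u \<otimes> prd xs) ys"
proof (induction xs arbitrary: u)
  case (Cons x xs)
  then have "prd xs \<in> carrier W" "x \<in> T" using T_word_closed by auto
  then show ?case using Cons by (simp add: m_assoc)
qed simp

lemma conc_conj:
  "u \<in> carrier W \<Longrightarrow> s \<in> S \<Longrightarrow> set ts \<subseteq> T \<Longrightarrow> s \<notin> set ts \<Longrightarrow>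
     conc (u \<otimes> s) (map (conj s) ts) \<longleftrightarrow> conc u ts"
proof (induction ts arbitrary: u)
  case (Cons t ts)
  then have t: "t \<in> T" "t \<noteq> s" by auto
  have "act (u \<otimes> s) (rt (conj s t)) = act u (rt t)"
    using rt_conj_simple[OF Cons.prems(2) t] Cons.prems
    by (simp add: act_simple refl_refl B_alpha_alpha bf_self)
  moreover have "u \<otimes> s \<otimes> conj s t = u \<otimes> t \<otimes> s" using Cons.prems t by (simp add: m_assoc)
  ultimately show ?case using Cons t by simp
qed simp

lemma conc_len:
  "u \<in> carrier W \<Longrightarrow> set ts \<subseteq> T \<Longrightarrow> conc u ts \<Longrightarrow> len u + length ts \<le> len (u \<otimes> prd ts)"
proof (induction ts arbitrary: u)
  case (Cons t ts)
  then have t: "t \<in> T" "prd ts \<in> carrier W" using T_word_closed by auto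
  have "len u < len (u \<otimes> t)" using Cons t by (intro len_refl_pos) auto
  moreover have "len (u \<otimes> t) + length ts \<le> len (u \<otimes> t \<otimes> prd ts)" using Cons t by simp
  ultimately show ?case using Cons.prems t by (simp add: m_assoc)
qed simp

text \<open>This is \<open>coxeter_plus\<close> for the Coxeter element spelled by
  \<open>rev bs\<close>, phrased as concordance of its factorization into simple letters;
  \<open>Plus_iff_len\<close> returns to lengths.\<close>

definition Plus :: "'a list \<Rightarrow> 'a \<Rightarrow> bool" where "Plus bs u \<longleftrightarrow> conc u (rev bs)"

lemma Plus_len:
  assumes "u \<in> carrier W" "set bs \<subseteq> S" "Plus bs u"
  shows "len (u \<otimes> prd (rev bs)) = len u + length bs"
proof -
  have "set (rev bs) \<subseteq> T" using assms by auto
  then have "len u + length bs \<le> len (u \<otimes> prd (rev bs))"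
    using conc_len[of u "rev bs"] assms by (simp add: Plus_def)
  moreover have "len (u \<otimes> prd (rev bs)) \<le> len u + len (prd (rev bs))"
    using assms simple_word_closed by (intro len_mult) auto
  moreover have "len (prd (rev bs)) \<le> length bs" using len_le[of "rev bs"] assms by simp
  ultimately show ?thesis by linarith
qed

lemma Plus_Cons:
  assumes "u \<in> carrier W" "coxeter_word (s # bs)"
  shows "Plus (s # bs) u \<longleftrightarrow> Plus bs u \<and> pos (act (u \<otimes> prd (rev bs)) (alpha s))"
  using assms conc_append[of u "rev bs" "[s]"] rt_simple[of s] by (auto simp: Plus_def coxeter_word_def)

text \<open>Conjugation by \<open>s\<close> moves the last letter of the Coxeter element to the
  front, where it leads from \<open>u \<otimes> s\<close> up to \<open>u\<close>.\<close>

lemma Plus_rotate: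
  assumes "u \<in> carrier W" "coxeter_word (s # bs)" "Plus (s # bs) u" "neg (act u (alpha s))"
  shows "Plus (bs @ [s]) (u \<otimes> s)"
proof -
  have s: "s \<in> S" using assms coxeter_word_Cons by blast
  have "act (u \<otimes> s) (alpha s) = (\<lambda>l. - act u (alpha s) l)"
    using s assms by (simp add: act_simple refl_alpha_self act_neg)
  then show ?thesis using assms Plus_Cons[OF assms(1,2)] s by (simp add: Plus_def m_assoc rt_simple)
qed

lemma factorization_no_simple:
  assumes "coxeter_word (s # bs)" "ts \<in> factorizations bs" shows "s \<notin> set ts"
proof
  assume "s \<in> set ts"
  then have "rt s s = 0"
    using factorization_support[of "rev bs" ts s s] assms by (auto simp: coxeter_word_def factorizations_def)
  then show False using assms by (simp add: rt_simple coxeter_word_def alpha_def)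
qed

text \<open>The root has no coordinate at \<open>s\<close> and nonnegative ones elsewhere, while
  distinct simple roots pair nonpositively.\<close>

lemma factorization_nonpos:
  assumes "coxeter_word (s # bs)" "ts \<in> factorizations bs" "t \<in> set ts" shows "B (alpha s) (rt t) \<le> 0"
proof -
  have s: "s \<in> S" "t \<in> T" using assms by (auto simp: coxeter_word_def factorizations_def)
  have "rt t s = 0"
    using factorization_support[of "rev bs" ts t s] assms by (auto simp: coxeter_word_def factorizations_def)
  moreover have "pos (rt t)" using rt s by blast
  ultimately have "rt t l * bf l s \<le> 0" if "l \<in> S" for l
    using bf_nonpos[OF that s(1)] that by (cases "l = s") (auto simp: pos_def mult_nonneg_nonpos)
  then have "B (rt t) (alpha s) \<le> 0" unfolding B_alpha[OF s(1)] by (intro sum_nonpos)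
  then show ?thesis by (simp add: B_sym)
qed

text \<open>Moving \<open>s\<close> to the right end of the word conjugates the letters it passes;
  dropping it there turns a factorization of \<open>c\<close> into one of
  \<open>c s\<close>.\<close>

definition reduce_at :: "'a \<Rightarrow> 'a list \<Rightarrow> 'a list" where
  "reduce_at s ts = takeWhile (\<lambda>t. t \<noteq> s) ts @ map (conj s) (tl (dropWhile (\<lambda>t. t \<noteq> s) ts))"

lemma reduce_at_append: "s \<notin> set A \<Longrightarrow> reduce_at s (A @ s # Z) = A @ map (conj s) Z"
proof -
  assume "s \<notin> set A"
  then have "takeWhile (\<lambda>t. t \<noteq> s) (A @ s # Z) = A" "dropWhile (\<lambda>t. t \<noteq> s) (A @ s # Z) = s # Z"
    by (induction A) auto
  then show ?thesis by (simp add: reduce_at_def)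
qed

lemma factorization_split:
  assumes "coxeter_word (s # bs)" "ts \<in> factorizations (s # bs)" "s \<in> set ts"
  obtains A Z where "ts = A @ s # Z" "s \<notin> set A" "s \<notin> set Z" "set A \<subseteq> T" "set Z \<subseteq> T"
    "A @ map (conj s) Z \<in> factorizations bs" "reduce_at s ts = A @ map (conj s) Z"
proof -
  obtain A Z where AZ: "ts = A @ s # Z" "s \<notin> set A" using split_list_first[OF assms(3)] by blast
  have s: "s \<in> S" "set bs \<subseteq> S" using assms by (auto simp: coxeter_word_def)
  have sub: "set A \<subseteq> T" "set Z \<subseteq> T" using assms AZ by (auto simp: factorizations_def)
  note cl = T_word_closed[OF sub(1)] T_word_closed[OF sub(2)] T_word_closed[OF map_conj_T[OF s(1) sub(2)]]
    simple_word_closed[OF s(2)]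
  have e: "prd A \<otimes> s \<otimes> prd Z = prd (rev bs) \<otimes> s"
    using assms(2) AZ(1) cl s by (simp add: factorizations_def m_assoc)
  have "prd (A @ map (conj s) Z) = prd A \<otimes> s \<otimes> prd Z \<otimes> s"
    using cl s sub by (simp add: prd_map_conj m_assoc)
  also have "\<dots> = prd (rev bs)" unfolding e using cl s by (simp add: m_assoc)
  finally have "prd (A @ map (conj s) Z) = prd (rev bs)" .
  moreover have "length (A @ map (conj s) Z) = length bs" using assms(2) AZ(1) by (simp add: factorizations_def)
  ultimately have f: "A @ map (conj s) Z \<in> factorizations bs"
    using s cl map_conj_T[OF s(1) sub(2)] sub by (simp add: factorizations_def m_assoc)
  \<comment> \<open>Conjugation by \<open>s\<close> fixes \<open>s\<close>, so a second occurrence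
    would survive into a factorization for \<open>bs\<close>, where \<open>s\<close> does not
    occur.\<close>
  have "s \<notin> set Z"
  proof
    assume "s \<in> set Z"
    then have "conj s s \<in> set (map (conj s) Z)" unfolding set_map by (rule imageI)
    then show False using factorization_no_simple[OF assms(1) f] s by simp
  qed
  then show ?thesis using AZ sub f reduce_at_append[OF AZ(2)] by (intro that[of A Z]) simp_all
qed

lemma conc_split:
  assumes "u \<in> carrier W" "s \<in> S" "set A \<subseteq> T" "set Z \<subseteq> T" "s \<notin> set Z"
  shows "conc u (A @ s # Z) \<longleftrightarrow> conc u (A @ map (conj s) Z) \<and> pos (act (u \<otimes> prd A) (alpha s))"
proof -
  have "prd A \<in> carrier W" using assms T_word_closed by auto
  then show ?thesis
    using assms conc_conj[of "u \<otimes> prd A \<otimes> s" s Z] by (auto simp: conc_append rt_simple m_assoc)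
qed

text \<open>Since the pairings are nonpositive, each reflection adds to \<open>alpha s\<close> a
  nonnegative multiple of a root that concordance makes positive.\<close>

lemma pos_prefix:
  assumes "s \<in> S" "u \<in> carrier W" "set A \<subseteq> T" "\<And>t. t \<in> set A \<Longrightarrow> B (alpha s) (rt t) \<le> 0"
    "conc u A" "pos (act u (alpha s))"
  shows "pos (act (u \<otimes> prd A) (alpha s))"
  using assms(2-)
proof (induction A arbitrary: u)
  case (Cons t A)
  then have t: "t \<in> T" "prd A \<in> carrier W" using T_word_closed by auto
  have eq: "act (u \<otimes> t) (alpha s) = (\<lambda>l. 1 * act u (alpha s) l + (- 2 * B (alpha s) (rt t)) * act u (rt t) l)"
    using act_lin[of u 1 "alpha s" "- 2 * B (alpha s) (rt t)" "rt t"] t Cons.prems by (simp add: rt refl_def)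
  have "pos (act (u \<otimes> t) (alpha s))"
    unfolding eq using Cons.prems(3)[of t] Cons.prems(4,5) by (intro pos_comb) auto
  then have "pos (act (u \<otimes> t \<otimes> prd A) (alpha s))" using Cons t by (intro Cons.IH) auto
  then show ?case using Cons t by (simp add: m_assoc)
qed simp

text \<open>Without \<open>s\<close>, conjugating the factorization would give a concordant one of
  the same length that starts at \<open>u s\<close>, above \<open>u\<close>, and ends at
  \<open>u c s\<close>, below \<open>u c\<close>. The lengths leave no room for that many
  steps.\<close>

lemma up_contains:
  assumes "u \<in> carrier W" "coxeter_word (s # bs)" "Plus (s # bs) u" "pos (act u (alpha s))"
    "ts \<in> Conc (s # bs) u"
  shows "s \<in> set ts"
proof (rule ccontr)
  assume no: "s \<notin> set ts"
  have s: "s \<in> S" "set bs \<subseteq> S" "prd (rev bs) \<in> carrier W" using assms simple_word_closed by (auto simp: coxeter_word_def)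
  have ts: "set ts \<subseteq> T" "length ts = Suc (length bs)" "prd ts = prd (rev bs) \<otimes> s" "conc u ts"
    using assms s simple_word_closed by (auto simp: Conc_def factorizations_def)
  have "conc (u \<otimes> s) (map (conj s) ts)" using conc_conj assms no s ts by simp
  then have "len (u \<otimes> s) + length ts \<le> len (u \<otimes> s \<otimes> prd (map (conj s) ts))"
    using conc_len[of "u \<otimes> s" "map (conj s) ts"] map_conj_T[OF s(1) ts(1)] assms s by simp
  also have "u \<otimes> s \<otimes> prd (map (conj s) ts) = u \<otimes> prd (rev bs)"
    using ts s assms by (simp add: prd_map_conj m_assoc)
  also have "len \<dots> = len u + length bs"
    using Plus_len[of u bs] Plus_Cons[OF assms(1,2)] assms s by simp
  finally show False using len_refl_pos[of u s] assms ts s by (simp add: rt_simple)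
qed

text \<open>Beyond concordance of the shortened word only the step along \<open>s\<close> adds a
  condition, and \<open>pos_prefix\<close> shows that an ascent at \<open>u\<close> fulfils
  it.\<close>

lemma Conc_up:
  assumes "u \<in> carrier W" "coxeter_word (s # bs)" "Plus (s # bs) u" "pos (act u (alpha s))"
  shows "ts \<in> Conc (s # bs) u \<longleftrightarrow> ts \<in> factorizations (s # bs) \<and> s \<in> set ts \<and> reduce_at s ts \<in> Conc bs u"
proof (cases "ts \<in> factorizations (s # bs) \<and> s \<in> set ts")
  case True
  then obtain A Z where AZ: "ts = A @ s # Z" "s \<notin> set A" "s \<notin> set Z" "set A \<subseteq> T" "set Z \<subseteq> T"
    "A @ map (conj s) Z \<in> factorizations bs" "reduce_at s ts = A @ map (conj s) Z"
    using factorization_split[OF assms(2)] by blast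
  have s: "s \<in> S" using assms coxeter_word_Cons by blast
  have "conc u (A @ map (conj s) Z) \<Longrightarrow> pos (act (u \<otimes> prd A) (alpha s))"
    using conc_append[OF assms(1) AZ(4)] factorization_nonpos[OF assms(2) AZ(6)] assms AZ s
    by (intro pos_prefix) auto
  then show ?thesis using True AZ conc_split[OF assms(1) s AZ(4,5,3)] by (auto simp: Conc_def)
next
  case False
  then show ?thesis using up_contains[OF assms] by (auto simp: Conc_def)
qed

lemma conj_factorization:
  assumes "coxeter_word (s # bs)" "ts \<in> factorizations (s # bs)"
  shows "map (conj s) ts \<in> factorizations (bs @ [s])"
proof -
  have s: "s \<in> S" "set bs \<subseteq> S" "prd (rev bs) \<in> carrier W" using assms simple_word_closed by (auto simp: coxeter_word_def)
  have ts: "set ts \<subseteq> T" "length ts = Suc (length bs)" "prd ts = prd (rev bs) \<otimes> s"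
    using assms s simple_word_closed by (auto simp: factorizations_def)
  then show ?thesis using s map_conj_T[OF s(1) ts(1)]
    by (simp add: factorizations_def prd_map_conj m_assoc)
qed

lemma conj_factorization':
  assumes "coxeter_word (s # bs)" "ts \<in> factorizations (bs @ [s])"
  shows "map (conj s) ts \<in> factorizations (s # bs)"
proof -
  have s: "s \<in> S" "set bs \<subseteq> S" "prd (rev bs) \<in> carrier W" using assms simple_word_closed by (auto simp: coxeter_word_def)
  have ts: "set ts \<subseteq> T" "length ts = Suc (length bs)" "prd ts = s \<otimes> prd (rev bs)"
    using assms s simple_word_closed by (auto simp: factorizations_def)
  then show ?thesis using s simple_word_closed map_conj_T[OF s(1) ts(1)]
    by (simp add: factorizations_def prd_map_conj m_assoc)
qed

lemma factorization_Cons: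
  assumes "coxeter_word (s # bs)" "ts \<in> factorizations bs"
  shows "s # ts \<in> factorizations (bs @ [s])"
  using assms simple_word_closed by (auto simp: factorizations_def coxeter_word_def)

text \<open>A concordant factorization may contain \<open>s\<close> even though
  \<open>u \<otimes> s\<close> is shorter. For \<open>ts = A @ s # Z\<close>, both words of the
  second clause ask the shortened word to be concordant with \<open>u\<close>. The conjugate of
  \<open>ts\<close> asks in addition that \<open>u A\<close> send \<open>alpha s\<close> to a
  negative root, where \<open>ts\<close> itself asks for a positive one. In either clause membership
  is thus decided by the set of concordant factorizations at \<open>u \<otimes> s\<close>.\<close>

lemma Conc_down:
  assumes "u \<in> carrier W" "coxeter_word (s # bs)" "neg (act u (alpha s))" "ts \<in> factorizations (s # bs)"
  shows "s \<notin> set ts \<Longrightarrow> ts \<in> Conc (s # bs) u \<longleftrightarrow> map (conj s) ts \<in> Conc (bs @ [s]) (u \<otimes> s)"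
    and "s \<in> set ts \<Longrightarrow> ts \<in> Conc (s # bs) u \<longleftrightarrow>
      s # reduce_at s ts \<in> Conc (bs @ [s]) (u \<otimes> s) \<and> map (conj s) ts \<notin> Conc (bs @ [s]) (u \<otimes> s)"
proof -
  have s: "s \<in> S" using assms coxeter_word_Cons by blast
  have ts: "set ts \<subseteq> T" using assms by (simp add: factorizations_def)
  show "ts \<in> Conc (s # bs) u \<longleftrightarrow> map (conj s) ts \<in> Conc (bs @ [s]) (u \<otimes> s)" if "s \<notin> set ts"
    using conc_conj[OF assms(1) s ts that] conj_factorization[OF assms(2,4)] assms(4) by (simp add: Conc_def)
  assume "s \<in> set ts"
  then obtain A Z where AZ: "ts = A @ s # Z" "s \<notin> set A" "s \<notin> set Z" "set A \<subseteq> T" "set Z \<subseteq> T"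
    "A @ map (conj s) Z \<in> factorizations bs" "reduce_at s ts = A @ map (conj s) Z"
    using factorization_split[OF assms(2,4)] by blast
  have pA: "prd A \<in> carrier W" using AZ T_word_closed by auto
  have su: "act (u \<otimes> s) (alpha s) = (\<lambda>l. - act u (alpha s) l)"
    using s assms by (simp add: act_simple refl_alpha_self act_neg)
  have 1: "s # reduce_at s ts \<in> Conc (bs @ [s]) (u \<otimes> s) \<longleftrightarrow> conc u (A @ map (conj s) Z)"
    using factorization_Cons[OF assms(2) AZ(6)] su assms(1,3) s AZ(7)
    by (simp add: Conc_def rt_simple m_assoc)
  have "act (u \<otimes> s \<otimes> prd (map (conj s) A)) (alpha s) = (\<lambda>l. - act (u \<otimes> prd A) (alpha s) l)"
    using assms(1) s pA prd_map_conj[OF s AZ(4)] by (simp add: act_simple refl_alpha_self act_neg refl_refl B_alpha_alpha bf_self)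
  moreover have "u \<otimes> s \<otimes> prd (map (conj s) A) \<otimes> s = u \<otimes> prd A"
    using assms(1) s pA prd_map_conj[OF s AZ(4)] by (simp add: m_assoc)
  ultimately have "conc (u \<otimes> s) (map (conj s) ts) \<longleftrightarrow>
      conc u (A @ map (conj s) Z) \<and> neg (act (u \<otimes> prd A) (alpha s))"
    using conc_conj[OF assms(1) s AZ(4,2)] map_conj_T[OF s AZ(4)] assms(1) s AZ(1,4)
    by (auto simp: conc_append rt_simple)
  then have 2: "map (conj s) ts \<in> Conc (bs @ [s]) (u \<otimes> s) \<longleftrightarrow>
      conc u (A @ map (conj s) Z) \<and> neg (act (u \<otimes> prd A) (alpha s))"
    using conj_factorization[OF assms(2,4)] by (simp add: Conc_def)
  have 3: "ts \<in> Conc (s # bs) u \<longleftrightarrow> conc u (A @ map (conj s) Z) \<and> pos (act (u \<otimes> prd A) (alpha s))"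
    using conc_split[OF assms(1) s AZ(4,5,3)] assms(4) AZ(1) by (simp add: Conc_def)
  have "act (u \<otimes> prd A) (alpha s) \<in> Phi" using assms pA s by (intro PhiI) auto
  then show "ts \<in> Conc (s # bs) u \<longleftrightarrow>
      s # reduce_at s ts \<in> Conc (bs @ [s]) (u \<otimes> s) \<and> map (conj s) ts \<notin> Conc (bs @ [s]) (u \<otimes> s)"
    unfolding 1 2 3 using Phi_neg_iff by blast
qed

end

section \<open>Commutation equivalence\<close>

context group
begin

lemma commutation_equiv_refl [simp]: "commutation_equiv G xs xs"
  by (simp add: commutation_equiv_def)

lemma commutation_equiv_trans:
  "commutation_equiv G xs ys \<Longrightarrow> commutation_equiv G ys zs \<Longrightarrow> commutation_equiv G xs zs"
  unfolding commutation_equiv_def by (rule rtranclp_trans)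

lemma commutation_step_sym: "commutation_step G xs ys \<Longrightarrow> commutation_step G ys xs"
  unfolding commutation_step_def by metis

lemma commutation_equiv_sym: "commutation_equiv G xs ys \<Longrightarrow> commutation_equiv G ys xs"
  unfolding commutation_equiv_def
  by (induction rule: rtranclp_induct) (auto intro: converse_rtranclp_into_rtranclp commutation_step_sym)

lemma commutation_equiv_invariant:
  assumes "commutation_equiv G xs ys" "P xs"
    and "\<And>us a b vs. a \<otimes> b = b \<otimes> a \<Longrightarrow> P (us @ [a, b] @ vs) \<Longrightarrow> P (us @ [b, a] @ vs)"
  shows "P ys"
  using assms(1) unfolding commutation_equiv_def
proof (induction rule: rtranclp_induct)
  case (step y z)
  from step(2) obtain us a b vs where "y = us @ [a, b] @ vs" "z = us @ [b, a] @ vs" "a \<otimes> b = b \<otimes> a"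
    unfolding commutation_step_def by blast
  then show ?case using assms(3)[of a b us vs] step(3) by simp
qed (rule assms(2))

lemma commutation_equiv_swap: "a \<otimes> b = b \<otimes> a \<Longrightarrow> commutation_equiv G (us @ [a, b] @ vs) (us @ [b, a] @ vs)"
  unfolding commutation_equiv_def commutation_step_def by blast

lemma commutation_equiv_context:
  assumes "commutation_equiv G xs ys" shows "commutation_equiv G (ps @ xs @ qs) (ps @ ys @ qs)"
proof (rule commutation_equiv_invariant[OF assms])
  fix us a b vs assume ab: "a \<otimes> b = b \<otimes> a" and e: "commutation_equiv G (ps @ xs @ qs) (ps @ (us @ [a, b] @ vs) @ qs)"
  show "commutation_equiv G (ps @ xs @ qs) (ps @ (us @ [b, a] @ vs) @ qs)"
    using commutation_equiv_trans[OF e] commutation_equiv_swap[OF ab, of "ps @ us" "vs @ qs"] by simp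
qed simp

lemma commutation_equiv_Cons:
  "commutation_equiv G xs ys \<Longrightarrow> commutation_equiv G (x # xs) (x # ys)"
  using commutation_equiv_context[of xs ys "[x]" "[]"] by simp

lemma commutation_equiv_set: assumes "commutation_equiv G xs ys" shows "set ys = set xs"
  by (rule commutation_equiv_invariant[OF assms, of "\<lambda>ys. set ys = set xs"]) auto

lemma commutation_equiv_length: assumes "commutation_equiv G xs ys" shows "length ys = length xs"
  by (rule commutation_equiv_invariant[OF assms, of "\<lambda>ys. length ys = length xs"]) auto

lemma commutation_equiv_prod:
  assumes "commutation_equiv G xs ys" "set xs \<subseteq> carrier G" shows "word_prod G ys = word_prod G xs"
proof -
  have "set ys \<subseteq> carrier G \<and> word_prod G ys = word_prod G xs"
  proof (rule commutation_equiv_invariant[OF assms(1)])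
    fix us a b vs assume ab: "a \<otimes> b = b \<otimes> a"
      and *: "set (us @ [a, b] @ vs) \<subseteq> carrier G \<and> word_prod G (us @ [a, b] @ vs) = word_prod G xs"
    have cl: "set us \<subseteq> carrier G" "a \<in> carrier G" "b \<in> carrier G" "set vs \<subseteq> carrier G" using * by auto
    have "word_prod G (us @ [b, a] @ vs) = word_prod G us \<otimes> ((b \<otimes> a) \<otimes> word_prod G vs)"
      using cl by (simp add: m_assoc)
    also have "\<dots> = word_prod G (us @ [a, b] @ vs)" unfolding ab[symmetric] using cl by (simp add: m_assoc)
    also have "\<dots> = word_prod G xs" using * by simp
    finally show "set (us @ [b, a] @ vs) \<subseteq> carrier G \<and> word_prod G (us @ [b, a] @ vs) = word_prod G xs"
      using * by auto
  qed (use assms in simp)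
  then show ?thesis by simp
qed

lemma commutation_equiv_map:
  assumes "commutation_equiv G xs ys" "set xs \<subseteq> A"
    and "\<And>a b. a \<in> A \<Longrightarrow> b \<in> A \<Longrightarrow> a \<otimes> b = b \<otimes> a \<Longrightarrow> f a \<otimes> f b = f b \<otimes> f a"
  shows "commutation_equiv G (map f xs) (map f ys)"
proof -
  have "set ys \<subseteq> A \<and> commutation_equiv G (map f xs) (map f ys)"
  proof (rule commutation_equiv_invariant[OF assms(1)])
    fix us a b vs assume ab: "a \<otimes> b = b \<otimes> a"
      and *: "set (us @ [a, b] @ vs) \<subseteq> A \<and> commutation_equiv G (map f xs) (map f (us @ [a, b] @ vs))"
    then have "f a \<otimes> f b = f b \<otimes> f a" using assms(3) by auto
    from commutation_equiv_swap[OF this, of "map f us" "map f vs"]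
    show "set (us @ [b, a] @ vs) \<subseteq> A \<and> commutation_equiv G (map f xs) (map f (us @ [b, a] @ vs))"
      using * commutation_equiv_trans by auto
  qed (use assms in simp)
  then show ?thesis by simp
qed

lemma commutation_equiv_move_front:
  "(\<And>a. a \<in> set xs \<Longrightarrow> a \<otimes> s = s \<otimes> a) \<Longrightarrow> commutation_equiv G (xs @ s # ys) (s # xs @ ys)"
proof (induction xs)
  case (Cons x xs)
  have "commutation_equiv G (x # xs @ s # ys) (x # s # xs @ ys)"
    using Cons by (intro commutation_equiv_Cons) auto
  moreover have "commutation_equiv G (x # s # xs @ ys) (s # x # xs @ ys)"
    using commutation_equiv_swap[of x s "[]"] Cons.prems by simp
  ultimately show ?case using commutation_equiv_trans by auto
qed simp

end

context finite_coxeter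
begin

lemma conj_commute:
  assumes "s \<in> S" "a \<in> T" "b \<in> T" "a \<otimes> b = b \<otimes> a" shows "conj s a \<otimes> conj s b = conj s b \<otimes> conj s a"
proof -
  have "conj s a \<otimes> conj s b = s \<otimes> (a \<otimes> b) \<otimes> s" using assms(1-3) by (simp add: m_assoc)
  also have "\<dots> = conj s b \<otimes> conj s a" unfolding assms(4) using assms(1-3) by (simp add: m_assoc)
  finally show ?thesis .
qed

lemma commutation_equiv_map_conj:
  assumes "s \<in> S" "set xs \<subseteq> T" "commutation_equiv W xs ys"
  shows "commutation_equiv W (map (conj s) xs) (map (conj s) ys)"
  by (rule commutation_equiv_map[OF assms(3,2)]) (rule conj_commute[OF assms(1)])

text \<open>Distinct commuting reflections have orthogonal roots, so neither affects the sign
  condition of the other.\<close>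

lemma conc_commutation:
  assumes "commutation_equiv W xs ys" "set xs \<subseteq> T" "u \<in> carrier W" "conc u xs"
  shows "conc u ys"
proof -
  have "set ys \<subseteq> T \<and> conc u ys"
  proof (rule commutation_equiv_invariant[OF assms(1)])
    fix us a b vs
    assume ab: "a \<otimes> b = b \<otimes> a" and *: "set (us @ [a, b] @ vs) \<subseteq> T \<and> conc u (us @ [a, b] @ vs)"
    define w where "w = u \<otimes> prd us"
    have sub: "set us \<subseteq> T" "a \<in> T" "b \<in> T" "set vs \<subseteq> T" using * by auto
    have wW: "w \<in> carrier W" using sub(1) assms(3) T_word_closed by (auto simp: w_def)
    have c: "conc u us" "pos (act w (rt a))" "pos (act (w \<otimes> a) (rt b))" "conc (w \<otimes> a \<otimes> b) vs"
      using * assms(3) sub by (auto simp: conc_append simp flip: w_def)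
    have "pos (act w (rt b)) \<and> pos (act (w \<otimes> b) (rt a)) \<and> conc (w \<otimes> b \<otimes> a) vs"
    proof (cases "a = b")
      case False
      then have "B (rt a) (rt b) = 0" "B (rt b) (rt a) = 0"
        using commute_iff[OF sub(2,3) False] ab B_sym by metis+
      then have "act (w \<otimes> a) (rt b) = act w (rt b)" "act (w \<otimes> b) (rt a) = act w (rt a)"
        using sub wW by (simp_all add: rt refl_def)
      moreover have "w \<otimes> b \<otimes> a = w \<otimes> a \<otimes> b" using sub wW ab by (simp add: m_assoc)
      ultimately show ?thesis using c by simp
    qed (use c in simp)
    then show "set (us @ [b, a] @ vs) \<subseteq> T \<and> conc u (us @ [b, a] @ vs)"
      using c sub assms(3) by (auto simp: conc_append simp flip: w_def)
  qed (use assms in simp)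
  then show ?thesis by simp
qed

lemma Conc_commutation:
  assumes "commutation_equiv W xs ys" "u \<in> carrier W" "xs \<in> Conc bs u" shows "ys \<in> Conc bs u"
  using assms conc_commutation[OF assms(1) _ assms(2)] commutation_equiv_prod[OF assms(1)]
    commutation_equiv_set[OF assms(1)] commutation_equiv_length[OF assms(1)] T_word_closed[of xs]
  by (simp add: Conc_def factorizations_def)

section \<open>Acute factorizations\<close>

text \<open>A form of being decreasing that ignores the order of the letters. It is therefore stable
  under commutation, and it passes through the conjugations of the recursion.\<close>

definition acute :: "'a list \<Rightarrow> bool" where
  "acute ts \<longleftrightarrow> (\<forall>t\<in>set ts. \<forall>t'\<in>set ts. 0 \<le> B (rt t) (rt t'))"

lemma acute_map_conj:
  assumes "s \<in> S" "set ts \<subseteq> T" "s \<notin> set ts" "acute ts" shows "acute (map (conj s) ts)"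
  unfolding acute_def
proof (intro ballI)
  fix x y assume "x \<in> set (map (conj s) ts)" "y \<in> set (map (conj s) ts)"
  then obtain t t' where t: "t \<in> set ts" "t' \<in> set ts" "x = conj s t" "y = conj s t'" by auto
  then have "t \<in> T" "t \<noteq> s" "t' \<in> T" "t' \<noteq> s" using assms by auto
  then have "B (rt x) (rt y) = B (rt t) (rt t')"
    unfolding t(3,4) using assms(1) by (simp add: rt_conj_simple B_refl B_alpha_alpha bf_self)
  then show "0 \<le> B (rt x) (rt y)" using assms(4) t by (simp add: acute_def)
qed

lemma acute_subset: "acute ts \<Longrightarrow> set xs \<subseteq> set ts \<Longrightarrow> acute xs"
  unfolding acute_def by blast

lemma orthogonal_simple_fixed:
  assumes "s \<in> S" "set A \<subseteq> T" "\<And>a. a \<in> set A \<Longrightarrow> B (alpha s) (rt a) = 0"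
  shows "act (prd A) (alpha s) = alpha s"
  using act_word_refl_fixed[OF assms(2)] assms(3) by blast

lemma orthogonal_simple_commute:
  assumes "s \<in> S" "a \<in> T" "a \<noteq> s" "B (alpha s) (rt a) = 0" shows "a \<otimes> s = s \<otimes> a" "conj s a = a"
proof -
  show c: "a \<otimes> s = s \<otimes> a" using commute_iff[of s a] assms by (simp add: rt_simple)
  show "conj s a = a" unfolding c[symmetric] using assms by (simp add: m_assoc)
qed

text \<open>The letters left of \<open>s\<close> pair nonpositively with \<open>alpha s\<close> by
  \<open>factorization_nonpos\<close> and nonnegatively by acuteness. They are orthogonal to it, and
  \<open>s\<close> commutes to the front.\<close>

lemma acute_split:
  assumes "coxeter_word (s # bs)" "ts \<in> factorizations (s # bs)" "s \<in> set ts" "acute ts"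
  obtains A Z where "ts = A @ s # Z" "set A \<subseteq> T" "set Z \<subseteq> T" "s \<notin> set Z"
    "reduce_at s ts = A @ map (conj s) Z" "A @ map (conj s) Z = map (conj s) (A @ Z)" "acute (reduce_at s ts)"
    "commutation_equiv W ts (s # A @ Z)" "act (prd A) (alpha s) = alpha s"
proof -
  obtain A Z where AZ: "ts = A @ s # Z" "s \<notin> set A" "s \<notin> set Z" "set A \<subseteq> T" "set Z \<subseteq> T"
    "A @ map (conj s) Z \<in> factorizations bs" "reduce_at s ts = A @ map (conj s) Z"
    using factorization_split[OF assms(1-3)] by blast
  have s: "s \<in> S" using assms(1) coxeter_word_Cons by blast
  have z: "B (alpha s) (rt a) = 0" if "a \<in> set A" for a
    using factorization_nonpos[OF assms(1) AZ(6), of a] assms(4) that s AZ(1) by (force simp: acute_def rt_simple)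
  have c: "a \<otimes> s = s \<otimes> a" "conj s a = a" if "a \<in> set A" for a
    using orthogonal_simple_commute[OF s _ _ z[OF that]] AZ that by auto
  have m: "map (conj s) (A @ Z) = A @ map (conj s) Z" using c(2) by (simp add: map_idI)
  moreover have "acute (A @ Z)" using AZ(1) by (intro acute_subset[OF assms(4)]) auto
  then have "acute (map (conj s) (A @ Z))" using AZ s by (intro acute_map_conj) auto
  moreover have "commutation_equiv W ts (s # A @ Z)"
    unfolding AZ(1) by (rule commutation_equiv_move_front) (rule c(1))
  ultimately show ?thesis using AZ orthogonal_simple_fixed[OF s AZ(4) z] by (intro that[of A Z]) simp_all
qed

text \<open>Conjugation by \<open>s\<close> changes the sign of the pairings with
  \<open>alpha s\<close>, which are nonpositive by \<open>factorization_nonpos\<close>.\<close>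

lemma acute_up_Cons:
  assumes "u \<in> carrier W" "coxeter_word (s # bs)" "pos (act u (alpha s))" "ts \<in> Conc bs u" "acute ts"
  shows "s # map (conj s) ts \<in> Conc (s # bs) u" "acute (s # map (conj s) ts)"
proof -
  have s: "s \<in> S" "s \<notin> set ts" and ts: "set ts \<subseteq> T" "ts \<in> factorizations bs"
    using assms coxeter_word_Cons[OF assms(2)] factorization_no_simple[OF assms(2)]
    by (auto simp: Conc_def factorizations_def)
  have sub: "set bs \<subseteq> carrier W" using assms(2) by (auto simp: coxeter_word_def)
  show "s # map (conj s) ts \<in> Conc (s # bs) u"
    using assms s ts sub map_conj_T[OF s(1) ts(1)] conc_conj[OF assms(1) s(1) ts(1) s(2)] T_word_closed[OF ts(1)]
    by (simp add: Conc_def factorizations_def prd_map_conj rt_simple m_assoc)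
  have "0 \<le> B (alpha s) (rt (conj s t))" if "t \<in> set ts" for t
  proof -
    have "t \<in> T" "t \<noteq> s" using that ts s by auto
    then have "B (alpha s) (rt (conj s t)) = - B (alpha s) (rt t)"
      using s by (simp add: rt_conj_simple B_refl2 B_alpha_alpha bf_self B_sym[of "rt t"])
    then show ?thesis using factorization_nonpos[OF assms(2) ts(2) that] by simp
  qed
  then show "acute (s # map (conj s) ts)"
    using acute_map_conj[OF s(1) ts(1) s(2) assms(5)] s B_sym by (auto simp: acute_def rt_simple B_alpha_alpha bf_self)
qed

text \<open>The letters right of an occurrence of \<open>s\<close> would be orthogonal to
  \<open>alpha s\<close>. The step along \<open>s\<close> turns the image of \<open>alpha s\<close>
  negative and nothing restores it up to the end of the chain, where \<open>Plus\<close> requires it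
  to be positive.\<close>

lemma acute_rotated_no_simple:
  assumes "u \<in> carrier W" "coxeter_word (s # bs)" "Plus (s # bs) u"
    "ts \<in> Conc (bs @ [s]) (u \<otimes> s)" "acute ts"
  shows "s \<notin> set ts"
proof
  assume "s \<in> set ts"
  have s: "s \<in> S" "prd (rev bs) \<in> carrier W" "set bs \<subseteq> carrier W" using assms simple_word_closed by (auto simp: coxeter_word_def)
  have ts: "set ts \<subseteq> T" "ts \<in> factorizations (bs @ [s])" "conc (u \<otimes> s) ts" using assms by (auto simp: Conc_def factorizations_def)
  obtain A Z where AZ: "ts = A @ s # Z" "s \<notin> set A" using split_list_first[OF \<open>s \<in> set ts\<close>] by blast
  have AZT: "set A \<subseteq> T" "set Z \<subseteq> T" using ts AZ by auto
  then have cl: "prd A \<in> carrier W" "prd Z \<in> carrier W" using T_word_closed by auto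
  have m: "map (conj s) ts = map (conj s) A @ s # map (conj s) Z" using AZ s by simp
  have sm: "s \<in> set (map (conj s) ts)" unfolding m by simp
  obtain A' Z' where AZ': "map (conj s) ts = A' @ s # Z'" "s \<notin> set A'" "s \<notin> set Z'"
      "set A' \<subseteq> T" "set Z' \<subseteq> T" "A' @ map (conj s) Z' \<in> factorizations bs"
      "reduce_at s (map (conj s) ts) = A' @ map (conj s) Z'"
    by (rule factorization_split[OF assms(2) conj_factorization'[OF assms(2) ts(2)] sm])
  have "A' = map (conj s) A \<and> Z' = map (conj s) Z"
    by (rule iffD1[OF append_Cons_eq_iff[OF AZ'(2,3)] HOL.trans[OF AZ'(1)[symmetric] m]])
  then have f: "map (conj s) A @ Z \<in> factorizations bs"
    using AZ'(6) map_conj_conj[OF s(1) AZT(2)] by simp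
  have "B (alpha s) (rt z) = 0" if "z \<in> set Z" for z
    using factorization_nonpos[OF assms(2) f(1), of z] assms(5) that s AZ(1) by (force simp: acute_def rt_simple)
  then have Z: "act (prd Z) (alpha s) = alpha s" by (rule orthogonal_simple_fixed[OF s(1) AZT(2)])
  have pos1: "pos (act (u \<otimes> s \<otimes> prd A) (alpha s))"
    using ts(3) assms(1) s AZT by (simp add: AZ conc_append rt_simple)
  have "prd A \<otimes> s \<otimes> prd Z = s \<otimes> prd (rev bs)"
    using ts(2) AZ AZT s cl T_word_closed by (simp add: factorizations_def m_assoc)
  then have "u \<otimes> prd (rev bs) = u \<otimes> s \<otimes> (prd A \<otimes> s \<otimes> prd Z)" using assms(1) s by (simp add: m_assoc)
  then have "act (u \<otimes> prd (rev bs)) (alpha s) = (\<lambda>l. - act (u \<otimes> s \<otimes> prd A) (alpha s) l)"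
    using assms(1) s cl Z by (simp add: act_simple refl_alpha_self act_neg)
  then have "neg (act (u \<otimes> prd (rev bs)) (alpha s))" using pos1 by simp
  moreover have "pos (act (u \<otimes> prd (rev bs)) (alpha s))" using Plus_Cons[OF assms(1,2)] assms(3) by simp
  moreover have "act (u \<otimes> prd (rev bs)) (alpha s) \<in> Phi" using assms(1) s by (intro PhiI) auto
  ultimately show False using Phi_not_both by blast
qed

text \<open>The letters left of an occurrence of \<open>s\<close> fix \<open>alpha s\<close>, so the
  positivity required at that step would already hold at \<open>u\<close>.\<close>

lemma acute_down_no_simple:
  assumes "u \<in> carrier W" "coxeter_word (s # bs)" "neg (act u (alpha s))" "ts \<in> Conc (s # bs) u" "acute ts"
  shows "s \<notin> set ts"
proof
  assume "s \<in> set ts"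
  have s: "s \<in> S" using assms coxeter_word_Cons by blast
  have "ts \<in> factorizations (s # bs)" using assms(4) by (simp add: Conc_def)
  then obtain A Z where AZ: "ts = A @ s # Z" "set A \<subseteq> T" "set Z \<subseteq> T" "s \<notin> set Z" "act (prd A) (alpha s) = alpha s"
    using acute_split[OF assms(2) _ \<open>s \<in> set ts\<close> assms(5)] by metis
  have "pos (act (u \<otimes> prd A) (alpha s))"
    using conc_split[OF assms(1) s AZ(2,3,4)] assms(4) AZ(1) by (simp add: Conc_def)
  then have "pos (act u (alpha s))" using AZ assms(1) T_word_closed by simp
  then show False using assms(1,3) s PhiI Phi_not_both by blast
qed

section \<open>The Cambrian projection as a greedy word\<close>

text \<open>\<open>projection_word bs u\<close> spells the projection of \<open>u\<^sup>-\<^sup>1\<close>.\<close>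
function projection_word :: "'a list \<Rightarrow> 'a \<Rightarrow> 'a list" where
  "projection_word [] u = []"
| "projection_word (s # bs) u =
     (if len (u \<otimes> s) < len u then s # projection_word (bs @ [s]) (u \<otimes> s) else projection_word bs u)"
  by pat_completeness auto
termination by (relation "measures [\<lambda>(bs, u). length bs, \<lambda>(bs, u). len u]") auto

text \<open>The well-founded order behind \<open>projection_word\<close>, detached from its
  equations so that a claim may be used at any smaller pair.\<close>

lemma lex_induct:
  assumes "\<And>(bs :: 'a list) u. (\<And>bs' u'. length bs' < length bs \<or> length bs' = length bs \<and> len u' < len u \<Longrightarrow> P bs' u') \<Longrightarrow> P bs u"
  shows "P bs u"
proof -
  have "P (fst x) (snd x)" for x
  proof (induction x rule: wf_induct_rule[OF wf_measures[of "[\<lambda>(bs, u). length bs, \<lambda>(bs, u). len u]"]])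
    case (1 x)
    have "P bs' u'" if "length bs' < length (fst x) \<or> length bs' = length (fst x) \<and> len u' < len (snd x)" for bs' u'
      using 1[of "(bs', u')"] that by (simp add: case_prod_beta)
    then show ?case by (rule assms)
  qed
  from this[of "(bs, u)"] show ?thesis by simp
qed

lemma up_down:
  assumes "u \<in> carrier W" "s \<in> S"
  shows "len (u \<otimes> s) < len u \<longleftrightarrow> neg (act u (alpha s))" "\<not> len (u \<otimes> s) < len u \<longleftrightarrow> pos (act u (alpha s))"
  using neg_iff_len[of u s] pos_iff_len[of u s] assms Phi_neg_iff[OF PhiI[OF assms]] by (auto simp: rt_simple)

lemma set_projection_word: "set (projection_word bs u) \<subseteq> set bs"
  by (induction bs u rule: projection_word.induct) auto

text \<open>The greedy recursion run backwards: \<open>acute_up_Cons\<close> inserts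
  \<open>s\<close> in an ascent; in a descent the factorization is conjugated, which keeps it acute
  because \<open>acute_rotated_no_simple\<close> excludes \<open>s\<close>.\<close>

lemma exists_acute:
  assumes "coxeter_word bs" "u \<in> carrier W" "Plus bs u" shows "\<exists>ts\<in>Conc bs u. acute ts"
  using assms
proof (induction bs u rule: lex_induct)
  case (1 bs u)
  show ?case
  proof (cases bs)
    case Nil then show ?thesis by (intro bexI[of _ "[]"]) (auto simp: Conc_def factorizations_def acute_def)
  next
    case (Cons s bs')
    note cw = coxeter_word_Cons[OF "1.prems"(1)[unfolded Cons]]
    note pr = "1.prems"[unfolded Cons]
    show ?thesis
    proof (cases "len (u \<otimes> s) < len u")
      case True
      then have ng: "neg (act u (alpha s))" using up_down pr cw by blast
      have "Plus (bs' @ [s]) (u \<otimes> s)" using Plus_rotate pr ng by blast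
      then obtain ts where ts: "ts \<in> Conc (bs' @ [s]) (u \<otimes> s)" "acute ts"
        using 1(1)[of "bs' @ [s]" "u \<otimes> s"] True Cons cw pr by auto
      have ns: "s \<notin> set ts" using acute_rotated_no_simple[OF pr(2,1,3) ts] .
      have tsT: "set ts \<subseteq> T" "ts \<in> factorizations (bs' @ [s])" using ts by (auto simp: Conc_def factorizations_def)
      define xs where "xs = map (conj s) ts"
      have "xs \<in> factorizations (s # bs')" using conj_factorization'[OF pr(1) tsT(2)] by (simp add: xs_def)
      moreover have "s \<notin> set xs" unfolding xs_def using cw by (intro not_in_map_conj[OF _ tsT(1) ns]) simp
      moreover have "map (conj s) xs = ts" unfolding xs_def using cw by (intro map_conj_conj[OF _ tsT(1)]) simp
      ultimately have "xs \<in> Conc (s # bs') u" using Conc_down(1)[OF pr(2,1) ng] ts(1) by simp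
      moreover have "acute xs" unfolding xs_def using acute_map_conj[OF _ tsT(1) ns ts(2)] cw by simp
      ultimately show ?thesis using Cons by blast
    next
      case False
      then have p: "pos (act u (alpha s))" using up_down pr cw by blast
      have "Plus bs' u" using Plus_Cons[OF pr(2,1)] pr(3) by simp
      then obtain ts where "ts \<in> Conc bs' u" "acute ts" using 1(1)[of bs' u] Cons cw pr by auto
      then show ?thesis using acute_up_Cons[OF pr(2,1) p] Cons by blast
    qed
  qed
qed

text \<open>On acute words the recursion can be inverted: in an ascent \<open>acute_split\<close>
  brings \<open>s\<close> to the front up to commutation, and in a descent \<open>s\<close> is
  absent.\<close>

lemma acute_unique:
  assumes "coxeter_word bs" "u \<in> carrier W" "Plus bs u"
    "ts \<in> Conc bs u" "acute ts" "ts' \<in> Conc bs u" "acute ts'"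
  shows "commutation_equiv W ts ts'"
  using assms
proof (induction bs u arbitrary: ts ts' rule: lex_induct)
  case (1 bs u)
  show ?case
  proof (cases bs)
    case Nil then show ?thesis using "1.prems" by (simp add: Conc_def factorizations_def)
  next
    case (Cons s bs')
    note cw = coxeter_word_Cons[OF "1.prems"(1)[unfolded Cons]]
    note pr = "1.prems"[unfolded Cons]
    have s: "s \<in> S" using cw by simp
    show ?thesis
    proof (cases "len (u \<otimes> s) < len u")
      case True
      then have ng: "neg (act u (alpha s))" using up_down pr s by blast
      have f: "x \<in> factorizations (s # bs')" "set x \<subseteq> T" if "x \<in> Conc (s # bs') u" for x
        using that by (auto simp: Conc_def factorizations_def)
      note no = acute_down_no_simple[OF pr(2,1) ng]
      have "commutation_equiv W (map (conj s) ts) (map (conj s) ts')"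
      proof (rule 1(1)[of "bs' @ [s]" "u \<otimes> s"])
        show "Plus (bs' @ [s]) (u \<otimes> s)" using Plus_rotate pr ng by blast
        show "map (conj s) ts \<in> Conc (bs' @ [s]) (u \<otimes> s)"
          using Conc_down(1)[OF pr(2,1) ng f(1)[OF pr(4)] no[OF pr(4,5)]] pr(4) by simp
        show "map (conj s) ts' \<in> Conc (bs' @ [s]) (u \<otimes> s)"
          using Conc_down(1)[OF pr(2,1) ng f(1)[OF pr(6)] no[OF pr(6,7)]] pr(6) by simp
        show "acute (map (conj s) ts)" using acute_map_conj[OF s f(2)[OF pr(4)] no[OF pr(4,5)] pr(5)] .
        show "acute (map (conj s) ts')" using acute_map_conj[OF s f(2)[OF pr(6)] no[OF pr(6,7)] pr(7)] .
      qed (use Cons True cw pr in auto)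
      then show ?thesis
        using commutation_equiv_map_conj[OF s map_conj_T[OF s f(2)[OF pr(4)]]]
          map_conj_conj[OF s f(2)[OF pr(4)]] map_conj_conj[OF s f(2)[OF pr(6)]] by metis
    next
      case False
      then have p: "pos (act u (alpha s))" using up_down pr s by blast
      have form: "reduce_at s x \<in> Conc bs' u \<and> acute (reduce_at s x) \<and>
          commutation_equiv W x (s # map (conj s) (reduce_at s x))"
        if x: "x \<in> Conc (s # bs') u" "acute x" for x
      proof -
        have c: "x \<in> factorizations (s # bs')" "s \<in> set x" "reduce_at s x \<in> Conc bs' u"
          using Conc_up[OF pr(2,1,3) p, of x] x by auto
        obtain A Z where AZ: "set A \<subseteq> T" "set Z \<subseteq> T" "reduce_at s x = A @ map (conj s) Z"
            "A @ map (conj s) Z = map (conj s) (A @ Z)" "acute (reduce_at s x)" "commutation_equiv W x (s # A @ Z)"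
          using acute_split[OF pr(1) c(1,2) x(2)] by metis
        have "map (conj s) (reduce_at s x) = A @ Z"
          unfolding AZ(3,4) using AZ(1,2) by (intro map_conj_conj[OF s]) simp
        then show ?thesis using AZ(5,6) c by simp
      qed
      have "commutation_equiv W (reduce_at s ts) (reduce_at s ts')"
        using form[OF pr(4,5)] form[OF pr(6,7)] Cons cw pr(2) Plus_Cons[OF pr(2,1)] pr(3)
        by (intro 1(1)[of bs' u]) auto
      moreover have "set (reduce_at s ts) \<subseteq> T" using form[OF pr(4,5)] by (simp add: Conc_def factorizations_def)
      ultimately have "commutation_equiv W (s # map (conj s) (reduce_at s ts)) (s # map (conj s) (reduce_at s ts'))"
        using s by (intro commutation_equiv_Cons commutation_equiv_map_conj) auto
      then show ?thesis using form[OF pr(4,5)] form[OF pr(6,7)] commutation_equiv_trans commutation_equiv_sym by meson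
    qed
  qed
qed

text \<open>The decisions of the greedy procedure are visible in an acute concordant factorization:
  it contains \<open>s\<close> exactly when \<open>u \<otimes> s\<close> is longer than
  \<open>u\<close>.\<close>

lemma acute_projection_word:
  assumes "coxeter_word bs" "u \<in> carrier W" "u' \<in> carrier W" "Plus bs u" "Plus bs u'"
    "ts \<in> Conc bs u" "ts \<in> Conc bs u'" "acute ts"
  shows "projection_word bs u = projection_word bs u'"
  using assms
proof (induction bs u arbitrary: ts u' rule: lex_induct)
  case (1 bs u)
  show ?case
  proof (cases bs)
    case (Cons s bs')
    note cw = coxeter_word_Cons[OF "1.prems"(1)[unfolded Cons]]
    note pr = "1.prems"[unfolded Cons]
    have s: "s \<in> S" using cw by simp
    have f: "ts \<in> factorizations (s # bs')" "set ts \<subseteq> T" using pr(6) by (auto simp: Conc_def factorizations_def)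
    have iff: "s \<in> set ts \<longleftrightarrow> \<not> len (x \<otimes> s) < len x" if "x \<in> carrier W" "Plus (s # bs') x" "ts \<in> Conc (s # bs') x" for x
      using up_down[OF that(1) s] up_contains[OF that(1) pr(1) that(2) _ that(3)]
        acute_down_no_simple[OF that(1) pr(1) _ that(3) pr(8)] by blast
    show ?thesis
    proof (cases "s \<in> set ts")
      case False
      then have d: "len (u \<otimes> s) < len u" "len (u' \<otimes> s) < len u'" using iff pr by blast+
      then have ng: "neg (act u (alpha s))" "neg (act u' (alpha s))" using up_down pr s by blast+
      have "projection_word (bs' @ [s]) (u \<otimes> s) = projection_word (bs' @ [s]) (u' \<otimes> s)"
      proof (rule 1(1)[of "bs' @ [s]" "u \<otimes> s"])
        show "Plus (bs' @ [s]) (u \<otimes> s)" "Plus (bs' @ [s]) (u' \<otimes> s)" using Plus_rotate pr ng by blast+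
        show "map (conj s) ts \<in> Conc (bs' @ [s]) (u \<otimes> s)" "map (conj s) ts \<in> Conc (bs' @ [s]) (u' \<otimes> s)"
          using Conc_down(1)[OF pr(2,1) ng(1) f(1) False] Conc_down(1)[OF pr(3,1) ng(2) f(1) False] pr(6,7) by blast+
        show "acute (map (conj s) ts)" using acute_map_conj[OF s f(2) False pr(8)] .
      qed (use Cons d cw pr in auto)
      then show ?thesis using d Cons by simp
    next
      case True
      then have d: "\<not> len (u \<otimes> s) < len u" "\<not> len (u' \<otimes> s) < len u'" using iff pr by blast+
      then have p: "pos (act u (alpha s))" "pos (act u' (alpha s))" using up_down pr s by blast+
      have "projection_word bs' u = projection_word bs' u'"
      proof (rule 1(1)[of bs' u])
        show "reduce_at s ts \<in> Conc bs' u" "reduce_at s ts \<in> Conc bs' u'"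
          using Conc_up[OF pr(2,1,4) p(1), of ts] Conc_up[OF pr(3,1,5) p(2), of ts] pr(6,7) by blast+
        show "acute (reduce_at s ts)" using acute_split[OF pr(1) f(1) True pr(8)] by metis
      qed (use Cons cw pr Plus_Cons[OF pr(2,1)] Plus_Cons[OF pr(3,1)] in auto)
      then show ?thesis using d Cons by simp
    qed
  qed simp
qed

text \<open>The word reveals the branch taken at each stage: after skipping \<open>s\<close> it is
  spelled in the remaining letters, so \<open>s\<close> can only come from a descent. Then
  \<open>Conc_up\<close> and \<open>Conc_down\<close> describe both sets by the same
  conditions.\<close>

lemma Conc_projection_word:
  assumes "coxeter_word bs" "u \<in> carrier W" "u' \<in> carrier W" "Plus bs u" "Plus bs u'"
    "projection_word bs u = projection_word bs u'"
  shows "Conc bs u = Conc bs u'"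
  using assms
proof (induction bs u arbitrary: u' rule: lex_induct)
  case (1 bs u)
  show ?case
  proof (cases bs)
    case Nil then show ?thesis by (auto simp: Conc_def factorizations_def)
  next
    case (Cons s bs')
    note cw = coxeter_word_Cons[OF "1.prems"(1)[unfolded Cons]]
    note pr = "1.prems"[unfolded Cons]
    have s: "s \<in> S" using cw by simp
    have ns: "s \<notin> set (projection_word bs' x)" for x using set_projection_word[of bs' x] cw by blast
    show ?thesis
    proof (cases "len (u \<otimes> s) < len u")
      case True
      have d: "len (u' \<otimes> s) < len u'" 
      proof (rule ccontr)
        assume "\<not> len (u' \<otimes> s) < len u'"
        then have "projection_word bs' u' = s # projection_word (bs' @ [s]) (u \<otimes> s)" using pr(6) True by simp
        then have "s \<in> set (projection_word bs' u')" by simp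
        then show False using ns by blast
      qed
      then have ng: "neg (act u (alpha s))" "neg (act u' (alpha s))" using True up_down pr s by blast+
      have "Conc (bs' @ [s]) (u \<otimes> s) = Conc (bs' @ [s]) (u' \<otimes> s)"
      proof (rule 1(1)[of "bs' @ [s]" "u \<otimes> s"])
        show "Plus (bs' @ [s]) (u \<otimes> s)" "Plus (bs' @ [s]) (u' \<otimes> s)" using Plus_rotate pr ng by blast+
      qed (use Cons d True cw pr in auto)
      then have "ts \<in> Conc (s # bs') u \<longleftrightarrow> ts \<in> Conc (s # bs') u'" if "ts \<in> factorizations (s # bs')" for ts
        using Conc_down[OF pr(2,1) ng(1) that] Conc_down[OF pr(3,1) ng(2) that] by blast
      then show ?thesis unfolding Cons by (auto simp: Conc_def)
    next
      case False
      have d: "\<not> len (u' \<otimes> s) < len u'" using pr(6) False ns[of u] by (cases "len (u' \<otimes> s) < len u'") auto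
      then have p: "pos (act u (alpha s))" "pos (act u' (alpha s))" using False up_down pr s by blast+
      have "Conc bs' u = Conc bs' u'"
        using False d Cons cw pr Plus_Cons[OF pr(2,1)] Plus_Cons[OF pr(3,1)] by (intro 1(1)[of bs' u]) auto
      then show ?thesis unfolding Cons using Conc_up[OF pr(2,1,4) p(1)] Conc_up[OF pr(3,1,5) p(2)] by blast
    qed
  qed
qed

section \<open>The right weak order through lengths\<close>

definition wle :: "'a \<Rightarrow> 'a \<Rightarrow> bool" where
  "wle v x \<longleftrightarrow> len v + len (inv v \<otimes> x) = len x"

lemma wle_refl [simp]: "x \<in> carrier W \<Longrightarrow> wle x x"
  by (simp add: wle_def)

lemma len_le_via:
  assumes "v \<in> carrier W" "x \<in> carrier W" shows "len x \<le> len v + len (inv v \<otimes> x)"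
  using len_mult[of v "inv v \<otimes> x"] assms by simp

lemma wle_trans:
  assumes "a \<in> carrier W" "b \<in> carrier W" "c \<in> carrier W" "wle a b" "wle b c" shows "wle a c"
proof -
  have "len (inv a \<otimes> c) \<le> len (inv a \<otimes> b) + len (inv b \<otimes> c)"
    using len_mult[of "inv a \<otimes> b" "inv b \<otimes> c"] assms by (simp add: m_assoc)
  then show ?thesis using assms len_le_via[of a c] by (simp add: wle_def)
qed

lemma wle_antisym:
  assumes "a \<in> carrier W" "b \<in> carrier W" "wle a b" "wle b a" shows "a = b"
proof -
  have "len (inv a \<otimes> b) = 0" using assms by (simp add: wle_def)
  then have "inv a \<otimes> b = \<one>" using assms len_0 by simp
  then have "a \<otimes> (inv a \<otimes> b) = a \<otimes> \<one>" by simp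
  then show ?thesis using assms by simp
qed

lemma wle_descent:
  assumes "s \<in> S" "v \<in> carrier W" "x \<in> carrier W" "wle v x" "len (s \<otimes> v) < len v"
  shows "len (s \<otimes> x) < len x"
  using len_le_via[of "s \<otimes> v" "s \<otimes> x"] assms by (simp add: wle_def inv_mult_group m_assoc)

lemma len_inv_mult:
  assumes "s \<in> S" "v \<in> carrier W" shows "len (inv v \<otimes> s) = len (s \<otimes> v)"
  using len_inv[of "s \<otimes> v"] assms by (simp add: inv_mult_group)

lemma wle_mult_left:
  assumes "s \<in> S" "v \<in> carrier W" "x \<in> carrier W" "len v < len (s \<otimes> v)" "len x < len (s \<otimes> x)"
  shows "wle (s \<otimes> v) (s \<otimes> x) \<longleftrightarrow> wle v x"
proof -
  have "len (s \<otimes> v) = len v + 1" "len (s \<otimes> x) = len x + 1"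
    using len_simple_mult_left[of v s] len_simple_mult_left[of x s] assms by auto
  moreover have "inv (s \<otimes> v) \<otimes> (s \<otimes> x) = inv v \<otimes> x" using assms by (simp add: inv_mult_group m_assoc)
  ultimately show ?thesis by (simp add: wle_def)
qed

lemma right_weak_le_iff:
  assumes "v \<in> carrier W" "x \<in> carrier W" shows "right_weak_le W S v x \<longleftrightarrow> wle v x"
proof
  assume "right_weak_le W S v x"
  then obtain xs ys where *: "reduced_word W S x (xs @ ys)" "reduced_word W S v xs"
    unfolding right_weak_le_def by blast
  then have sub: "set xs \<subseteq> S" "set ys \<subseteq> S" and p: "prd xs = v" "length xs = len v" "length (xs @ ys) = len x" "prd (xs @ ys) = x"
    by (auto simp: reduced_word_def in_lists_conv_set)
  have "inv v \<otimes> x = prd ys" using p sub simple_word_closed assms by (auto simp: m_assoc)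
  then have "len (inv v \<otimes> x) \<le> length ys" using len_le[OF sub(2)] by simp
  then show "wle v x" using p len_le_via[OF assms] by (simp add: wle_def)
next
  assume w: "wle v x"
  obtain xs where xs: "set xs \<subseteq> S" "prd xs = v" "length xs = len v" using reduced_exists[OF assms(1)] .
  obtain ys where ys: "set ys \<subseteq> S" "prd ys = inv v \<otimes> x" "length ys = len (inv v \<otimes> x)"
    using reduced_exists[of "inv v \<otimes> x"] assms by auto
  have "reduced_word W S x (xs @ ys)" "reduced_word W S v xs"
    using xs ys w assms simple_word_closed by (auto simp: reduced_word_def wle_def)
  then show "right_weak_le W S v x" unfolding right_weak_le_def by blast
qed

section \<open>The projection is the largest fixed element below\<close>

text \<open>Every letter taken is a right descent of what is left of \<open>u\<close>. It follows
  that the greedy word is reduced and spells an element weakly below \<open>inv u\<close>.\<close>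

lemma projection_word_len:
  assumes "u \<in> carrier W" "set bs \<subseteq> S"
  shows "len (u \<otimes> prd (projection_word bs u)) + length (projection_word bs u) = len u"
  using assms
proof (induction bs u rule: projection_word.induct)
  case (2 s bs u)
  show ?case
  proof (cases "len (u \<otimes> s) < len u")
    case True
    have "set (projection_word (bs @ [s]) (u \<otimes> s)) \<subseteq> carrier W"
      using set_projection_word[of "bs @ [s]"] 2 simple_word_closed by fastforce
    then show ?thesis using 2 True len_simple_mult[of u s] by (simp add: m_assoc)
  qed (use 2 in simp)
qed simp

lemma projection_word_closed: "set bs \<subseteq> S \<Longrightarrow> prd (projection_word bs u) \<in> carrier W"
  using set_projection_word[of bs u] simple_word_closed by (meson order_trans word_prod_closed)

lemma projection_word_wle:
  assumes "u \<in> carrier W" "set bs \<subseteq> S"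
  shows "wle (prd (projection_word bs u)) (inv u)" "len (prd (projection_word bs u)) = length (projection_word bs u)"
proof -
  let ?y = "prd (projection_word bs u)"
  have y: "?y \<in> carrier W" using projection_word_closed assms by blast
  have e: "len (u \<otimes> ?y) + length (projection_word bs u) = len u" using projection_word_len assms by blast
  have "len ?y \<le> length (projection_word bs u)" using len_le set_projection_word assms by (meson order_trans)
  moreover have "inv ?y \<otimes> inv u = inv (u \<otimes> ?y)" using assms y by (simp add: inv_mult_group)
  then have l: "len (inv ?y \<otimes> inv u) = len (u \<otimes> ?y)" using assms y by simp
  moreover have "len (inv u) \<le> len ?y + len (inv ?y \<otimes> inv u)" using assms y by (intro len_le_via) auto
  ultimately show "len ?y = length (projection_word bs u)" using e assms by simp
  then show "wle ?y (inv u)" using l e assms by (simp add: wle_def)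
qed

text \<open>The letters of \<open>xs\<close> never touch the coordinate at \<open>s\<close>, so the
  image of \<open>alpha s\<close> keeps the coordinate 1 there and cannot be negative.\<close>

lemma support_up:
  assumes "s \<in> S" "set xs \<subseteq> S" "s \<notin> set xs"
  shows "len (inv (prd xs)) < len (inv (prd xs) \<otimes> s)"
proof -
  have "act (prd (rev xs)) (alpha s) s = 1"
    using act_word_diff[of "rev xs" s "alpha s"] act_prd[of "rev xs"] assms by (simp add: alpha_def)
  then have "\<not> neg (act (inv (prd xs)) (alpha s))"
    using assms word_rev_inv[of xs] by (force simp: neg_def)
  moreover have "inv (prd xs) \<in> carrier W" using assms simple_word_closed by auto
  ultimately show ?thesis using up_down[of "inv (prd xs)" s] assms(1) len_simple_mult[of "inv (prd xs)" s] by auto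
qed

text \<open>Run on its own value, the greedy procedure repeats its decisions: a letter taken is a
  descent because the word is reduced, a letter skipped is none by
  \<open>support_up\<close>.\<close>

lemma projection_word_idem:
  assumes "u \<in> carrier W" "coxeter_word bs"
  shows "projection_word bs (inv (prd (projection_word bs u))) = projection_word bs u"
  using assms
proof (induction bs u rule: projection_word.induct)
  case (2 s bs u)
  note cw = coxeter_word_Cons[OF 2(4)]
  have sub: "set bs \<subseteq> S" "set (bs @ [s]) \<subseteq> S" using 2(4) by (auto simp: coxeter_word_def)
  show ?case
  proof (cases "len (u \<otimes> s) < len u")
    case True
    define y where "y = prd (projection_word (bs @ [s]) (u \<otimes> s))"
    have y: "y \<in> carrier W" unfolding y_def using projection_word_closed sub by blast
    have p: "projection_word (s # bs) u = s # projection_word (bs @ [s]) (u \<otimes> s)" using True by simp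
    have "len (prd (projection_word (s # bs) u)) = length (projection_word (s # bs) u)"
      using projection_word_wle(2)[of u "s # bs"] 2(3) sub cw by simp
    moreover have "len y = length (projection_word (bs @ [s]) (u \<otimes> s))"
      unfolding y_def using projection_word_wle(2)[of "u \<otimes> s"] 2(3) sub cw by simp
    ultimately have "len (s \<otimes> y) = len y + 1" unfolding p by (simp add: y_def)
    moreover have "inv (s \<otimes> y) \<otimes> s = inv y" using y cw by (simp add: inv_mult_group m_assoc)
    ultimately have "len (inv (s \<otimes> y) \<otimes> s) < len (inv (s \<otimes> y))" using y cw by simp
    moreover have "projection_word (bs @ [s]) (inv y) = projection_word (bs @ [s]) (u \<otimes> s)"
      unfolding y_def using 2(1) True 2(3) cw by simp
    moreover have "prd (projection_word (s # bs) u) = s \<otimes> y" unfolding p by (simp add: y_def)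
    ultimately show ?thesis using \<open>inv (s \<otimes> y) \<otimes> s = inv y\<close> p by simp
  next
    case False
    have "s \<notin> set (projection_word bs u)" "set (projection_word bs u) \<subseteq> S"
      using set_projection_word[of bs u] cw sub by auto
    then have "\<not> len (inv (prd (projection_word bs u)) \<otimes> s) < len (inv (prd (projection_word bs u)))"
      using support_up[of s "projection_word bs u"] cw by simp
    then show ?thesis using 2(2) False 2(3) cw by simp
  qed
qed simp

lemma conc_simple_of_len:
  assumes "u \<in> carrier W" "set xs \<subseteq> S" "len u + length xs \<le> len (u \<otimes> prd xs)" shows "conc u xs"
  using assms
proof (induction xs arbitrary: u)
  case (Cons s xs)
  then have cl: "s \<in> S" "prd xs \<in> carrier W" using simple_word_closed by auto
  have "len (u \<otimes> s \<otimes> prd xs) \<le> len (u \<otimes> s) + length xs"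
    using len_mult[of "u \<otimes> s" "prd xs"] len_le[of xs] Cons.prems cl by simp
  then have "len u < len (u \<otimes> s)" and l: "len u + 1 \<le> len (u \<otimes> s)" using Cons.prems cl by (auto simp: m_assoc)
  moreover have "len (u \<otimes> s) = len u + 1" using len_simple_mult[of u s] Cons.prems cl l by auto
  ultimately show ?case
    using Cons.IH[of "u \<otimes> s"] Cons.prems cl simple_up_pos[of u s] by (simp add: m_assoc rt_simple)
qed simp

lemma Plus_iff_len:
  assumes "u \<in> carrier W" "set bs \<subseteq> S"
  shows "Plus bs u \<longleftrightarrow> len (u \<otimes> prd (rev bs)) = len u + length bs"
  using Plus_len[OF assms] conc_simple_of_len[of u "rev bs"] assms by (auto simp: Plus_def)

text \<open>When \<open>y\<close> is weakly below \<open>inv u\<close>, lengths add in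
  \<open>u = (u y) (inv y)\<close>. A loss of length in \<open>inv y\<close> times the Coxeter
  element would then show in \<open>u\<close> times it.\<close>

lemma Plus_downward:
  assumes "u \<in> carrier W" "set bs \<subseteq> S" "y \<in> carrier W" "Plus bs u" "wle y (inv u)"
  shows "Plus bs (inv y)"
proof -
  have c: "prd (rev bs) \<in> carrier W" using assms simple_word_closed by auto
  have "len (inv y \<otimes> inv u) = len (u \<otimes> y)" using len_inv[of "u \<otimes> y"] assms by (simp add: inv_mult_group)
  then have l: "len u = len y + len (u \<otimes> y)" using assms by (simp add: wle_def)
  have "u \<otimes> prd (rev bs) = (u \<otimes> y) \<otimes> (inv y \<otimes> prd (rev bs))" using assms c by (simp add: m_assoc)
  then have "len u + length bs \<le> len (u \<otimes> y) + len (inv y \<otimes> prd (rev bs))"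
    using len_mult[of "u \<otimes> y" "inv y \<otimes> prd (rev bs)"] Plus_len[OF assms(1,2,4)] assms c by simp
  then have "len (inv y) + length (rev bs) \<le> len (inv y \<otimes> prd (rev bs))" using l assms by simp
  then have "conc (inv y) (rev bs)" using conc_simple_of_len[of "inv y" "rev bs"] assms by simp
  then show ?thesis by (simp add: Plus_def)
qed

text \<open>
  If \<open>s\<close> is below \<open>x = u\<^sup>-\<^sup>1\<close> but not below \<open>v\<close>, then \<open>v\<close> is fixed for the word \<open>bs\<close> without \<open>s\<close>.
  An acute factorization for \<open>bs\<close> followed by \<open>s\<close> is concordant with \<open>x\<close>, hence with its
  projection \<open>z\<close>, which has the same concordant factorizations; therefore \<open>x\<close> and \<open>z\<close> have the
  same projection for \<open>bs\<close>, and \<open>v\<close> lies below it.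
\<close>
lemma projection_word_maximal:
  assumes "coxeter_word bs" "u \<in> carrier W" "v \<in> carrier W" "Plus bs u"
    "prd (projection_word bs (inv v)) = v" "wle v (inv u)"
  shows "wle v (prd (projection_word bs u))"
  using assms
proof (induction bs u arbitrary: v rule: lex_induct)
  case (1 bs u)
  show ?case
  proof (cases bs)
    case Nil then show ?thesis using "1.prems" by simp
  next
    case (Cons s bs')
    note cw = coxeter_word_Cons[OF "1.prems"(1)[unfolded Cons]]
    note pr = "1.prems"[unfolded Cons]
    have s: "s \<in> S" using cw by simp
    have sub: "set bs' \<subseteq> S" "set (s # bs') \<subseteq> S" "set (bs' @ [s]) \<subseteq> S" using pr(1) by (auto simp: coxeter_word_def)
    have Pl: "Plus bs' u" using Plus_Cons[OF pr(2,1)] pr(4) by simp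
    have vs: "len (inv v \<otimes> s) = len (s \<otimes> v)" "len (u \<otimes> s) = len (s \<otimes> inv u)"
      using len_inv_mult[OF s, of v] len_inv_mult[OF s, of "inv u"] pr by simp_all
    show ?thesis
    proof (cases "len (u \<otimes> s) < len u")
      case False
      then have nv: "\<not> len (inv v \<otimes> s) < len (inv v)"
        using wle_descent[OF s, of v "inv u"] vs pr by auto
      then have "wle v (prd (projection_word bs' u))"
        using 1(1)[of bs' u v] Cons cw pr Pl by simp
      then show ?thesis using False Cons by simp
    next
      case True
      then have ng: "neg (act u (alpha s))" using up_down pr s by blast
      define y where "y = prd (projection_word (bs' @ [s]) (u \<otimes> s))"
      have y: "y \<in> carrier W" unfolding y_def using projection_word_closed sub by blast
      have z: "prd (projection_word (s # bs') u) = s \<otimes> y" using True by (simp add: y_def)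
      have ly: "len (s \<otimes> y) = len y + 1"
        using projection_word_wle(2)[OF pr(2) sub(2)] projection_word_wle(2)[of "u \<otimes> s", OF _ sub(3)] True pr s
        unfolding z[symmetric] by (simp add: y_def)
      show ?thesis
      proof (cases "len (inv v \<otimes> s) < len (inv v)")
        case T2: True
        define v' where "v' = s \<otimes> v"
        have v': "v' \<in> carrier W" "v = s \<otimes> v'" "inv v \<otimes> s = inv v'" using pr s by (simp_all add: v'_def inv_mult_group)
        have up1: "len v' < len (s \<otimes> v')" unfolding v'(2)[symmetric] using T2 vs(1) pr(3) by (simp add: v'_def)
        have up2: "len (s \<otimes> inv u) < len (s \<otimes> (s \<otimes> inv u))" using vs(2) True s pr(2) by simp
        have "s \<otimes> prd (projection_word (bs' @ [s]) (inv v')) = s \<otimes> v'"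
          unfolding v'(2,3)[symmetric] using pr(5) T2 by simp
        then have fv: "prd (projection_word (bs' @ [s]) (inv v')) = v'"
          using s v' projection_word_closed[OF sub(3)] by (metis simple_square')
        have iu: "inv (u \<otimes> s) = s \<otimes> inv u" using pr s by (simp add: inv_mult_group)
        have "wle v' (inv (u \<otimes> s))"
          using wle_mult_left[OF s v'(1), of "s \<otimes> inv u"] up1 up2 pr(2,6) s iu unfolding v'(2)[symmetric] by simp
        then have "wle v' y" unfolding y_def
          using 1(1)[of "bs' @ [s]" "u \<otimes> s" v'] Cons True cw pr(2) v'(1) fv Plus_rotate[OF pr(2,1,4) ng] by simp
        then have "wle v (s \<otimes> y)" using wle_mult_left[OF s v'(1) y] up1 ly unfolding v'(2)[symmetric] by simp
        then show ?thesis unfolding Cons z .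
      next
        case F2: False
        define w where "w = s \<otimes> y"
        have w: "w \<in> carrier W" using s y by (simp add: w_def)
        have fv: "prd (projection_word bs' (inv v)) = v" using F2 pr(5) by simp
        have wu: "wle w (inv u)" using projection_word_wle(1)[OF pr(2) sub(2)] unfolding z w_def .
        have pw: "projection_word (s # bs') (inv w) = projection_word (s # bs') u"
          using projection_word_idem[OF pr(2,1)] unfolding z w_def .
        have Plw: "Plus (s # bs') (inv w)" using Plus_downward[OF pr(2) sub(2) w pr(4) wu] .
        then have Plw': "Plus bs' (inv w)" using Plus_Cons[of "inv w" s bs'] pr(1) w by simp
        have eq: "Conc (s # bs') (inv w) = Conc (s # bs') u"
          using Conc_projection_word[OF pr(1) _ pr(2) Plw pr(4) pw] w by simp
        obtain ts where ts: "ts \<in> Conc bs' u" "acute ts" using exists_acute[of bs' u] cw pr Pl by blast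
        have tsT: "set ts \<subseteq> T" "prd ts = prd (rev bs')" "ts \<in> factorizations bs'" "length ts = length bs'"
          using ts by (auto simp: Conc_def factorizations_def)
        have "ts @ [s] \<in> factorizations (s # bs')"
          using tsT s T_word_closed[OF tsT(1)] sub simple_word_closed by (simp add: factorizations_def)
        then have "ts @ [s] \<in> Conc (s # bs') u"
          using ts(1) conc_append[OF pr(2) tsT(1), of "[s]"] tsT Plus_Cons[OF pr(2,1)] pr(4) s
          by (simp add: Conc_def rt_simple)
        then have "conc (inv w) (ts @ [s])" using eq by (auto simp: Conc_def)
        then have "ts \<in> Conc bs' (inv w)"
          using conc_append[of "inv w" ts "[s]"] w tsT by (simp add: Conc_def)
        then have pe: "projection_word bs' u = projection_word bs' (inv w)"
          using acute_projection_word[of bs' u "inv w" ts] cw pr w Pl Plw' ts by simp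
        have "wle v (prd (projection_word bs' u))"
          using 1(1)[of bs' u v] Cons cw pr Pl fv by simp
        moreover have "wle (prd (projection_word bs' (inv w))) w"
          using projection_word_wle(1)[of "inv w" bs'] w sub by simp
        ultimately have "wle v w"
          using wle_trans[of v "prd (projection_word bs' u)" w] pe w pr projection_word_closed[OF sub(1)] by simp
        then show ?thesis unfolding Cons z w_def .
      qed
    qed
  qed
qed

section \<open>The longest element\<close>

abbreviation longest :: "'a \<Rightarrow> bool" where
  "longest w \<equiv> w \<in> carrier W \<and> (\<forall>v\<in>carrier W. len v \<le> len w)"

lemma act_expand: assumes "b \<in> Phi" shows "act w b = (\<lambda>l. \<Sum>s\<in>S. b s * act w (alpha s) l)"
proof -
  have "b = (\<lambda>l. \<Sum>s\<in>S. b s * alpha s l)"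
    using finite_S Phi_support[OF assms]
    by (intro ext) (simp add: alpha_def if_distrib[of "\<lambda>z. _ * z"] cong: if_cong)
  then show ?thesis using act_sum[OF finite_S, of w b alpha] by simp
qed

text \<open>Every simple reflection is a descent of \<open>w\<close>, so \<open>w\<close> makes all
  simple roots negative, and with them all positive roots.\<close>

lemma longest_flip: assumes "longest w" "b \<in> Phi" shows "pos (act w b) \<longleftrightarrow> neg b"
proof -
  have *: "neg (act w b)" if b: "b \<in> Phi" "pos b" for b
  proof -
    have "neg (act w (alpha s))" if s: "s \<in> S" for s
    proof -
      have wc: "w \<in> carrier W" and "w \<otimes> s \<in> carrier W" using assms(1) s by auto
      then have "len (w \<otimes> s) \<le> len w" using assms(1) by blast
      then have "len (w \<otimes> s) < len w" using len_simple_mult[OF wc s] by linarith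
      then show ?thesis using up_down(1)[of w s] assms(1) s by simp
    qed
    then show ?thesis unfolding act_expand[OF b(1)] using b(2)
      by (auto simp: neg_def pos_def intro!: sum_nonpos mult_nonneg_nonpos)
  qed
  have P: "act w b \<in> Phi" using assms act_Phi by blast
  show ?thesis
  proof
    assume "pos (act w b)"
    then show "neg b" using *[OF assms(2)] Phi_not_both[OF P] Phi_sign[OF assms(2)] by blast
  next
    assume "neg b"
    then have "neg (act w (\<lambda>l. - b l))" using *[OF Phi_neg[OF assms(2)]] by simp
    then show "pos (act w b)" by (simp add: act_neg)
  qed
qed

lemma longest_unique: assumes "longest v" "longest w" shows "v = w"
proof -
  have il: "longest (inv w)" using assms by simp
  have "inv w \<otimes> v = \<one>"
  proof (rule faithful)
    fix s assume s: "s \<in> S"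
    have P: "act v (alpha s) \<in> Phi" using PhiI assms s by blast
    have "\<not> pos (act v (alpha s))" using longest_flip[OF assms(1) alpha_Phi[OF s]] Phi_not_both[OF alpha_Phi[OF s]] by auto
    then have "neg (act v (alpha s))" using Phi_sign P by blast
    then show "pos (act (inv w \<otimes> v) (alpha s))" using longest_flip[OF il P] assms s by simp
  qed (use assms in simp)
  then have "w \<otimes> (inv w \<otimes> v) = w" using assms by simp
  then show ?thesis using assms by simp
qed

lemma longest_exists: "\<exists>w. longest w"
proof -
  have "finite (len ` carrier W)" "len ` carrier W \<noteq> {}" using finite_carrier by auto
  then have "Max (len ` carrier W) \<in> len ` carrier W" by (rule Max_in)
  then obtain w where "w \<in> carrier W" "len w = Max (len ` carrier W)" by auto
  then show ?thesis using finite_carrier by (intro exI[of _ w]) auto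
qed

abbreviation w0 :: 'a where "w0 \<equiv> longest_element W S"

lemma longest_w0: "longest w0"
proof -
  obtain w where w: "longest w" using longest_exists by blast
  have "w0 = w" unfolding longest_element_def by (rule the_equality) (use w longest_unique in blast)+
  then show ?thesis using w by simp
qed

lemma w0_closed [simp]: "w0 \<in> carrier W"
  using longest_w0 by blast

lemma w0_inv [simp]: "inv w0 = w0"
  using longest_unique[of "inv w0" w0] longest_w0 by simp

lemma w0_square [simp]: "w0 \<otimes> w0 = \<one>"
  using r_inv[OF w0_closed] unfolding w0_inv .

lemma len_w0_mult:
  assumes "set xs \<subseteq> S" "len (prd xs) = length xs" shows "len (w0 \<otimes> prd xs) + length xs = len w0"
  using assms
proof (induction xs rule: rev_induct)
  case (snoc s xs)
  have cl: "s \<in> S" "set xs \<subseteq> S" "prd xs \<in> carrier W" using snoc.prems simple_word_closed by auto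
  have e: "prd (xs @ [s]) = prd xs \<otimes> s" using cl simple_word_closed by simp
  have "len (prd xs \<otimes> s) = length xs + 1" using snoc.prems e by simp
  moreover have "len (prd xs) \<le> length xs" using len_le cl by blast
  ultimately have l: "len (prd xs) = length xs" "len (prd xs) < len (prd xs \<otimes> s)"
    using len_simple_mult[OF cl(3,1)] by auto
  then have "pos (act (prd xs) (alpha s))" using simple_up_pos cl by blast
  then have "\<not> pos (act w0 (act (prd xs) (alpha s)))"
    using longest_flip[OF longest_w0 PhiI[OF cl(3,1)]] Phi_not_both[OF PhiI[OF cl(3,1)]] by blast
  then have "len (w0 \<otimes> prd xs \<otimes> s) < len (w0 \<otimes> prd xs)"
    using up_down[of "w0 \<otimes> prd xs" s] cl by auto
  then have "len (w0 \<otimes> prd xs) = len (w0 \<otimes> prd xs \<otimes> s) + 1" using len_simple_mult[of "w0 \<otimes> prd xs" s] cl by auto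
  then show ?case using snoc.IH l cl e by (simp add: m_assoc)
qed simp

lemma T_word_rev: "set ts \<subseteq> T \<Longrightarrow> prd (rev ts) = inv (prd ts)"
proof (induction ts)
  case (Cons t ts)
  then have "set ts \<subseteq> carrier W" "t \<in> T" by auto
  then show ?case using Cons by (simp add: inv_mult_group)
qed simp

text \<open>Left multiplication by \<open>w0\<close> exchanges positive and negative roots, and the
  reversed chain meets each reflection from its other side. The two changes of sign cancel.\<close>

lemma conc_rev:
  assumes "u \<in> carrier W" "set ts \<subseteq> T"
  shows "conc (w0 \<otimes> u \<otimes> prd ts) (rev ts) \<longleftrightarrow> conc u ts"
  using assms
proof (induction ts arbitrary: u)
  case (Cons t ts)
  then have t: "t \<in> T" "set ts \<subseteq> T" "prd ts \<in> carrier W" using T_word_closed by auto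
  have 1: "w0 \<otimes> u \<otimes> prd (t # ts) = w0 \<otimes> (u \<otimes> t) \<otimes> prd ts" using Cons.prems t by (simp add: m_assoc)
  have 2: "w0 \<otimes> (u \<otimes> t) \<otimes> prd ts \<otimes> prd (rev ts) = w0 \<otimes> (u \<otimes> t)"
    using Cons.prems t by (simp add: T_word_rev m_assoc)
  have P: "act u (rt t) \<in> Phi" using act_rt_Phi Cons.prems t by simp
  have "pos (act (w0 \<otimes> (u \<otimes> t)) (rt t)) \<longleftrightarrow> pos (act w0 (\<lambda>l. - act u (rt t) l))"
    using Cons.prems t by (simp add: act_rt_self act_neg)
  also have "\<dots> \<longleftrightarrow> pos (act u (rt t))" using longest_flip[OF longest_w0 Phi_neg[OF P]] by simp
  finally show ?case unfolding 1 using Cons.IH[of "u \<otimes> t"] Cons.prems t 2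
    by (auto simp: conc_append)
qed simp

lemma factorizations_rev:
  assumes "set bs \<subseteq> S" shows "rev ts \<in> factorizations (rev bs) \<longleftrightarrow> ts \<in> factorizations bs"
proof -
  have c: "prd (rev bs) \<in> carrier W" "inv (prd (rev bs)) = prd bs"
    using assms simple_word_closed word_rev_inv[of "rev bs"] by auto
  show ?thesis
  proof (cases "set ts \<subseteq> T")
    case True
    then have "prd ts \<in> carrier W" using T_word_closed by auto
    then have "inv (prd ts) = inv (prd (rev bs)) \<longleftrightarrow> prd ts = prd (rev bs)" using c by (metis inv_inv)
    then show ?thesis using True c T_word_rev[OF True] by (simp add: factorizations_def)
  qed (simp add: factorizations_def)
qed

lemma Conc_rev:
  assumes "u \<in> carrier W" "set bs \<subseteq> S"
  shows "rev ts \<in> Conc (rev bs) (w0 \<otimes> u \<otimes> prd (rev bs)) \<longleftrightarrow> ts \<in> Conc bs u"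
  using factorizations_rev[OF assms(2), of ts] conc_rev[OF assms(1), of ts] by (auto simp: Conc_def factorizations_def)

lemma Plus_rev:
  assumes "u \<in> carrier W" "set bs \<subseteq> S"
  shows "Plus (rev bs) (w0 \<otimes> u \<otimes> prd (rev bs)) \<longleftrightarrow> Plus bs u"
proof -
  have "set (rev bs) \<subseteq> T" using assms by auto
  then show ?thesis using conc_rev[OF assms(1), of "rev bs"] by (simp add: Plus_def)
qed

text \<open>Simple letters are reflections, so the lower bound for reflection factorizations also
  bounds the length in \<open>S\<close>.\<close>

lemma coxeter_word_len:
  assumes "coxeter_word cs" shows "len (prd cs) = length cs"
proof -
  have sub: "set cs \<subseteq> S" "prd cs \<in> carrier W" using assms simple_word_closed by (auto simp: coxeter_word_def)
  obtain xs where xs: "set xs \<subseteq> S" "prd xs = prd cs" "length xs = len (prd cs)" using reduced_exists[OF sub(2)] .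
  have "set xs \<subseteq> T" using xs by auto
  then have "length cs \<le> length xs" using absolute_length_lower[of cs xs] assms xs by (simp add: coxeter_word_def)
  then show ?thesis using xs len_le[OF sub(1)] by simp
qed

lemma projection_word_one [simp]: "projection_word bs \<one> = []"
  by (induction bs "\<one>" rule: projection_word.induct) auto

lemma projection_word_Nil_up:
  "projection_word bs u = [] \<Longrightarrow> s \<in> set bs \<Longrightarrow> \<not> len (u \<otimes> s) < len u"
  by (induction bs u rule: projection_word.induct) (auto split: if_splits)

lemma projection_word_descend:
  assumes "w \<in> carrier W" "set xs \<subseteq> S" "len (w \<otimes> prd xs) + length xs = len w"
  shows "projection_word (xs @ ys) w = xs @ projection_word (ys @ xs) (w \<otimes> prd xs)"
  using assms
proof (induction xs arbitrary: w ys)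
  case (Cons x xs)
  then have cl: "x \<in> S" "prd xs \<in> carrier W" "set xs \<subseteq> S" using simple_word_closed by auto
  have "len (w \<otimes> x) \<le> len (w \<otimes> x \<otimes> prd xs) + len (prd xs)"
    using len_mult[of "w \<otimes> x \<otimes> prd xs" "inv (prd xs)"] cl Cons.prems by (simp add: m_assoc)
  moreover have "len (prd xs) \<le> length xs" using len_le cl by blast
  ultimately have "len (w \<otimes> x) < len w" using Cons.prems cl by (simp add: m_assoc)
  moreover have "len w = len (w \<otimes> x) + 1" using calculation len_simple_mult[of w x] Cons.prems cl by auto
  ultimately show ?case using Cons.IH[of "w \<otimes> x" "ys @ [x]"] Cons.prems cl by (simp add: m_assoc)
qed simp

text \<open>
  The map \<open>u \<mapsto> w0 u c\<close> reverses concordant factorizations and exchanges \<open>c\<close> with its inverse.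
  The class of the identity is a singleton, hence so is that of \<open>w0 c\<close>.
\<close>
lemma longest_projection:
  assumes "coxeter_word cs" "set cs = S" shows "prd (projection_word cs w0) = w0"
proof -
  define c where "c = prd cs"
  define u where "u = w0 \<otimes> c"
  define z where "z = prd (projection_word cs u)"
  \<comment> \<open>\<open>y\<close> is the element that the reversing map takes to
    \<open>inv z\<close>, as \<open>zy\<close> records. The aim is \<open>y = \<one>\<close>, which
    makes \<open>z\<close> equal to \<open>inv u\<close>.\<close>
  define y where "y = w0 \<otimes> inv z \<otimes> inv c"
  have cw: "coxeter_word (rev cs)" and sub: "set cs \<subseteq> S" "set (rev cs) \<subseteq> S"
    using assms by (auto simp: coxeter_word_def)
  have c: "c \<in> carrier W" using sub simple_word_closed by (auto simp: c_def)
  have u: "u \<in> carrier W" using c by (simp add: u_def)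
  have z: "z \<in> carrier W" using projection_word_closed sub by (simp add: z_def)
  have y: "y \<in> carrier W" using c z by (simp add: y_def)
  have zy: "inv z = w0 \<otimes> y \<otimes> c" using c z by (simp add: y_def m_assoc flip: m_assoc[of w0 w0])
  have lc: "len c = length cs" using coxeter_word_len assms by (simp add: c_def)
  have P1: "Plus (rev cs) \<one>" using Plus_iff_len[of \<one> "rev cs"] sub c lc by (simp add: c_def)
  have Pu: "Plus cs u" using Plus_rev[of \<one> "rev cs"] P1 sub by (simp add: u_def c_def)
  have Pz: "Plus cs (inv z)" using Plus_downward[OF u sub(1) z Pu] projection_word_wle(1)[OF u sub(1)] by (simp add: z_def)
  have Py: "Plus (rev cs) y" using Plus_rev[OF y sub(2)] Pz by (simp add: zy c_def)
  have "projection_word cs (inv z) = projection_word cs u" using projection_word_idem[OF u assms(1)] by (simp add: z_def)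
  then have "Conc cs (inv z) = Conc cs u"
    using Conc_projection_word[OF assms(1) _ u Pz Pu] z by simp
  then have eq: "ts \<in> Conc (rev cs) y \<longleftrightarrow> ts \<in> Conc (rev cs) \<one>" for ts
    using Conc_rev[OF y sub(2), of ts] Conc_rev[OF one_closed sub(2), of ts]
    by (simp add: zy u_def c_def)
  obtain ts where "ts \<in> Conc (rev cs) \<one>" "acute ts" using exists_acute[OF cw one_closed P1] by blast
  then have "projection_word (rev cs) y = projection_word (rev cs) \<one>"
    using acute_projection_word[OF cw y one_closed Py P1] eq by blast
  then have "projection_word (rev cs) y = []" by simp
  then have "\<not> len (y \<otimes> s) < len y" if "s \<in> S" for s using projection_word_Nil_up[of "rev cs" y s] assms that by simp
  then have "y = \<one>" using descent_exists[OF y] by blast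
  then have "inv z = u" using zy c by (simp add: u_def)
  then have zu: "z = inv u" using z by (metis inv_inv)
  \<comment> \<open>The greedy word of \<open>w0\<close> first takes a full copy of
    \<open>cs\<close> and then goes on with \<open>u\<close>, where it spells
    \<open>z = inv u\<close>.\<close>
  have "projection_word (cs @ []) w0 = cs @ projection_word ([] @ cs) (w0 \<otimes> prd cs)"
    using len_w0_mult[OF sub(1)] lc sub by (intro projection_word_descend) (simp_all add: c_def)
  then have "projection_word cs w0 = cs @ projection_word cs u" by (simp add: u_def c_def)
  moreover have "set (projection_word cs u) \<subseteq> carrier W" "set cs \<subseteq> carrier W"
    using set_projection_word[of cs u] sub simple_word_closed by blast+
  ultimately have "prd (projection_word cs w0) = c \<otimes> z" by (simp add: c_def z_def)
  also have "\<dots> = w0" unfolding zu u_def using c by (simp add: inv_mult_group)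
  finally show ?thesis .
qed

end

section \<open>Sorting words\<close>

lemma periodic_letter_Suc: "periodic_letter (s # cs) (Suc p) = periodic_letter (cs @ [s]) p"
proof -
  let ?n = "length (s # cs)"
  have "(cs @ [s]) ! (p mod ?n) = rotate1 (s # cs) ! (p mod ?n)" by simp
  also have "\<dots> = (s # cs) ! (Suc (p mod ?n) mod ?n)" by (rule nth_rotate1) simp
  also have "Suc (p mod ?n) mod ?n = Suc p mod ?n" by (rule mod_Suc_eq)
  finally show ?thesis by (simp add: periodic_letter_def)
qed

lemma periodic_letter_0 [simp]: "periodic_letter (s # cs) 0 = s"
  by (simp add: periodic_letter_def)

lemma map_periodic_letter_Suc:
  "map (periodic_letter (s # cs)) (map Suc ps) = map (periodic_letter (cs @ [s])) ps"
  by (simp add: periodic_letter_Suc)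

lemma positions_exist:
  assumes "set xs \<subseteq> set cs"
  shows "\<exists>ps. sorted_wrt (<) ps \<and> (\<forall>p\<in>set ps. k \<le> p) \<and> map (periodic_letter cs) ps = xs"
  using assms
proof (induction xs arbitrary: k)
  case (Cons x xs)
  then obtain i where i: "i < length cs" "cs ! i = x" by (auto simp: in_set_conv_nth)
  define p where "p = i + length cs * k"
  have "1 * k \<le> length cs * k" using i by (intro mult_right_mono) auto
  then have "k \<le> p" unfolding p_def by linarith
  moreover have "periodic_letter cs p = x" using i by (simp add: p_def periodic_letter_def)
  ultimately have p: "k \<le> p" "periodic_letter cs p = x" by blast+
  obtain ps where ps: "sorted_wrt (<) ps" "\<forall>q\<in>set ps. Suc p \<le> q" "map (periodic_letter cs) ps = xs"
    using Cons.IH[of "Suc p"] Cons.prems by auto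
  then show ?case using p by (intro exI[of _ "p # ps"]) (auto simp: Suc_le_eq intro: order_trans)
qed simp

lemma lex_total:
  "length xs = length ys \<Longrightarrow> xs = ys \<or> (xs, ys) \<in> lex less_than \<or> (ys, xs) \<in> lex less_than"
proof (induction xs ys rule: list_induct2)
  case (Cons x xs y ys)
  then show ?case by (cases x y rule: linorder_cases) auto
qed simp

lemma lex_asym: "(xs, ys) \<in> lex less_than \<Longrightarrow> (ys, xs) \<notin> lex less_than"
  using wf_asym[OF wf_lex[OF wf_less_than]] .

lemma lex_map_Suc: "(map Suc xs, map Suc ys) \<in> lex less_than \<longleftrightarrow> (xs, ys) \<in> lex less_than"
proof (induction xs arbitrary: ys)
  case (Cons x xs) then show ?case by (cases ys) auto
qed simp

lemma positive_map_Suc: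
  assumes "0 \<notin> set qs" obtains ps where "qs = map Suc ps"
proof -
  have "qs = map Suc (map (\<lambda>q. q - 1) qs)" using assms by (induction qs) auto
  then show ?thesis using that by blast
qed

text \<open>With \<open>r\<close> distinct letters in each copy, nested blocks of a sorting word
  mean that its set of positions is closed under going back one copy.\<close>

definition periodic_down :: "nat \<Rightarrow> nat set \<Rightarrow> bool" where
  "periodic_down r P \<longleftrightarrow> (\<forall>p. p + r \<in> P \<longrightarrow> p \<in> P)"

lemma periodic_down_multiple: "periodic_down r P \<Longrightarrow> 0 \<notin> P \<Longrightarrow> k * r \<notin> P"
proof (induction k)
  case (Suc k) then show ?case by (auto simp: periodic_down_def add.commute)
qed simp

text \<open>Position \<open>0\<close> is missing from a shifted set, so position \<open>r\<close>,
  one copy further on, has to be missing too.\<close>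

lemma periodic_down_Suc: "periodic_down r (Suc ` P) \<longleftrightarrow> periodic_down r P \<and> r \<notin> Suc ` P"
proof
  assume d: "periodic_down r (Suc ` P)"
  have "r \<notin> Suc ` P" using d periodic_down_multiple[OF d, of 1] by auto
  moreover have "p \<in> P" if "p + r \<in> P" for p
  proof -
    have "Suc p + r \<in> Suc ` P" using that by auto
    then have "Suc p \<in> Suc ` P" using d unfolding periodic_down_def by blast
    then show ?thesis by auto
  qed
  ultimately show "periodic_down r P \<and> r \<notin> Suc ` P" by (simp add: periodic_down_def)
next
  assume d: "periodic_down r P \<and> r \<notin> Suc ` P"
  show "periodic_down r (Suc ` P)" unfolding periodic_down_def
  proof (intro allI impI)
    fix p assume "p + r \<in> Suc ` P"
    then show "p \<in> Suc ` P" using d by (cases p) (auto simp: periodic_down_def)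
  qed
qed

lemma periodic_down_insert_Suc:
  assumes "0 < r" shows "periodic_down r (insert 0 (Suc ` P)) \<longleftrightarrow> periodic_down r P"
proof
  assume d: "periodic_down r (insert 0 (Suc ` P))"
  show "periodic_down r P" unfolding periodic_down_def
  proof (intro allI impI)
    fix p assume "p + r \<in> P"
    then have "Suc p + r \<in> insert 0 (Suc ` P)" by auto
    then have "Suc p \<in> insert 0 (Suc ` P)" using d unfolding periodic_down_def by blast
    then show "p \<in> P" by auto
  qed
next
  assume d: "periodic_down r P"
  show "periodic_down r (insert 0 (Suc ` P))" unfolding periodic_down_def
  proof (intro allI impI)
    fix p assume "p + r \<in> insert 0 (Suc ` P)"
    then show "p \<in> insert 0 (Suc ` P)" using d assms by (cases p) (auto simp: periodic_down_def)
  qed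
qed

context finite_coxeter
begin

lemma reduced_word_iff: "reduced_word W S w xs \<longleftrightarrow> set xs \<subseteq> S \<and> prd xs = w \<and> length xs = len w"
  by (auto simp: reduced_word_def in_lists_conv_set)

lemma reduced_word_Cons:
  assumes "s \<in> S" "w \<in> carrier W" "len (s \<otimes> w) < len w"
  shows "reduced_word W S w (s # xs) \<longleftrightarrow> reduced_word W S (s \<otimes> w) xs"
proof -
  have l: "len w = len (s \<otimes> w) + 1" using len_simple_mult_left[OF assms(2,1)] assms(3) by auto
  have "s \<otimes> prd xs = w \<longleftrightarrow> prd xs = s \<otimes> w" if "set xs \<subseteq> S"
    using that assms simple_word_closed[OF that] by (metis simple_square' word_prod_closed)
  then show ?thesis using assms l by (auto simp: reduced_word_iff)
qed

abbreviation least_positions :: "'a list \<Rightarrow> 'a \<Rightarrow> nat list \<Rightarrow> bool" where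
  "least_positions cs w ps \<equiv> ps \<in> reduced_positions W S cs w \<and>
     (\<forall>qs\<in>reduced_positions W S cs w. qs = ps \<or> (ps, qs) \<in> lex less_than)"

lemma reduced_positions_length: "ps \<in> reduced_positions W S cs w \<Longrightarrow> length ps = len w"
  by (auto simp: reduced_positions_def reduced_word_iff)

lemma least_positions_unique:
  assumes "least_positions cs w ps" "least_positions cs w qs" shows "ps = qs"
proof -
  have "qs = ps \<or> (ps, qs) \<in> lex less_than" "ps = qs \<or> (qs, ps) \<in> lex less_than"
    using assms by simp_all
  then show ?thesis using lex_asym[of ps qs] by auto
qed

lemma least_positions_eq: "least_positions cs w ps \<Longrightarrow> sorting_positions W S cs w = ps"
  unfolding sorting_positions_def by (rule the_equality) (assumption, rule least_positions_unique)

lemma sorting_positions_least: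
  assumes "set cs = S" "w \<in> carrier W" shows "least_positions cs w (sorting_positions W S cs w)"
proof -
  let ?R = "reduced_positions W S cs w"
  obtain xs where xs: "set xs \<subseteq> S" "prd xs = w" "length xs = len w" using reduced_exists[OF assms(2)] .
  then obtain ps where ps: "sorted_wrt (<) ps" "map (periodic_letter cs) ps = xs"
    using positions_exist[of xs cs 0] assms by auto
  have "reduced_word W S w (map (periodic_letter cs) ps)" unfolding ps(2) reduced_word_iff using xs by blast
  then have "ps \<in> ?R" using ps(1) by (simp add: reduced_positions_def)
  then obtain m where m: "m \<in> ?R" "\<And>y. (y, m) \<in> lex less_than \<Longrightarrow> y \<notin> ?R"
    using wfE_min'[OF wf_lex[OF wf_less_than], of ?R] by (metis empty_iff)
  have "least_positions cs w m"
  proof (intro conjI ballI)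
    fix qs assume "qs \<in> ?R"
    then show "qs = m \<or> (m, qs) \<in> lex less_than"
      using lex_total[of qs m] m reduced_positions_length by metis
  qed (rule m(1))
  then show ?thesis using least_positions_eq by metis
qed

text \<open>Together with \<open>sorting_positions_up\<close> this turns the lexicographic minimum
  into a recursion along the rotated word: position \<open>0\<close> is used exactly when its letter
  is a left descent.\<close>

lemma sorting_positions_down:
  assumes "set (s # cs) = S" "w \<in> carrier W" "len (s \<otimes> w) < len w"
  shows "sorting_positions W S (s # cs) w = 0 # map Suc (sorting_positions W S (cs @ [s]) (s \<otimes> w))"
proof (rule least_positions_eq)
  let ?ps = "sorting_positions W S (cs @ [s]) (s \<otimes> w)"
  have s: "s \<in> S" using assms by auto
  have lp: "least_positions (cs @ [s]) (s \<otimes> w) ?ps"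
    using assms s by (intro sorting_positions_least) auto
  have iff: "0 # map Suc qs \<in> reduced_positions W S (s # cs) w \<longleftrightarrow> qs \<in> reduced_positions W S (cs @ [s]) (s \<otimes> w)" for qs
    using reduced_word_Cons[OF s assms(2,3)]
    by (simp add: reduced_positions_def sorted_wrt_map periodic_letter_Suc comp_def)
  show "least_positions (s # cs) w (0 # map Suc ?ps)"
  proof (intro conjI ballI)
    show mem: "0 # map Suc ?ps \<in> reduced_positions W S (s # cs) w" using iff lp by blast
    fix qs assume qs: "qs \<in> reduced_positions W S (s # cs) w"
    have l: "length qs = Suc (length ?ps)" using reduced_positions_length[OF qs] reduced_positions_length[OF mem] by simp
    then obtain q qs' where q: "qs = q # qs'" by (cases qs) auto
    have gt: "\<forall>x\<in>set qs'. q < x" using qs q by (simp add: reduced_positions_def)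
    then have "0 \<notin> set qs'" by auto
    then obtain ys where ys: "qs' = map Suc ys" by (rule positive_map_Suc)
    show "qs = 0 # map Suc ?ps \<or> (0 # map Suc ?ps, qs) \<in> lex less_than"
    proof (cases "q = 0")
      case True
      then have "ys \<in> reduced_positions W S (cs @ [s]) (s \<otimes> w)" using iff qs q ys by simp
      then have "ys = ?ps \<or> (?ps, ys) \<in> lex less_than" using lp by blast
      then show ?thesis using q ys True lex_map_Suc by auto
    next
      case False then show ?thesis using q l by simp
    qed
  qed
qed

lemma sorting_positions_up:
  assumes "set (s # cs) = S" "w \<in> carrier W" "\<not> len (s \<otimes> w) < len w"
  shows "sorting_positions W S (s # cs) w = map Suc (sorting_positions W S (cs @ [s]) w)"
proof (rule least_positions_eq)
  let ?ps = "sorting_positions W S (cs @ [s]) w"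
  have s: "s \<in> S" using assms by auto
  have lp: "least_positions (cs @ [s]) w ?ps" using assms s by (intro sorting_positions_least) auto
  have iff: "map Suc qs \<in> reduced_positions W S (s # cs) w \<longleftrightarrow> qs \<in> reduced_positions W S (cs @ [s]) w" for qs
    by (simp add: reduced_positions_def sorted_wrt_map periodic_letter_Suc comp_def)
  show "least_positions (s # cs) w (map Suc ?ps)"
  proof (intro conjI ballI)
    show "map Suc ?ps \<in> reduced_positions W S (s # cs) w" using iff lp by blast
    fix qs assume qs: "qs \<in> reduced_positions W S (s # cs) w"
    have "0 \<notin> set qs"
    proof
      assume "0 \<in> set qs"
      moreover have "sorted_wrt (<) qs" using qs by (simp add: reduced_positions_def)
      ultimately obtain ys where ys: "qs = 0 # ys" by (cases qs) auto
      define xs where "xs = map (periodic_letter (s # cs)) ys"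
      have r: "reduced_word W S w (s # xs)" using qs ys by (simp add: reduced_positions_def xs_def)
      then have "s \<otimes> w = prd xs" using s simple_word_closed[of xs] by (auto simp: reduced_word_iff)
      then have "len (s \<otimes> w) \<le> length xs" using r len_le[of xs] by (simp add: reduced_word_iff)
      then show False using assms(3) r by (simp add: reduced_word_iff)
    qed
    then obtain ys where ys: "qs = map Suc ys" by (rule positive_map_Suc)
    then have "ys \<in> reduced_positions W S (cs @ [s]) w" using iff qs by simp
    then have "ys = ?ps \<or> (?ps, ys) \<in> lex less_than" using lp by blast
    then show "qs = map Suc ?ps \<or> (map Suc ?ps, qs) \<in> lex less_than" using ys lex_map_Suc by auto
  qed
qed

text \<open>
  \<open>K\<close> collects the letters that a sortable element has stopped using. Rotating the word and
  filtering by \<open>K\<close> relates positions in the periodic word to the shrinking words of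
  \<open>projection_word\<close>.
\<close>
lemma sorting_positions_projection_word:
  assumes "distinct cs" "set cs = S" "K \<subseteq> S" "w \<in> carrier W"
  shows "(periodic_down (length cs) (set (sorting_positions W S cs w)) \<and>
      (\<forall>p\<in>set (sorting_positions W S cs w). periodic_letter cs p \<notin> K)
      \<longleftrightarrow> prd (projection_word (filter (\<lambda>x. x \<notin> K) cs) (inv w)) = w) \<and>
    (prd (projection_word (filter (\<lambda>x. x \<notin> K) cs) (inv w)) = w \<longrightarrow>
      map (periodic_letter cs) (sorting_positions W S cs w) = projection_word (filter (\<lambda>x. x \<notin> K) cs) (inv w))"
    (is "?P cs K w")
  using assms
\<comment> \<open>The measure follows the three moves: skipping a letter outside \<open>K\<close>
  enlarges \<open>K\<close>, a descent shortens \<open>w\<close>, and skipping a letter of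
  \<open>K\<close> brings a letter outside \<open>K\<close> nearer to the front.\<close>
proof (induction "(cs, K, w)" arbitrary: cs K w
    rule: wf_induct_rule[OF wf_measures[of "[\<lambda>(cs, K, w). card (S - K), \<lambda>(cs, K, w). len w,
      \<lambda>(cs, K, w). length (takeWhile (\<lambda>x. x \<in> K) cs)]"]])
  case (1 cs K w)
  let ?ps = "sorting_positions W S cs w"
  have IH: "?P cs' K' w'"
    if "card (S - K') < card (S - K) \<or> card (S - K') = card (S - K) \<and> (len w' < len w \<or> len w' = len w \<and>
        length (takeWhile (\<lambda>x. x \<in> K') cs') < length (takeWhile (\<lambda>x. x \<in> K) cs))"
      "distinct cs'" "set cs' = S" "K' \<subseteq> S" "w' \<in> carrier W" for cs' K' w'
    using 1(1)[of cs' K' w'] that by auto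
  have lp: "least_positions cs w ?ps" using sorting_positions_least 1 by blast
  show ?case
  proof (cases "S - K = {}")
    case True
    then have f: "filter (\<lambda>x. x \<notin> K) cs = []" using 1 by (auto simp: filter_empty_conv)
    have letters: "set (map (periodic_letter cs) ?ps) \<subseteq> S" and pr: "prd (map (periodic_letter cs) ?ps) = w"
      using lp by (auto simp: reduced_positions_def reduced_word_iff)
    have "?ps = [] \<longleftrightarrow> w = \<one>"
      using reduced_positions_length[of ?ps cs w] lp len_0[of w] 1 by auto
    moreover have "periodic_letter cs p \<in> K" if "p \<in> set ?ps" for p using letters True that by auto
    then have "(\<forall>p\<in>set ?ps. periodic_letter cs p \<notin> K) \<longleftrightarrow> ?ps = []" by (cases ?ps) auto
    moreover have "periodic_down (length cs) (set [])" by (simp add: periodic_down_def)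
    ultimately show ?thesis unfolding f by auto
  next
    case False
    then have "cs \<noteq> []" using 1 by auto
    then obtain s cs' where cs: "cs = s # cs'" by (cases cs) auto
    define rot where "rot = cs' @ [s]"
    have s: "s \<in> S" "s \<notin> set cs'" using 1 cs by auto
    have rot: "distinct rot" "set rot = S" "length rot = length cs" using 1 cs by (auto simp: rot_def)
    have lsw: "len (inv w \<otimes> s) = len (s \<otimes> w)" using len_inv_mult s 1 by blast
    have letter_r: "periodic_letter rot (length cs - 1) = s" by (simp add: rot_def cs periodic_letter_def)
    have upcase: "periodic_down (length cs) (set ?ps) \<longleftrightarrow>
          periodic_down (length cs) (set (sorting_positions W S rot w)) \<and> length cs - 1 \<notin> set (sorting_positions W S rot w)"
        and letters_up: "map (periodic_letter cs) ?ps = map (periodic_letter rot) (sorting_positions W S rot w)"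
        and pseq: "?ps = map Suc (sorting_positions W S rot w)"
      if "\<not> len (s \<otimes> w) < len w"
    proof -
      show e: "?ps = map Suc (sorting_positions W S rot w)"
        using sorting_positions_up[of s cs' w] that 1 by (simp add: cs rot_def)
      show "periodic_down (length cs) (set ?ps) \<longleftrightarrow>
          periodic_down (length cs) (set (sorting_positions W S rot w)) \<and> length cs - 1 \<notin> set (sorting_positions W S rot w)"
        unfolding e set_map periodic_down_Suc by (auto simp: cs)
      show "map (periodic_letter cs) ?ps = map (periodic_letter rot) (sorting_positions W S rot w)"
        unfolding e unfolding cs rot_def by (rule map_periodic_letter_Suc)
    qed
    show ?thesis
    proof (cases "s \<in> K")
      case sK: True
      have f: "filter (\<lambda>x. x \<notin> K) cs = filter (\<lambda>x. x \<notin> K) rot" using sK by (simp add: cs rot_def)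
      have sF: "s \<notin> set (projection_word (filter (\<lambda>x. x \<notin> K) cs) (inv w))"
        "set (projection_word (filter (\<lambda>x. x \<notin> K) cs) (inv w)) \<subseteq> S"
        using set_projection_word[of "filter (\<lambda>x. x \<notin> K) cs" "inv w"] sK 1(3) by auto
      show ?thesis
      proof (cases "len (s \<otimes> w) < len w")
        case True
        have "?ps = 0 # map Suc (sorting_positions W S rot (s \<otimes> w))"
          using sorting_positions_down[of s cs' w] True 1 by (simp add: cs rot_def)
        then have "\<not> (\<forall>p\<in>set ?ps. periodic_letter cs p \<notin> K)" using sK by (simp add: cs)
        moreover have "prd (projection_word (filter (\<lambda>x. x \<notin> K) cs) (inv w)) \<noteq> w"
        proof
          assume e: "prd (projection_word (filter (\<lambda>x. x \<notin> K) cs) (inv w)) = w"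
          have "len (inv w) < len (inv w \<otimes> s)" using support_up[OF s(1) sF(2,1)] unfolding e .
          then show False using True lsw 1 by simp
        qed
        ultimately show ?thesis by blast
      next
        case nd: False
        obtain x where x: "x \<in> set cs'" "x \<notin> K" using False 1 cs sK by auto
        have tw: "length (takeWhile (\<lambda>x. x \<in> K) rot) < length (takeWhile (\<lambda>x. x \<in> K) cs)"
          unfolding rot_def takeWhile_append1[of x cs' "\<lambda>x. x \<in> K", OF x] using sK by (simp add: cs)
        have ih: "?P rot K w" using IH[of K w rot] tw rot 1 by blast
        have "length cs - 1 \<notin> set (sorting_positions W S rot w)"
          if "\<forall>p\<in>set (sorting_positions W S rot w). periodic_letter rot p \<notin> K"
          using that letter_r sK by auto
        moreover have "(\<forall>p\<in>set ?ps. periodic_letter cs p \<notin> K) \<longleftrightarrow>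
            (\<forall>p\<in>set (sorting_positions W S rot w). periodic_letter rot p \<notin> K)"
          using arg_cong[OF letters_up[OF nd], of set] by (metis (no_types, lifting) image_iff list.set_map)
        ultimately show ?thesis
          using ih upcase[OF nd] letters_up[OF nd] rot(3) unfolding f by auto
      qed
    next
      case sK: False
      define F where "F = filter (\<lambda>x. x \<notin> K) cs'"
      have f: "filter (\<lambda>x. x \<notin> K) cs = s # F" "filter (\<lambda>x. x \<notin> K) rot = F @ [s]"
        using sK by (simp_all add: cs rot_def F_def)
      have subF: "set (F @ [s]) \<subseteq> S" using 1 cs s by (auto simp: F_def)
      show ?thesis
      proof (cases "len (s \<otimes> w) < len w")
        case True
        have sw: "s \<otimes> w \<in> carrier W" "inv w \<otimes> s = inv (s \<otimes> w)" using s 1 by (simp_all add: inv_mult_group)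
        have e: "?ps = 0 # map Suc (sorting_positions W S rot (s \<otimes> w))"
          using sorting_positions_down[of s cs' w] True 1 by (simp add: cs rot_def)
        have ih: "?P rot K (s \<otimes> w)" using IH[of K "s \<otimes> w" rot] True rot sw 1 by blast
        have pw: "projection_word (s # F) (inv w) = s # projection_word (F @ [s]) (inv (s \<otimes> w))"
          using True lsw sw 1 by simp
        have "s \<otimes> prd (projection_word (F @ [s]) (inv (s \<otimes> w))) = w \<longleftrightarrow>
            prd (projection_word (F @ [s]) (inv (s \<otimes> w))) = s \<otimes> w"
          using projection_word_closed[OF subF] s 1 by (metis simple_square')
        moreover have "periodic_down (length cs) (set ?ps) \<longleftrightarrow> periodic_down (length cs) (set (sorting_positions W S rot (s \<otimes> w)))"
          unfolding e using periodic_down_insert_Suc[of "length cs"] by (simp add: cs)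
        moreover have "map (periodic_letter cs) ?ps = s # map (periodic_letter rot) (sorting_positions W S rot (s \<otimes> w))"
          unfolding e unfolding cs rot_def by (simp add: periodic_letter_Suc)
        moreover have "(\<forall>p\<in>set ?ps. periodic_letter cs p \<notin> K) \<longleftrightarrow>
            (\<forall>p\<in>set (sorting_positions W S rot (s \<otimes> w)). periodic_letter rot p \<notin> K)"
          unfolding e unfolding cs rot_def using sK by (simp add: periodic_letter_Suc)
        ultimately show ?thesis using ih rot(3) pw unfolding f by auto
      next
        case nd: False
        define K' where "K' = insert s K"
        have f': "filter (\<lambda>x. x \<notin> K') rot = F"
          using s by (auto simp: rot_def F_def K'_def intro!: filter_cong)
        have "S - K' \<subset> S - K" using s sK by (auto simp: K'_def)
        then have "card (S - K') < card (S - K)" using finite_S by (intro psubset_card_mono) auto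
        then have ih: "?P rot K' w" using IH[of K' w rot] rot s 1 by (auto simp: K'_def)
        have pw: "projection_word (s # F) (inv w) = projection_word F (inv w)"
          using nd lsw 1 by simp
        have lK: "(\<forall>p\<in>set ?ps. periodic_letter cs p \<notin> X) \<longleftrightarrow>
            (\<forall>p\<in>set (sorting_positions W S rot w). periodic_letter rot p \<notin> X)" for X
          using arg_cong[OF letters_up[OF nd], of set] by (metis (no_types, lifting) image_iff list.set_map)
        have "periodic_letter cs p \<noteq> s" if pd: "periodic_down (length cs) (set ?ps)" and p: "p \<in> set ?ps" for p
        proof
          assume "periodic_letter cs p = s"
          then have "cs ! (p mod length cs) = cs ! 0" by (simp add: periodic_letter_def cs)
          moreover have "p mod length cs < length cs" "0 < length cs" by (simp_all add: cs)
          ultimately have "p mod length cs = 0" using nth_eq_iff_index_eq[OF 1(2)] by blast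
          then have "p = (p div length cs) * length cs" by auto
          moreover have "0 \<notin> set ?ps" unfolding pseq[OF nd] by auto
          ultimately show False using periodic_down_multiple[OF pd] p by metis
        qed
        moreover have "length cs - 1 \<notin> set (sorting_positions W S rot w)"
          if "\<forall>p\<in>set (sorting_positions W S rot w). periodic_letter rot p \<notin> K'"
          using that letter_r by (auto simp: K'_def)
        ultimately have "periodic_down (length cs) (set ?ps) \<and> (\<forall>p\<in>set ?ps. periodic_letter cs p \<notin> K) \<longleftrightarrow>
            periodic_down (length cs) (set (sorting_positions W S rot w)) \<and>
            (\<forall>p\<in>set (sorting_positions W S rot w). periodic_letter rot p \<notin> K')"
          using upcase[OF nd] lK[of K] lK[of K'] by (auto simp: K'_def)
        then show ?thesis using ih rot(3) pw letters_up[OF nd] unfolding f f' by auto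
      qed
    qed
  qed
qed

lemma sortable_iff:
  assumes "distinct cs" "set cs = S"
  shows "sortable W S cs w \<longleftrightarrow> w \<in> carrier W \<and> prd (projection_word cs (inv w)) = w"
proof -
  have "(\<forall>k. sorting_block W S cs (k + 1) w \<subseteq> sorting_block W S cs k w) \<longleftrightarrow>
      periodic_down (length cs) (set (sorting_positions W S cs w))" (is "?L \<longleftrightarrow> ?R")
    if w: "w \<in> carrier W"
  proof (cases "cs = []")
    case True
    \<comment> \<open>Division by zero puts every position into block \<open>0\<close>, and closure
      under going back zero steps is void.\<close>
    then show ?thesis by (auto simp: sorting_block_def periodic_down_def)
  next
    case False
    then have r: "0 < length cs" by simp
    show ?thesis
    proof
      assume L: ?L
      show ?R unfolding periodic_down_def
      proof (intro allI impI)
        fix p assume p: "p + length cs \<in> set (sorting_positions W S cs w)"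
        define k where "k = p div length cs"
        have "(p + length cs) div length cs = k + 1" using r by (simp add: k_def)
        then have "periodic_letter cs (p + length cs) \<in> sorting_block W S cs (k + 1) w"
          unfolding sorting_block_def using p by blast
        then have "periodic_letter cs (p + length cs) \<in> sorting_block W S cs k w" using L by blast
        then obtain q where q: "periodic_letter cs (p + length cs) = periodic_letter cs q"
            "q \<in> set (sorting_positions W S cs w)" "q div length cs = k"
          unfolding sorting_block_def by blast
        have "p mod length cs = q mod length cs"
          using q(1) nth_eq_iff_index_eq[OF assms(1)] r by (simp add: periodic_letter_def)
        then have "p = q" using q(3) unfolding k_def by (metis div_mult_mod_eq)
        then show "p \<in> set (sorting_positions W S cs w)" using q(2) by simp
      qed
    next
      assume R: ?R
      show ?L
      proof (intro allI subsetI)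
        fix k x assume "x \<in> sorting_block W S cs (k + 1) w"
        then obtain p where p: "x = periodic_letter cs p" "p \<in> set (sorting_positions W S cs w)" "p div length cs = k + 1"
          unfolding sorting_block_def by blast
        then have "length cs \<le> p" using r by (metis div_less less_add_one not_le not_add_less2 zero_less_iff_neq_zero add_is_0 one_neq_zero)
        then obtain q where q: "p = q + length cs" by (metis add.commute le_Suc_ex)
        then have "q \<in> set (sorting_positions W S cs w)" using R p by (simp add: periodic_down_def)
        moreover have "q div length cs = k" using p(3) q r by simp
        moreover have "x = periodic_letter cs q" using p(1) q by (simp add: periodic_letter_def)
        ultimately show "x \<in> sorting_block W S cs k w" unfolding sorting_block_def by blast
      qed
    qed
  qed
  moreover have "periodic_down (length cs) (set (sorting_positions W S cs w)) \<longleftrightarrow> prd (projection_word cs (inv w)) = w"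
    if "w \<in> carrier W"
    using sorting_positions_projection_word[OF assms _ that, of "{}"] by simp
  ultimately show ?thesis unfolding sortable_def by blast
qed

lemma sorting_word_sortable:
  assumes "distinct cs" "set cs = S" "w \<in> carrier W" "prd (projection_word cs (inv w)) = w"
  shows "sorting_word W S cs w = projection_word cs (inv w)"
  using sorting_positions_projection_word[OF assms(1,2) _ assms(3), of "{}"] assms(4) by (simp add: sorting_word_def)

text \<open>\<open>projection_word_idem\<close> makes the greedy value sortable, and
  \<open>projection_word_maximal\<close> gives the maximality on which the definite description
  depends. The latter is where \<open>Plus\<close> enters.\<close>

lemma cambrian_proj_eq:
  assumes "distinct bs" "set bs = S" "u \<in> carrier W" "Plus bs u"
  shows "cambrian_proj W S bs (inv u) = prd (projection_word bs u)"
proof -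
  let ?y = "prd (projection_word bs u)"
  have cw: "coxeter_word bs" and sub: "set bs \<subseteq> S" using assms by (auto simp: coxeter_word_def)
  have y: "?y \<in> carrier W" using projection_word_closed sub by blast
  have "sortable W S bs ?y"
    using sortable_iff[OF assms(1,2)] projection_word_idem[OF assms(3) cw] y by simp
  moreover have "right_weak_le W S ?y (inv u)"
    using right_weak_le_iff[OF y] projection_word_wle(1)[OF assms(3) sub] assms by simp
  moreover have max: "right_weak_le W S v ?y" if "sortable W S bs v" "right_weak_le W S v (inv u)" for v
  proof -
    have v: "v \<in> carrier W" "prd (projection_word bs (inv v)) = v" using that sortable_iff[OF assms(1,2)] by auto
    then have "wle v (inv u)" using that right_weak_le_iff assms by simp
    then show ?thesis using projection_word_maximal[OF cw assms(3) v(1) assms(4) v(2)] right_weak_le_iff[OF v(1) y] by simp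
  qed
  ultimately show ?thesis unfolding cambrian_proj_def
  proof (intro the_equality conjI allI impI)
    fix v assume v: "sortable W S bs v \<and> right_weak_le W S v (inv u) \<and>
        (\<forall>v'. sortable W S bs v' \<and> right_weak_le W S v' (inv u) \<longrightarrow> right_weak_le W S v' v)"
    then have vW: "v \<in> carrier W" by (simp add: sortable_def)
    have "right_weak_le W S v ?y" "right_weak_le W S ?y v"
      using v max \<open>sortable W S bs ?y\<close> \<open>right_weak_le W S ?y (inv u)\<close> by blast+
    then show "v = ?y" using wle_antisym[OF vW y] right_weak_le_iff[OF vW y] right_weak_le_iff[OF y vW] by blast
  qed auto
qed

text \<open>Two elements share a class when their projections agree, and
  \<open>projection_word_idem\<close> recovers the greedy word from its product.\<close>

lemma same_cambrian_class_iff: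
  assumes "distinct bs" "set bs = S" "u \<in> carrier W" "Plus bs u" "u' \<in> carrier W" "Plus bs u'"
  shows "(\<exists>C\<in>cambrian_classes W S bs. inv u \<in> C \<and> inv u' \<in> C) \<longleftrightarrow>
    projection_word bs u = projection_word bs u'"
proof -
  have cw: "coxeter_word bs" using assms by (auto simp: coxeter_word_def)
  have "(\<exists>C\<in>cambrian_classes W S bs. inv u \<in> C \<and> inv u' \<in> C) \<longleftrightarrow>
      cambrian_proj W S bs (inv u) = cambrian_proj W S bs (inv u')"
  proof
    assume "cambrian_proj W S bs (inv u) = cambrian_proj W S bs (inv u')"
    then show "\<exists>C\<in>cambrian_classes W S bs. inv u \<in> C \<and> inv u' \<in> C"
      using assms by (intro bexI[of _ "{y \<in> carrier W. cambrian_proj W S bs y = cambrian_proj W S bs (inv u)}"])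
        (auto simp: cambrian_classes_def)
  qed (auto simp: cambrian_classes_def)
  also have "\<dots> \<longleftrightarrow> prd (projection_word bs u) = prd (projection_word bs u')"
    using cambrian_proj_eq assms by simp
  also have "\<dots> \<longleftrightarrow> projection_word bs u = projection_word bs u'"
    using projection_word_idem[OF assms(3) cw] projection_word_idem[OF assms(5) cw] by metis
  finally show ?thesis .
qed

end

section \<open>The Euler form and the order on reflections\<close>

fun before :: "'a list \<Rightarrow> 'a \<Rightarrow> 'a \<Rightarrow> bool" where
  "before [] x y \<longleftrightarrow> False"
| "before (z # zs) x y \<longleftrightarrow> z = x \<and> y \<in> set zs \<or> before zs x y"

lemma before_append:
  "before (xs @ ys) a b \<longleftrightarrow> before xs a b \<or> before ys a b \<or> a \<in> set xs \<and> b \<in> set ys"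
  by (induction xs) auto

lemma before_in: "before xs a b \<Longrightarrow> a \<in> set xs \<and> b \<in> set xs"
  by (induction xs) auto

lemma before_map: "before xs a b \<Longrightarrow> before (map f xs) (f a) (f b)"
  by (induction xs) auto

lemma before_iff_nth: "before xs a b \<longleftrightarrow> (\<exists>i j. i < j \<and> j < length xs \<and> xs ! i = a \<and> xs ! j = b)"
proof (induction xs)
  case (Cons x xs)
  show ?case
  proof
    assume "before (x # xs) a b"
    then consider "x = a" "b \<in> set xs" | "before xs a b" by auto
    then show "\<exists>i j. i < j \<and> j < length (x # xs) \<and> (x # xs) ! i = a \<and> (x # xs) ! j = b"
    proof cases
      case 1
      then obtain j where "j < length xs" "xs ! j = b" by (auto simp: in_set_conv_nth)
      then show ?thesis using 1 by (intro exI[of _ 0] exI[of _ "Suc j"]) simp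
    next
      case 2
      then obtain i j where "i < j" "j < length xs" "xs ! i = a" "xs ! j = b" using Cons by blast
      then show ?thesis by (intro exI[of _ "Suc i"] exI[of _ "Suc j"]) simp
    qed
  next
    assume "\<exists>i j. i < j \<and> j < length (x # xs) \<and> (x # xs) ! i = a \<and> (x # xs) ! j = b"
    then obtain i j where ij: "i < j" "j < length (x # xs)" "(x # xs) ! i = a" "(x # xs) ! j = b" by blast
    then obtain j' where j': "j = Suc j'" "j' < length xs" "xs ! j' = b" by (cases j) auto
    show "before (x # xs) a b"
    proof (cases i)
      case 0 then show ?thesis using ij j' by auto
    next
      case (Suc i') then show ?thesis using ij j' Cons by auto
    qed
  qed
qed simp

context group
begin

text \<open>Insertion sort: only pairs with increasing values of \<open>f\<close> are ever
  interchanged, and these commute by assumption.\<close>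

lemma commutation_equiv_sort:
  assumes "\<And>x y. before xs x y \<Longrightarrow> f x < f y \<Longrightarrow> x \<otimes> y = y \<otimes> x"
  shows "\<exists>ys. commutation_equiv G xs ys \<and> sorted_wrt (\<lambda>a b. f b \<le> (f a :: nat)) ys"
  using assms
proof (induction xs)
  case Nil then show ?case by (intro exI[of _ "[]"]) simp
next
  case (Cons x xs)
  then obtain ys where ys: "commutation_equiv G xs ys" "sorted_wrt (\<lambda>a b. f b \<le> f a) ys" by auto
  define A where "A = takeWhile (\<lambda>a. f x < f a) ys"
  define C where "C = dropWhile (\<lambda>a. f x < f a) ys"
  have AC: "ys = A @ C" by (simp add: A_def C_def)
  have fA: "f x < f a" if "a \<in> set A" for a using that set_takeWhileD unfolding A_def by metis
  have fC: "f c \<le> f x" if "c \<in> set C" for c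
  proof (cases C)
    case (Cons d D)
    then have "f d \<le> f x" using hd_dropWhile[of "\<lambda>a. f x < f a" ys] by (simp add: C_def)
    then show ?thesis using that ys(2) Cons AC by (auto simp: sorted_wrt_append intro: order_trans)
  qed (use that in simp)
  have "x \<otimes> a = a \<otimes> x" if "a \<in> set A" for a
  proof -
    have "a \<in> set xs" using that commutation_equiv_set[OF ys(1)] AC by auto
    then show ?thesis using Cons.prems[of x a] fA[OF that] by simp
  qed
  then have "commutation_equiv G (x # A @ C) (A @ x # C)"
    by (intro commutation_equiv_sym[OF commutation_equiv_move_front]) simp
  then have "commutation_equiv G (x # xs) (A @ x # C)"
    using commutation_equiv_Cons[OF ys(1), of x] commutation_equiv_trans unfolding AC by blast
  moreover have "sorted_wrt (\<lambda>a b. f b \<le> f a) (A @ x # C)"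
    using ys(2) fA fC unfolding AC by (fastforce simp: sorted_wrt_append intro: less_imp_le)
  ultimately show ?case by blast
qed

end

context finite_coxeter
begin

text \<open>The Euler form of the Coxeter element spelled by \<open>bs\<close>. It is a nonsymmetric
  half of \<open>2 * B\<close>: the diagonal entries are 1, and the mixed term of two letters sits
  entirely on the side where the first argument carries the later letter.\<close>

fun euler :: "'a list \<Rightarrow> ('a \<Rightarrow> real) \<Rightarrow> ('a \<Rightarrow> real) \<Rightarrow> real" where
  "euler [] x y = 0"
| "euler (s # bs) x y = x s * y s + 2 * y s * (\<Sum>l\<in>set bs. x l * bf l s) + euler bs x y"

lemma euler_cong:
  "(\<And>l. l \<in> set bs \<Longrightarrow> x l = x' l) \<Longrightarrow> (\<And>l. l \<in> set bs \<Longrightarrow> y l = y' l) \<Longrightarrow> euler bs x y = euler bs x' y'"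
  by (induction bs) (auto intro!: sum.cong)

lemma euler_zero: "(\<And>l. l \<in> set bs \<Longrightarrow> x l = 0) \<Longrightarrow> euler bs x y = 0"
  by (induction bs) auto

lemma euler_zero': "(\<And>l. l \<in> set bs \<Longrightarrow> y l = 0) \<Longrightarrow> euler bs x y = 0"
  by (induction bs) auto

lemma euler_scale: "euler bs (\<lambda>l. a * x l) y = a * euler bs x y"
  by (induction bs) (simp_all add: sum_distrib_left algebra_simps)

lemma euler_append:
  "distinct (bs @ [s]) \<Longrightarrow>
    euler (bs @ [s]) x y = euler bs x y + x s * y s + 2 * x s * (\<Sum>k\<in>set bs. y k * bf s k)"
  by (induction bs) (auto simp: algebra_simps)

lemma B_supported:
  assumes "J \<subseteq> S" "s \<in> S" "\<And>l. l \<in> S - J \<Longrightarrow> x l = 0" shows "B x (alpha s) = (\<Sum>l\<in>J. x l * bf l s)"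
  unfolding B_alpha[OF assms(2)] using assms finite_S by (intro sum.mono_neutral_right) auto

text \<open>Only the coordinate at \<open>s\<close> changes under the reflection, and expanding it
  moves the mixed terms of \<open>s\<close> to the other side, as moving \<open>s\<close> to the end
  of the word does. This is the invariance of the Euler form under reflection at a source or
  sink.\<close>

lemma euler_rotate:
  assumes "coxeter_word (s # bs)" "\<And>l. l \<notin> set (s # bs) \<Longrightarrow> x l = 0" "\<And>l. l \<notin> set (s # bs) \<Longrightarrow> y l = 0"
  shows "euler (bs @ [s]) (refl (alpha s) x) (refl (alpha s) y) = euler (s # bs) x y"
proof -
  have s: "s \<in> S" "s \<notin> set bs" "set bs \<subseteq> S" and d: "distinct (bs @ [s])" using assms by (auto simp: coxeter_word_def)
  have Bx: "B z (alpha s) = z s + (\<Sum>l\<in>set bs. z l * bf l s)" if "\<And>l. l \<notin> set (s # bs) \<Longrightarrow> z l = 0" for z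
    using B_supported[of "set (s # bs)" s z] that s by (simp add: bf_self)
  have off: "refl (alpha s) z l = z l" if "l \<in> set bs" for z l
    using that s by (auto simp: refl_def alpha_def)
  have at: "refl (alpha s) z s = - z s - 2 * (\<Sum>l\<in>set bs. z l * bf l s)"
    if "\<And>l. l \<notin> set (s # bs) \<Longrightarrow> z l = 0" for z
    using Bx[OF that] by (simp add: refl_def alpha_def)
  have 1: "euler bs (refl (alpha s) x) (refl (alpha s) y) = euler bs x y"
    using off by (intro euler_cong) auto
  have 2: "(\<Sum>k\<in>set bs. refl (alpha s) y k * bf s k) = (\<Sum>k\<in>set bs. y k * bf k s)"
    using off s by (intro sum.cong) (auto simp: bf_sym)
  have 3: "refl (alpha s) x s = - x s - 2 * (\<Sum>l\<in>set bs. x l * bf l s)" using assms(2) by (rule at)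
  have 4: "refl (alpha s) y s = - y s - 2 * (\<Sum>l\<in>set bs. y l * bf l s)" using assms(3) by (rule at)
  show ?thesis unfolding euler_append[OF d] euler.simps 1 2 3 4
    by (simp add: algebra_simps)
qed

lemma euler_symmetrize:
  assumes "distinct bs" "set bs \<subseteq> S"
  shows "euler bs x y + euler bs y x = 2 * (\<Sum>l\<in>set bs. \<Sum>k\<in>set bs. x l * y k * bf l k)"
  using assms
proof (induction bs)
  case (Cons s bs)
  have "(\<Sum>k\<in>set bs. x s * y k * bf s k) = x s * (\<Sum>k\<in>set bs. y k * bf k s)"
    unfolding sum_distrib_left using Cons.prems by (intro sum.cong) (auto simp: bf_sym)
  moreover have "(\<Sum>l\<in>set bs. x l * y s * bf l s) = y s * (\<Sum>l\<in>set bs. x l * bf l s)"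
    unfolding sum_distrib_left by (intro sum.cong) auto
  ultimately show ?case using Cons by (simp add: sum.distrib bf_self algebra_simps)
qed simp

lemma euler_B:
  assumes "distinct cs" "set cs = S" shows "euler cs x y + euler cs y x = 2 * B x y"
  using euler_symmetrize[of cs x y] assms by (simp add: B_def)

text \<open>For a word using all of \<open>S\<close> this is the identity
  \<open>E (x - c x, y) = 2 * B x y\<close>, or equivalently \<open>E (c x, y) = - E (y, x)\<close>.
  Coordinates keep it meaningful for the shorter words of the induction.\<close>

lemma euler_coxeter:
  assumes "distinct bs" "set bs \<subseteq> S"
  shows "euler bs (\<lambda>l. x l - act_word bs x l) y = (\<Sum>k\<in>set bs. y k * (2 * B x (alpha k)))"
  using assms
proof (induction bs)
  case (Cons s bs)
  define z where "z = act_word bs x"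
  have s: "s \<in> S" "s \<notin> set bs" "set bs \<subseteq> S" "distinct bs" using Cons.prems by auto
  have zero: "x l - z l = 0" if "l \<notin> set bs" for l
    using act_word_diff[OF s(3) that] by (simp add: z_def)
  define d where "d = (\<lambda>l. x l - act_word (s # bs) x l)"
  have ds: "d s = 2 * B z (alpha s)" using zero[OF s(2)] by (simp add: d_def z_def refl_def alpha_def)
  have dl: "d l = x l - z l" if "l \<in> set bs" for l
    using that s by (auto simp: d_def z_def refl_def alpha_def)
  have 1: "euler bs d y = (\<Sum>k\<in>set bs. y k * (2 * B x (alpha k)))"
    using Cons.IH s euler_cong[of bs d "\<lambda>l. x l - z l" y y] dl by (simp add: z_def)
  have 2: "(\<Sum>l\<in>set bs. d l * bf l s) = B x (alpha s) - B z (alpha s)"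
    using B_supported[OF s(3,1), of "\<lambda>l. x l - z l"] zero dl by (simp add: B_diff1)
  have "euler (s # bs) d y = (\<Sum>k\<in>set (s # bs). y k * (2 * B x (alpha k)))"
    unfolding euler.simps 1 2 ds using s(2) by (simp add: algebra_simps)
  then show ?case by (simp only: d_def)
qed simp

text \<open>For \<open>x\<close> orthogonal to the roots of all other factors,
  \<open>x - c x\<close> is a nonzero multiple of \<open>rt t\<close>. By
  \<open>euler_coxeter\<close> its Euler pairing with \<open>rt z\<close> is
  \<open>2 * B x (rt z)\<close>, which vanishes.\<close>

lemma euler_factorization_head:
  assumes "distinct cs" "set cs = S" "set (t # ts) \<subseteq> T" "length (t # ts) = length cs" "prd (t # ts) = prd cs"
    "z \<in> set ts"
  shows "euler cs (rt t) (rt z) = 0"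
proof -
  have card: "card S = length cs" using assms(1,2) distinct_card by metis
  obtain x where x: "\<exists>l\<in>S. x l \<noteq> 0" "\<And>b. b \<in> set (map rt ts) \<Longrightarrow> B x b = 0"
    using common_orthogonal[of "map rt ts"] card assms by auto
  have t: "t \<in> T" "set ts \<subseteq> T" "prd ts \<in> carrier W" using assms T_word_closed by auto
  have fx: "act (prd ts) x = x" using act_word_refl_fixed[OF t(2)] x by auto
  have "act_word cs x = act (prd (t # ts)) x" using act_prd[of cs x] assms by simp
  also have "\<dots> = (\<lambda>l. x l - 2 * B x (rt t) * rt t l)" using t fx by (simp add: rt refl_def)
  finally have c: "(\<lambda>l. x l - act_word cs x l) = (\<lambda>l. 2 * B x (rt t) * rt t l)" by simp
  have nz: "B x (rt t) \<noteq> 0"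
  proof
    assume "B x (rt t) = 0"
    then have "B x (rt a) = 0" if "a \<in> set (t # ts)" for a using that x(2) by auto
    then have "B x (alpha s) = 0" if "s \<in> S" for s
      using coxeter_orthogonal[of cs "t # ts" x s] assms that by simp
    then show False using nondegenerate x(1) by blast
  qed
  have "2 * B x (rt t) * euler cs (rt t) (rt z) = (\<Sum>k\<in>S. rt z k * (2 * B x (alpha k)))"
    using euler_coxeter[of cs x "rt z"] assms unfolding c by (simp add: euler_scale)
  also have "\<dots> = 2 * B x (rt z)" unfolding B_expand[of x "rt z"] sum_distrib_left by (rule sum.cong) auto
  also have "\<dots> = 0" using x(2) assms(6) by simp
  finally show ?thesis using nz by simp
qed

text \<open>The letters before \<open>t\<close> are moved past it by conjugation with
  \<open>t\<close>; this leaves the letters after \<open>t\<close> untouched and makes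
  \<open>t\<close> the head.\<close>

lemma euler_factorization:
  assumes "distinct cs" "set cs = S" "set ts \<subseteq> T" "length ts = length cs" "prd ts = prd cs" "before ts t z"
  shows "euler cs (rt t) (rt z) = 0"
proof -
  obtain i j where ij: "i < j" "j < length ts" "ts ! i = t" "ts ! j = z" using assms(6) before_iff_nth by metis
  define A where "A = take i ts"
  define Z where "Z = drop (Suc i) ts"
  have ts: "ts = A @ t # Z" using ij id_take_nth_drop[of i ts] by (simp add: A_def Z_def)
  have "Z ! (j - Suc i) = z" "j - Suc i < length Z" using ij by (simp_all add: Z_def)
  then have zZ: "z \<in> set Z" by (metis nth_mem)
  have sub: "set A \<subseteq> T" "t \<in> T" "set Z \<subseteq> T" using assms(3) ts by auto
  have cl: "prd A \<in> carrier W" "prd Z \<in> carrier W" "set A \<subseteq> carrier W" "set Z \<subseteq> carrier W" using sub T_word_closed by auto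
  define A' where "A' = map (\<lambda>a. t \<otimes> a \<otimes> t) A"
  have A': "set A' \<subseteq> T" "prd A' = t \<otimes> prd A \<otimes> t"
  proof -
    show "set A' \<subseteq> T" using sub by (auto simp: A'_def)
    have "prd (map (\<lambda>a. t \<otimes> a \<otimes> t) A) = t \<otimes> prd A \<otimes> t" using sub(1)
    proof (induction A)
      case (Cons a A)
      then have "a \<in> T" "prd A \<in> carrier W" using T_word_closed by auto
      then show ?case using Cons sub(2) by (simp add: m_assoc)
    qed (use sub in simp)
    then show "prd A' = t \<otimes> prd A \<otimes> t" by (simp add: A'_def)
  qed
  have "prd (t # A' @ Z) = prd ts"
    unfolding ts using A' cl sub T_word_closed[OF A'(1)] by (simp add: m_assoc)
  then show ?thesis
    using euler_factorization_head[of cs t "A' @ Z" z] assms A'(1) sub zZ by (simp add: ts A'_def)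
qed

section \<open>Inversion sequences\<close>

lemma inversion_sequence_Nil [simp]: "inversion_sequence W [] = []"
  by (simp add: inversion_sequence_def)

lemma inversion_sequence_Cons:
  assumes "s \<in> S" "set ws \<subseteq> S"
  shows "inversion_sequence W (s # ws) = s # map (conj s) (inversion_sequence W ws)"
proof -
  have "prd (take (Suc i) (s # ws) @ [(s # ws) ! Suc i] @ rev (take (Suc i) (s # ws)))
      = conj s (prd (take i ws @ [ws ! i] @ rev (take i ws)))" if "i < length ws" for i
  proof -
    have sub: "set (take i ws @ [ws ! i] @ rev (take i ws)) \<subseteq> carrier W"
      using that assms(2) simple_word_closed[OF assms(2)] set_take_subset[of i ws] nth_mem[OF that] by auto
    have "take (Suc i) (s # ws) @ [(s # ws) ! Suc i] @ rev (take (Suc i) (s # ws))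
        = s # (take i ws @ [ws ! i] @ rev (take i ws)) @ [s]" by simp
    then show ?thesis using sub assms(1) word_prod_append[OF sub, of "[s]"]
      by (simp only: word_prod_Cons word_prod_Nil) (simp add: m_assoc del: word_prod_append)
  qed
  then show ?thesis using assms(1)
    by (simp add: inversion_sequence_def upt_conv_Cons map_Suc_upt[symmetric] del: upt_Suc)
qed

lemma inversion_sequence_T: "set ws \<subseteq> S \<Longrightarrow> set (inversion_sequence W ws) \<subseteq> T"
proof (induction ws)
  case (Cons s ws)
  then show ?case using map_conj_T[of s "inversion_sequence W ws"] by (simp add: inversion_sequence_Cons)
qed simp

lemma inversion_support:
  assumes "set ws \<subseteq> J" "J \<subseteq> S" "x \<in> set (inversion_sequence W ws)" "l \<notin> J" shows "rt x l = 0"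
  using assms
proof (induction ws arbitrary: x)
  case (Cons s ws)
  then have s: "s \<in> S" "set ws \<subseteq> S" "l \<noteq> s" by auto
  show ?case
  proof (cases "x = s")
    case True then show ?thesis using s by (simp add: rt_simple alpha_def)
  next
    case False
    then obtain y where y: "y \<in> set (inversion_sequence W ws)" "x = conj s y"
      using Cons.prems(3) s by (auto simp: inversion_sequence_Cons)
    then have "y \<in> T" "y \<noteq> s" using inversion_sequence_T[OF s(2)] False s by auto
    then show ?thesis using Cons y s rt_conj_simple(1)[OF s(1), of y] by (simp add: refl_def alpha_def)
  qed
qed simp

lemma inversion_mem:
  assumes "set ws \<subseteq> S" "t \<in> T" "neg (act (inv (prd ws)) (rt t))" shows "t \<in> set (inversion_sequence W ws)"
  using assms
proof (induction ws arbitrary: t)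
  case Nil then show ?case using rt(1,2) Phi_not_both by auto
next
  case (Cons s ws)
  then have s: "s \<in> S" "set ws \<subseteq> S" "prd ws \<in> carrier W" using simple_word_closed by auto
  show ?case
  proof (cases "t = s")
    case False
    have "act (inv (prd (s # ws))) (rt t) = act (inv (prd ws)) (rt (conj s t))"
      using rt_conj_simple(1)[OF s(1) Cons.prems(2) False] s by (simp add: inv_mult_group act_simple)
    then have "conj s t \<in> set (inversion_sequence W ws)" using Cons s by simp
    then have "conj s (conj s t) \<in> set (map (conj s) (inversion_sequence W ws))" unfolding set_map by (rule imageI)
    then show ?thesis using s Cons.prems(2) by (simp add: inversion_sequence_Cons)
  qed (use s in \<open>simp add: inversion_sequence_Cons\<close>)
qed

lemma inversion_reduced:
  assumes "set ws \<subseteq> S" "len (prd ws) = length ws"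
  shows "distinct (inversion_sequence W ws) \<and> (\<forall>x\<in>set (inversion_sequence W ws). neg (act (inv (prd ws)) (rt x)))"
  using assms
proof (induction ws)
  case (Cons s ws)
  let ?I = "inversion_sequence W ws"
  have s: "s \<in> S" "set ws \<subseteq> S" "prd ws \<in> carrier W" using Cons simple_word_closed by auto
  have l: "len (prd ws) = length ws"
    using Cons.prems len_le[OF s(2)] len_simple_mult_left[OF s(3,1)] by auto
  have IH: "distinct ?I" "\<And>x. x \<in> set ?I \<Longrightarrow> neg (act (inv (prd ws)) (rt x))" using Cons s l by auto
  have "len (inv (prd ws)) < len (inv (prd ws) \<otimes> s)" using Cons.prems l len_inv_mult[OF s(1,3)] s by simp
  then have p: "pos (act (inv (prd ws)) (alpha s))" using simple_up_pos s by simp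
  have sI: "s \<notin> set ?I"
  proof
    assume "s \<in> set ?I"
    then have "neg (act (inv (prd ws)) (alpha s))" using IH(2)[of s] s by (simp add: rt_simple)
    then show False using p Phi_not_both PhiI[of "inv (prd ws)" s] s by simp
  qed
  have IT: "set ?I \<subseteq> T" using inversion_sequence_T s by simp
  have "inj_on (conj s) (set ?I)"
    by (rule inj_on_inverseI[of _ "conj s"]) (use IT s in auto)
  then have "distinct (s # map (conj s) ?I)"
    using IH(1) not_in_map_conj[OF s(1) IT sI] by (simp add: distinct_map)
  moreover have "neg (act (inv (prd (s # ws))) (rt x))" if xI: "x \<in> set (s # map (conj s) ?I)" for x
  proof (cases "x = s")
    case True
    then show ?thesis using p s by (simp add: inv_mult_group rt_simple act_simple refl_alpha_self act_neg)
  next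
    case False
    then obtain y where y: "y \<in> set ?I" "x = conj s y" using xI by auto
    then have "y \<in> T" "y \<noteq> s" using IT sI by auto
    then have "act (inv (prd (s # ws))) (rt x) = act (inv (prd ws)) (rt y)"
      using rt_conj_simple(1)[OF s(1), of y] s y(2)
      by (simp add: inv_mult_group act_simple refl_refl B_alpha_alpha bf_self)
    then show ?thesis using IH(2)[OF y(1)] by simp
  qed
  ultimately show ?case using s by (simp add: inversion_sequence_Cons)
qed simp

lemma inversion_sequence_append:
  assumes "set xs \<subseteq> S" "set ys \<subseteq> S"
  shows "inversion_sequence W (xs @ ys) =
    inversion_sequence W xs @ map (\<lambda>t. prd xs \<otimes> t \<otimes> inv (prd xs)) (inversion_sequence W ys)"
  using assms
proof (induction xs)
  case Nil
  have "set (inversion_sequence W ys) \<subseteq> carrier W" using inversion_sequence_T Nil T_word_closed by blast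
  then show ?case by (simp add: map_idI subset_iff)
next
  case (Cons s xs)
  then have s: "s \<in> S" "set xs \<subseteq> S" "prd xs \<in> carrier W" using simple_word_closed by auto
  have "set (inversion_sequence W ys) \<subseteq> carrier W" using inversion_sequence_T Cons T_word_closed by blast
  then have "map (conj s) (map (\<lambda>t. prd xs \<otimes> t \<otimes> inv (prd xs)) (inversion_sequence W ys)) =
      map (\<lambda>t. prd (s # xs) \<otimes> t \<otimes> inv (prd (s # xs))) (inversion_sequence W ys)"
    using s by (auto simp: inv_mult_group m_assoc)
  then show ?case using Cons s by (simp add: inversion_sequence_Cons)
qed

text \<open>Swapping two commuting letters swaps two commuting neighbours of the inversion sequence
  and changes nothing else. For noncommuting reflections the quantifier over words in
  \<open>reflection_le\<close> thus reduces to a single word.\<close>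

lemma before_commutation:
  assumes "commutation_equiv W ws ws'" "set ws \<subseteq> S" "before (inversion_sequence W ws) t t'"
    "t \<otimes> t' \<noteq> t' \<otimes> t"
  shows "before (inversion_sequence W ws') t t'"
proof -
  have "set ws' \<subseteq> S \<and> before (inversion_sequence W ws') t t'"
  proof (rule commutation_equiv_invariant[OF assms(1)])
    fix us a b vs
    assume ab: "a \<otimes> b = b \<otimes> a"
      and *: "set (us @ [a, b] @ vs) \<subseteq> S \<and> before (inversion_sequence W (us @ [a, b] @ vs)) t t'"
    have sub: "set us \<subseteq> S" "a \<in> S" "b \<in> S" "set vs \<subseteq> S" using * by auto
    define g where "g = (\<lambda>t. prd us \<otimes> t \<otimes> inv (prd us))"
    have gW: "prd us \<in> carrier W" using sub simple_word_closed by auto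
    have e: "conj a b = b" "conj b a = a" using ab sub by (simp_all add: m_assoc)
    have VT: "set (inversion_sequence W vs) \<subseteq> T" using inversion_sequence_T sub by blast
    have m: "map (conj a) (map (conj b) (inversion_sequence W vs)) = map (conj b) (map (conj a) (inversion_sequence W vs))"
    proof -
      have "conj a (conj b x) = conj b (conj a x)" if "x \<in> carrier W" for x
      proof -
        have "conj a (conj b x) = (a \<otimes> b) \<otimes> x \<otimes> (b \<otimes> a)" using sub that by (simp add: m_assoc)
        also have "\<dots> = conj b (conj a x)" unfolding ab using sub that ab by (simp add: m_assoc)
        finally show ?thesis .
      qed
      then show ?thesis using VT by auto
    qed
    define R where "R = map g (map (conj a) (map (conj b) (inversion_sequence W vs)))"
    have i1: "inversion_sequence W (us @ [a, b] @ vs) = inversion_sequence W us @ [g a, g b] @ R"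
      using inversion_sequence_append[of us "[a, b] @ vs"] sub e by (simp add: inversion_sequence_Cons g_def R_def)
    have i2: "inversion_sequence W (us @ [b, a] @ vs) = inversion_sequence W us @ [g b, g a] @ R"
      using inversion_sequence_append[of us "[b, a] @ vs"] sub e m by (simp add: inversion_sequence_Cons g_def R_def)
    have "g a \<otimes> g b = prd us \<otimes> (a \<otimes> b) \<otimes> inv (prd us)" using sub gW by (simp add: g_def m_assoc)
    also have "\<dots> = g b \<otimes> g a" unfolding ab using sub gW by (simp add: g_def m_assoc)
    finally have "\<not> (t = g a \<and> t' = g b)" using assms(4) by auto
    then show "set (us @ [b, a] @ vs) \<subseteq> S \<and> before (inversion_sequence W (us @ [b, a] @ vs)) t t'"
      using * unfolding i1 i2 by (auto simp: before_append)
  qed (use assms in simp)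
  then show ?thesis by simp
qed

text \<open>A letter \<open>s\<close> that is taken comes first in the inversion sequence. For a
  positive root \<open>b\<close> the value \<open>E (alpha s, b) = b s\<close> is nonnegative, and
  if it is zero, \<open>E (b, alpha s)\<close> is nonpositive, so pairs with \<open>s\<close> stand
  in the right order. All other pairs arise by conjugation with \<open>s\<close>, under which
  \<open>euler_rotate\<close> carries the claim. If \<open>s\<close> is skipped, the coordinates at
  \<open>s\<close> vanish.\<close>

lemma euler_order:
  assumes "coxeter_word bs" "u \<in> carrier W" "x \<in> set (inversion_sequence W (projection_word bs u))"
    "y \<in> set (inversion_sequence W (projection_word bs u))" "euler bs (rt x) (rt y) = 0"
  shows "(euler bs (rt y) (rt x) < 0 \<longrightarrow> before (inversion_sequence W (projection_word bs u)) x y) \<and>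
    (0 < euler bs (rt y) (rt x) \<longrightarrow> before (inversion_sequence W (projection_word bs u)) y x)"
  using assms
proof (induction bs u arbitrary: x y rule: projection_word.induct)
  case (2 s bs u)
  note cw = coxeter_word_Cons[OF 2(3)]
  have s: "s \<in> S" "s \<notin> set bs" "set bs \<subseteq> S" using 2(3) by (auto simp: coxeter_word_def)
  show ?case
  proof (cases "len (u \<otimes> s) < len u")
    case False
    then have e: "projection_word (s # bs) u = projection_word bs u" by simp
    have z: "rt x s = 0" "rt y s = 0"
      using inversion_support[OF set_projection_word s(3) _ s(2)] 2(5,6) unfolding e by blast+
    have "euler (s # bs) (rt x) (rt y) = euler bs (rt x) (rt y)" "euler (s # bs) (rt y) (rt x) = euler bs (rt y) (rt x)"
      using z by simp_all
    then show ?thesis using 2(2)[OF False] 2(4-7) cw unfolding e by simp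
  next
    case True
    define ws where "ws = projection_word (bs @ [s]) (u \<otimes> s)"
    define I where "I = inversion_sequence W ws"
    have wsub: "set ws \<subseteq> set (bs @ [s])" "set (bs @ [s]) \<subseteq> S"
      unfolding ws_def by (rule set_projection_word) (use s in simp)
    have IT: "set I \<subseteq> T" unfolding I_def using inversion_sequence_T wsub by blast
    have L: "inversion_sequence W (projection_word (s # bs) u) = s # map (conj s) I"
      using True inversion_sequence_Cons[OF s(1) subset_trans[OF wsub]] by (simp add: I_def ws_def)
    have supp: "rt z l = 0" if "z \<in> set I" "l \<notin> set (s # bs)" for z l
      using inversion_support[OF wsub] that by (auto simp: I_def)
    have xy: "x \<in> set (s # map (conj s) I)" "y \<in> set (s # map (conj s) I)" using 2(5,6) unfolding L by auto
    have T': "z \<in> T" if "z \<in> set (s # map (conj s) I)" for z using that map_conj_T[OF s(1) IT] s(1) by auto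
    have z: "alpha s l = 0" if "l \<in> set bs" for l using that s by (auto simp: alpha_def)
    have one: "alpha s s = 1" by (simp add: alpha_def)
    have "(\<Sum>l\<in>set bs. alpha s l * bf l s) = 0" using z by (intro sum.neutral) auto
    then have e1: "euler (s # bs) (alpha s) b = b s" for b
      using euler_zero[of bs "alpha s" b, OF z] one by simp
    have e2: "euler (s # bs) b (alpha s) = b s + 2 * (\<Sum>l\<in>set bs. b l * bf l s)" for b
      using euler_zero'[of bs "alpha s" b, OF z] one by simp
    consider "x = s" | "x \<noteq> s" "y = s" | "x \<noteq> s" "y \<noteq> s" by blast
    then show ?thesis
    proof cases
      case 1
      then have ys: "rt y s = 0" using 2(7) s by (simp only: rt_simple e1)
      then have "y \<noteq> s" using s by (auto simp: rt_simple alpha_def)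
      then have b: "before (s # map (conj s) I) x y" using xy 1 by auto
      have py: "pos (rt y)" using rt(2) T' xy by blast
      have "rt y l * bf l s \<le> 0" if l: "l \<in> set bs" for l
      proof (rule mult_nonneg_nonpos)
        have "l \<in> S" "l \<noteq> s" using l s by auto
        then show "bf l s \<le> 0" using bf_nonpos s by blast
        show "0 \<le> rt y l" using py \<open>l \<in> S\<close> by (simp add: pos_def)
      qed
      then have "(\<Sum>l\<in>set bs. rt y l * bf l s) \<le> 0" by (intro sum_nonpos)
      then have "euler (s # bs) (rt y) (rt x) \<le> 0" using ys 1 s by (simp only: rt_simple e2)
      then show ?thesis using b unfolding L by auto
    next
      case 2
      have "pos (rt x)" using rt(2) T' xy by blast
      then have "0 \<le> euler (s # bs) (rt y) (rt x)" using 2 s by (simp only: rt_simple e1) (simp add: pos_def)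
      moreover have "before (s # map (conj s) I) y x" using xy 2 by auto
      ultimately show ?thesis unfolding L by auto
    next
      case 3
      then obtain x' y' where x': "x' \<in> set I" "x = conj s x'" and y': "y' \<in> set I" "y = conj s y'" using xy by auto
      then have n: "x' \<in> T" "y' \<in> T" "x' \<noteq> s" "y' \<noteq> s" using IT 3 s by auto
      have rx: "rt x = refl (alpha s) (rt x')" "rt y = refl (alpha s) (rt y')"
        using rt_conj_simple(1)[OF s(1)] n x' y' by simp_all
      have sup: "refl (alpha s) (rt z) l = 0" if "z \<in> set I" "l \<notin> set (s # bs)" for z l
        using supp[OF that] that by (auto simp: refl_def alpha_def)
      have eu: "euler (s # bs) (refl (alpha s) (rt a)) (refl (alpha s) (rt b)) = euler (bs @ [s]) (rt a) (rt b)"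
        if "a \<in> set I" "b \<in> set I" for a b
        using euler_rotate[OF \<open>coxeter_word (s # bs)\<close>, of "refl (alpha s) (rt a)" "refl (alpha s) (rt b)"] sup that s
        by (simp add: refl_refl B_alpha_alpha bf_self)
      have ih: "(euler (bs @ [s]) (rt y') (rt x') < 0 \<longrightarrow> before I x' y') \<and>
          (0 < euler (bs @ [s]) (rt y') (rt x') \<longrightarrow> before I y' x')"
        unfolding I_def ws_def
      proof (rule 2(1)[OF True])
        show "euler (bs @ [s]) (rt x') (rt y') = 0" using 2(7) eu x' y' rx by simp
      qed (use cw 2(4) s x' y' in \<open>auto simp: I_def ws_def\<close>)
      have "before (s # map (conj s) I) x y" if "before I x' y'"
        using before_map[OF that, of "conj s"] x' y' by simp
      moreover have "before (s # map (conj s) I) y x" if "before I y' x'"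
        using before_map[OF that, of "conj s"] x' y' by simp
      ultimately show ?thesis using ih eu x' y' rx unfolding L by simp
    qed
  qed
qed simp

section \<open>Maximal chains of noncrossing partitions\<close>

text \<open>If a letter were missing from \<open>cs\<close>, some nonzero vector would be orthogonal
  to all letters of \<open>cs\<close>, hence by \<open>coxeter_orthogonal\<close> to all simple
  roots. A word of length \<open>card S\<close> that uses every letter has no repetition.\<close>

lemma standard_coxeter_word:
  assumes "distinct ws" "set ws = S" "reduced_word W S (prd ws) cs"
  shows "distinct cs" "set cs = S"
proof -
  have cs: "set cs \<subseteq> S" "prd cs = prd ws" "length cs = len (prd ws)" using assms(3) by (auto simp: reduced_word_iff)
  have l: "length cs = card S"
    using coxeter_word_len[of ws] assms cs distinct_card[OF assms(1)] by (simp add: coxeter_word_def)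
  show "set cs = S"
  proof (rule ccontr)
    assume "set cs \<noteq> S"
    then have "card (set cs) < card S" using cs(1) finite_S by (intro psubset_card_mono) auto
    then have "length (map alpha (remdups cs)) < card S" by (simp add: length_remdups_card_conv)
    then obtain x where x: "\<exists>l\<in>S. x l \<noteq> 0" "\<And>b. b \<in> set (map alpha (remdups cs)) \<Longrightarrow> B x b = 0"
      using common_orthogonal by blast
    have "B x (rt t) = 0" if "t \<in> set cs" for t
    proof -
      have "t \<in> S" using that cs(1) by blast
      then show ?thesis using x(2)[of "alpha t"] that by (simp add: rt_simple)
    qed
    moreover have "set cs \<subseteq> T" using cs(1) by auto
    ultimately have "B x (alpha s) = 0" if "s \<in> S" for s
      using coxeter_orthogonal[of ws cs x s] assms cs that by simp
    then show False using nondegenerate x(1) by blast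
  qed
  then show "distinct cs" using l by (intro card_distinct) simp
qed

lemma inv_mult_one:
  assumes "u \<in> carrier W" "v \<in> carrier W" "inv u \<otimes> v = \<one>" shows "v = u"
proof -
  have "u \<otimes> (inv u \<otimes> v) = u" unfolding assms(3) using assms by simp
  then show ?thesis using assms(1,2) by simp
qed

section \<open>Reflection length and covers of the absolute order\<close>

abbreviation alen :: "'a \<Rightarrow> nat" where "alen \<equiv> word_length W T"

lemma T_word_exists: assumes "x \<in> carrier W" shows "\<exists>ts. set ts \<subseteq> T \<and> prd ts = x"
proof -
  obtain xs where "set xs \<subseteq> S" "prd xs = x" using word_exists[OF assms] by blast
  then show ?thesis by (intro exI[of _ xs]) auto
qed

lemma T_reduced:
  assumes "x \<in> carrier W" obtains ts where "set ts \<subseteq> T" "prd ts = x" "length ts = alen x"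
  using word_length_word[OF T_word_exists[OF assms]] by blast

lemma alen_le: "set ts \<subseteq> T \<Longrightarrow> alen (prd ts) \<le> length ts"
  by (rule word_length_le)

lemma alen_mult:
  assumes "x \<in> carrier W" "y \<in> carrier W" shows "alen (x \<otimes> y) \<le> alen x + alen y"
proof -
  obtain ts where ts: "set ts \<subseteq> T" "prd ts = x" "length ts = alen x" using T_reduced[OF assms(1)] .
  obtain rs where rs: "set rs \<subseteq> T" "prd rs = y" "length rs = alen y" using T_reduced[OF assms(2)] .
  show ?thesis using alen_le[of "ts @ rs"] ts rs T_word_closed by simp
qed

lemma alen_0: assumes "x \<in> carrier W" "alen x = 0" shows "x = \<one>"
  by (rule T_reduced[OF assms(1)]) (use assms(2) in simp)

lemma alen_T: "t \<in> T \<Longrightarrow> alen t \<le> 1"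
  using alen_le[of "[t]"] by simp

text \<open>The first letter of a shortest reflection word for \<open>inv u \<otimes> v\<close>
  leads from \<open>u\<close> to an element between \<open>u\<close> and \<open>v\<close>, which a
  cover forces to be \<open>v\<close>.\<close>

lemma absolute_cover_T:
  assumes "absolute_cover W S u v" shows "u \<in> carrier W" "v \<in> carrier W" "inv u \<otimes> v \<in> T"
proof -
  have le: "absolute_le W S u v" and ne: "u \<noteq> v"
    and mid: "\<And>x. absolute_le W S u x \<Longrightarrow> absolute_le W S x v \<Longrightarrow> x = u \<or> x = v"
    using assms by (auto simp: absolute_cover_def)
  show uv: "u \<in> carrier W" "v \<in> carrier W" using le by (auto simp: absolute_le_def)
  have l: "alen u + alen (inv u \<otimes> v) = alen v" using le by (simp add: absolute_le_def T_def)
  obtain ts where ts: "set ts \<subseteq> T" "prd ts = inv u \<otimes> v" "length ts = alen (inv u \<otimes> v)"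
    using T_reduced[of "inv u \<otimes> v"] uv by auto
  show "inv u \<otimes> v \<in> T"
  proof (cases ts)
    case Nil
    then have "inv u \<otimes> v = \<one>" using ts(2) by simp
    then have "v = u" by (rule inv_mult_one[OF uv])
    then show ?thesis using ne by blast
  next
    case (Cons t rs)
    have t: "t \<in> T" "set rs \<subseteq> T" "prd rs \<in> carrier W" using ts Cons T_word_closed by auto
    define x where "x = u \<otimes> t"
    have x: "x \<in> carrier W" "inv u \<otimes> x = t" using uv t by (simp_all add: x_def)
    have "u \<otimes> (t \<otimes> prd rs) = v" using ts Cons uv by simp
    then have xv: "v = x \<otimes> prd rs" "inv x \<otimes> v = prd rs" using uv t by (auto simp: x_def inv_mult_group m_assoc)
    have a: "alen (prd rs) \<le> length rs" "alen v \<le> alen x + alen (prd rs)" "alen x \<le> alen u + alen t"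
      using alen_le[OF t(2)] alen_mult[of x "prd rs"] alen_mult[of u t] x t uv xv by (simp_all add: x_def)
    have "alen t \<le> 1" using alen_T t by blast
    then have e: "alen x = alen u + alen t" "alen v = alen x + alen (prd rs)" "alen t = 1"
      using a l ts(3) Cons by simp_all
    have "absolute_le W S u x" using uv x e by (simp add: absolute_le_def T_def[symmetric])
    moreover have "absolute_le W S x v" using uv x xv(2) e by (simp add: absolute_le_def T_def[symmetric])
    ultimately have "x = u \<or> x = v" using mid by blast
    moreover have "x \<noteq> u" using e by auto
    ultimately show ?thesis using x t by simp
  qed
qed

definition chain_of :: "'a list \<Rightarrow> 'a list" where
  "chain_of ts = map (\<lambda>i. prd (take i ts)) [0..<length ts + 1]"

lemma chain_of_nth: "i \<le> length ts \<Longrightarrow> chain_of ts ! i = prd (take i ts)"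
  unfolding chain_of_def by (subst nth_map) (auto simp del: upt_Suc)

lemma length_chain_of [simp]: "length (chain_of ts) = length ts + 1"
  by (simp add: chain_of_def)

lemma prd_take_Suc:
  assumes "set ts \<subseteq> carrier W" "i < length ts" shows "prd (take (Suc i) ts) = prd (take i ts) \<otimes> ts ! i"
proof -
  have "set (take i ts) \<subseteq> carrier W" "ts ! i \<in> carrier W" using assms set_take_subset[of i ts] nth_mem[of i ts] by auto
  then show ?thesis unfolding take_Suc_conv_app_nth[OF assms(2)] by simp
qed

lemma prd_take_closed: "set ts \<subseteq> carrier W \<Longrightarrow> prd (take i ts) \<in> carrier W"
  using set_take_subset[of i ts] by (intro word_prod_closed) blast

lemma chain_word_chain_of:
  assumes "set ts \<subseteq> carrier W" shows "chain_word W (chain_of ts) = ts"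
proof (rule nth_equalityI)
  fix i assume "i < length (chain_word W (chain_of ts))"
  then have i: "i < length ts" by (simp add: chain_word_def)
  have "ts ! i \<in> carrier W" using assms i nth_mem by blast
  then show "chain_word W (chain_of ts) ! i = ts ! i"
    using i assms prd_take_closed[OF assms, of i] prd_take_Suc[OF assms i]
    by (simp add: chain_word_def chain_of_nth)
qed (simp add: chain_word_def)

text \<open>Each half of the word has reflection length at most its number of letters, and
  \<open>absolute_length_lower\<close> leaves no slack in the total.\<close>

lemma factorization_alen_prefix:
  assumes "coxeter_word bs" "ts \<in> factorizations bs" "i \<le> length ts" shows "alen (prd (take i ts)) = i"
proof -
  have ts: "set ts \<subseteq> T" "prd ts = prd (rev bs)" "length ts = length bs" using assms by (auto simp: factorizations_def)
  have sub: "set (take i ts) \<subseteq> T" "set (drop i ts) \<subseteq> T" using ts(1) set_take_subset set_drop_subset by fast+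
  then have cl: "prd (take i ts) \<in> carrier W" "prd (drop i ts) \<in> carrier W" using T_word_closed by auto
  have "prd ts = prd (take i ts) \<otimes> prd (drop i ts)"
    using word_prod_append[OF T_word_closed[OF sub(1)] T_word_closed[OF sub(2)]] by simp
  then have "alen (prd ts) \<le> alen (prd (take i ts)) + alen (prd (drop i ts))" using alen_mult[OF cl] by simp
  moreover have "alen (prd (take i ts)) \<le> i" using alen_le[OF sub(1)] assms(3) by simp
  moreover have "alen (prd (drop i ts)) \<le> length ts - i" using alen_le[OF sub(2)] by simp
  moreover have "length ts \<le> alen (prd ts)"
  proof -
    obtain rs where rs: "set rs \<subseteq> T" "prd rs = prd ts" "length rs = alen (prd ts)"
      using T_reduced[of "prd ts"] T_word_closed[OF ts(1)] by auto
    then show ?thesis using absolute_length_lower[of "rev bs" rs] assms(1) ts by (simp add: coxeter_word_def)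
  qed
  ultimately show ?thesis using assms(3) by linarith
qed

lemma chain_of_max_chain:
  assumes "coxeter_word bs" "length bs = card S" "ts \<in> factorizations bs"
  shows "chain_of ts \<in> max_chains W S (prd (rev bs))"
proof -
  have ts: "set ts \<subseteq> T" "prd ts = prd (rev bs)" "length ts = card S" using assms by (auto simp: factorizations_def)
  note cl = T_word_closed[OF ts(1)]
  have "absolute_cover W S (chain_of ts ! i) (chain_of ts ! (i + 1))" if i: "i < card S" for i
  proof -
    define u where "u = prd (take i ts)"
    define v where "v = prd (take (Suc i) ts)"
    have uv: "u \<in> carrier W" "v \<in> carrier W" using prd_take_closed cl by (simp_all add: u_def v_def)
    have t: "ts ! i \<in> T" using ts i by auto
    have lu: "alen u = i" "alen v = i + 1"
      using factorization_alen_prefix[OF assms(1,3), of i] factorization_alen_prefix[OF assms(1,3), of "Suc i"] i ts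
      by (simp_all add: u_def v_def)
    have vu: "v = u \<otimes> ts ! i" unfolding u_def v_def using prd_take_Suc[OF cl] i ts by simp
    have iuv: "inv u \<otimes> v = ts ! i" unfolding vu using uv t by simp
    have "alen v \<le> alen u + alen (ts ! i)" unfolding vu using alen_mult uv t by simp
    then have "alen (ts ! i) = 1" using alen_T[OF t] lu by simp
    then have "absolute_le W S u v" using uv iuv lu by (simp add: absolute_le_def T_def[symmetric])
    moreover have "u \<noteq> v" using lu by auto
    moreover have "x = u \<or> x = v" if x: "absolute_le W S u x" "absolute_le W S x v" for x
    proof -
      have xW: "x \<in> carrier W" and l: "alen u + alen (inv u \<otimes> x) = alen x" "alen x + alen (inv x \<otimes> v) = alen v"
        using x by (auto simp: absolute_le_def T_def)
      then have "alen (inv u \<otimes> x) = 0 \<or> alen (inv x \<otimes> v) = 0" using lu by linarith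
      then show ?thesis
      proof
        assume "alen (inv u \<otimes> x) = 0"
        then have "inv u \<otimes> x = \<one>" by (rule alen_0[rotated]) (use uv xW in simp)
        then show ?thesis using inv_mult_one[OF uv(1) xW] by simp
      next
        assume "alen (inv x \<otimes> v) = 0"
        then have "inv x \<otimes> v = \<one>" by (rule alen_0[rotated]) (use uv xW in simp)
        then show ?thesis using inv_mult_one[OF xW uv(2)] by simp
      qed
    qed
    ultimately have "absolute_cover W S u v" unfolding absolute_cover_def by blast
    then show ?thesis using i ts by (simp add: chain_of_nth u_def v_def)
  qed
  then show ?thesis using ts unfolding max_chains_def by (simp add: chain_of_nth)
qed

lemma max_chain_factorization:
  assumes "coxeter_word bs" "length bs = card S" "p \<in> max_chains W S (prd (rev bs))"
  shows "chain_word W p \<in> factorizations bs" "chain_of (chain_word W p) = p"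
proof -
  define ts where "ts = chain_word W p"
  have p: "length p = card S + 1" "p ! 0 = \<one>" "p ! card S = prd (rev bs)"
    "\<And>i. i < card S \<Longrightarrow> absolute_cover W S (p ! i) (p ! (i + 1))"
    using assms(3) by (auto simp: max_chains_def)
  have lt: "length ts = card S" using p by (simp add: ts_def chain_word_def)
  have tn: "ts ! i = inv (p ! i) \<otimes> p ! (i + 1)" if "i < card S" for i
    using that p by (simp add: ts_def chain_word_def)
  have sub: "set ts \<subseteq> T" using absolute_cover_T(3)[OF p(4)] tn lt by (auto simp: in_set_conv_nth)
  have pt: "prd (take i ts) = p ! i" if "i \<le> card S" for i
    using that
  proof (induction i)
    case 0 then show ?case using p by simp
  next
    case (Suc i)
    then have c: "p ! i \<in> carrier W" "p ! (i + 1) \<in> carrier W" using absolute_cover_T[OF p(4)[of i]] by auto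
    have "prd (take (Suc i) ts) = p ! i \<otimes> (inv (p ! i) \<otimes> p ! (i + 1))"
      using prd_take_Suc[OF T_word_closed[OF sub], of i] Suc tn[of i] lt by simp
    then show ?case using c by simp
  qed
  have "prd ts = prd (rev bs)" using pt[of "card S"] p lt by simp
  then show "chain_word W p \<in> factorizations bs" using sub lt assms(2) by (simp add: factorizations_def ts_def[symmetric])
  have "chain_of ts = p" using pt lt p by (intro nth_equalityI) (simp_all add: chain_of_nth)
  then show "chain_of (chain_word W p) = p" by (simp add: ts_def)
qed

lemma conc_nth:
  assumes "u \<in> carrier W" "set ts \<subseteq> T"
  shows "conc u ts \<longleftrightarrow> (\<forall>i<length ts. pos (act (u \<otimes> prd (take i ts)) (rt (ts ! i))))"
  using assms
proof (induction ts arbitrary: u)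
  case (Cons t ts)
  have t: "t \<in> T" "set ts \<subseteq> T" using Cons by auto
  have "u \<otimes> t \<otimes> prd (take i ts) = u \<otimes> prd (take (Suc i) (t # ts))" for i
    using Cons.prems t prd_take_closed[OF T_word_closed[OF t(2)]] by (simp add: m_assoc)
  then have "conc (u \<otimes> t) ts \<longleftrightarrow> (\<forall>i<length ts. pos (act (u \<otimes> prd (take (Suc i) (t # ts))) (rt ((t # ts) ! Suc i))))"
    using Cons t by (simp del: take_Suc_Cons)
  then show ?case using Cons.prems by (simp add: All_less_Suc2 del: take_Suc_Cons)
qed simp

section \<open>Bruhat intervals\<close>

text \<open>\<open>conc\<close> only asks each step to raise the length; additivity of the lengths
  makes every step a Bruhat cover.\<close>

definition saturated :: "'a \<Rightarrow> 'a list \<Rightarrow> bool" where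
  "saturated x ts \<longleftrightarrow> set ts \<subseteq> T \<and> conc x ts \<and> len (x \<otimes> prd ts) = len x + length ts"

lemma saturated_append:
  assumes "x \<in> carrier W" "set as \<subseteq> T"
  shows "saturated x (as @ bs) \<longleftrightarrow> saturated x as \<and> saturated (x \<otimes> prd as) bs"
proof (cases "set bs \<subseteq> T \<and> conc x (as @ bs)")
  case True
  then have bs: "set bs \<subseteq> T" and c: "conc x as" "conc (x \<otimes> prd as) bs" using conc_append assms by auto
  have cl: "prd as \<in> carrier W" "prd bs \<in> carrier W" using assms bs T_word_closed by auto
  have e: "x \<otimes> prd (as @ bs) = x \<otimes> prd as \<otimes> prd bs"
    using word_prod_append[OF T_word_closed[OF assms(2)] T_word_closed[OF bs]] cl assms by (simp add: m_assoc)
  have "len x + length as \<le> len (x \<otimes> prd as)" "len (x \<otimes> prd as) + length bs \<le> len (x \<otimes> prd as \<otimes> prd bs)"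
    using conc_len assms bs c cl by auto
  then show ?thesis using assms bs c True unfolding saturated_def e by auto
next
  case False
  then show ?thesis using conc_append[OF assms] assms by (auto simp: saturated_def)
qed

lemma bruhat_cover_iff:
  assumes "x \<in> carrier W" shows "bruhat_cover W S x y \<longleftrightarrow> (\<exists>t. saturated x [t] \<and> y = x \<otimes> t)"
proof
  assume "bruhat_cover W S x y"
  then obtain t where t: "t \<in> T" "y = x \<otimes> t" "len y = len x + 1" unfolding bruhat_cover_def T_def by blast
  then show "\<exists>t. saturated x [t] \<and> y = x \<otimes> t"
    using pos_iff_len[OF assms t(1)] by (intro exI[of _ t]) (simp add: saturated_def)
next
  assume "\<exists>t. saturated x [t] \<and> y = x \<otimes> t"
  then obtain t where t: "t \<in> T" "y = x \<otimes> t" "len y = len x + 1" by (auto simp: saturated_def)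
  then show "bruhat_cover W S x y" unfolding bruhat_cover_def using assms t by (auto simp: T_def[symmetric])
qed

lemma bruhat_le_iff:
  assumes "x \<in> carrier W" shows "bruhat_le W S x y \<longleftrightarrow> (\<exists>ts. saturated x ts \<and> y = x \<otimes> prd ts)"
proof
  assume "bruhat_le W S x y"
  then show "\<exists>ts. saturated x ts \<and> y = x \<otimes> prd ts"
    unfolding bruhat_le_def
  proof (induction rule: rtranclp_induct)
    case base then show ?case using assms by (intro exI[of _ "[]"]) (simp add: saturated_def)
  next
    case (step y z)
    then obtain ts where ts: "saturated x ts" "y = x \<otimes> prd ts" by blast
    then have tT: "set ts \<subseteq> T" by (simp add: saturated_def)
    have y: "y \<in> carrier W" using ts(2) assms T_word_closed[OF tT] by simp
    obtain t where t: "saturated y [t]" "z = y \<otimes> t" using step(2) bruhat_cover_iff[OF y] by blast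
    then have tt: "t \<in> T" by (simp add: saturated_def)
    have "saturated x (ts @ [t])" using saturated_append[OF assms tT] ts t by simp
    moreover have "z = x \<otimes> prd (ts @ [t])" using t ts assms tt T_word_closed[OF tT] by (simp add: m_assoc)
    ultimately show ?case by blast
  qed
next
  assume "\<exists>ts. saturated x ts \<and> y = x \<otimes> prd ts"
  then obtain ts where "saturated x ts" "y = x \<otimes> prd ts" by blast
  then show "bruhat_le W S x y" using assms
  proof (induction ts arbitrary: x)
    case Nil then show ?case by (simp add: bruhat_le_def)
  next
    case (Cons t ts)
    then have t: "t \<in> T" "set ts \<subseteq> T" by (auto simp: saturated_def)
    have "saturated x [t]" "saturated (x \<otimes> t) ts"
      using saturated_append[of x "[t]" ts] Cons.prems t by auto
    moreover have "y = x \<otimes> t \<otimes> prd ts" using Cons.prems t T_word_closed[OF t(2)] by (simp add: m_assoc)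
    ultimately have "bruhat_cover W S x (x \<otimes> t)" "bruhat_le W S (x \<otimes> t) y"
      using bruhat_cover_iff[OF Cons.prems(3)] Cons.IH[of "x \<otimes> t"] Cons.prems t by auto
    then show ?case unfolding bruhat_le_def by (rule converse_rtranclp_into_rtranclp)
  qed
qed

lemma bruhat_le_refl: "bruhat_le W S x x"
  by (simp add: bruhat_le_def)

lemma bruhat_le_trans: "bruhat_le W S x y \<Longrightarrow> bruhat_le W S y z \<Longrightarrow> bruhat_le W S x z"
  unfolding bruhat_le_def by (rule rtranclp_trans)

lemma bruhat_le_len:
  assumes "x \<in> carrier W" "bruhat_le W S x y" shows "y \<in> carrier W" "x = y \<or> len x < len y"
proof -
  obtain ts where ts: "saturated x ts" "y = x \<otimes> prd ts" using bruhat_le_iff assms by blast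
  then have tT: "set ts \<subseteq> T" by (simp add: saturated_def)
  show "y \<in> carrier W" using ts assms T_word_closed[OF tT] by simp
  show "x = y \<or> len x < len y" using ts assms by (cases ts) (auto simp: saturated_def)
qed

text \<open>Under \<open>Plus\<close> the lengths of the two ends differ by exactly the number of
  letters, so each step gains one. Concordant factorizations are thereby the label words of maximal
  chains of the Bruhat interval.\<close>

lemma Conc_saturated:
  assumes "u \<in> carrier W" "coxeter_word bs" "Plus bs u"
  shows "ts \<in> Conc bs u \<longleftrightarrow> saturated u ts \<and> u \<otimes> prd ts = u \<otimes> prd (rev bs)"
proof -
  have sub: "set bs \<subseteq> S" "prd (rev bs) \<in> carrier W" using assms simple_word_closed by (auto simp: coxeter_word_def)
  have l: "len (u \<otimes> prd (rev bs)) = len u + length bs" using Plus_len assms sub by blast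
  have "u \<otimes> prd ts = u \<otimes> prd (rev bs) \<longleftrightarrow> prd ts = prd (rev bs)" if "set ts \<subseteq> T"
    using assms(1) sub T_word_closed[OF that] by simp
  then show ?thesis using l by (auto simp: Conc_def factorizations_def saturated_def)
qed

lemma bruhat_step:
  assumes "x \<in> carrier W" "t \<in> T" "bruhat_le W S x (x \<otimes> t)" shows "pos (act x (rt t))"
proof -
  have "x \<noteq> x \<otimes> t" using neg_iff_len[OF assms(1,2)] pos_iff_len[OF assms(1,2)] Phi_sign[OF act_rt_Phi[OF assms(1,2)]] by auto
  then show ?thesis using bruhat_le_len[OF assms(1,3)] pos_iff_len assms by blast
qed

lemma saturated_take:
  assumes "u \<in> carrier W" "saturated u ts" "i \<le> j" "j \<le> length ts"
  shows "bruhat_le W S (u \<otimes> prd (take i ts)) (u \<otimes> prd (take j ts))"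
proof -
  define as where "as = take i ts"
  define bs where "bs = take (j - i) (drop i ts)"
  define ds where "ds = drop j ts"
  have ts: "ts = as @ bs @ ds" using assms(3)
    by (simp add: as_def bs_def ds_def) (metis append_take_drop_id add.commute drop_drop le_add_diff_inverse)
  have sub: "set as \<subseteq> T" "set bs \<subseteq> T" using assms(2) unfolding saturated_def ts by auto
  have cl: "prd as \<in> carrier W" "prd bs \<in> carrier W" using sub T_word_closed by auto
  have "take j ts = as @ bs" using assms(3) by (simp add: as_def bs_def) (metis le_add_diff_inverse take_add)
  then have e: "prd (take j ts) = prd as \<otimes> prd bs" using sub T_word_closed by simp
  have "saturated (u \<otimes> prd as) bs"
    using assms(1,2) cl sub saturated_append[of u as "bs @ ds"] saturated_append[of "u \<otimes> prd as" bs ds] ts by simp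
  then show ?thesis unfolding e as_def[symmetric] using bruhat_le_iff[of "u \<otimes> prd as"] cl assms(1)
    by (auto simp: m_assoc)
qed

lemma concordant_iff:
  assumes "u \<in> carrier W" "coxeter_word bs" "Plus bs u" "ts \<in> factorizations bs"
  shows "concordant W S u (chain_of ts) \<longleftrightarrow> ts \<in> Conc bs u"
proof
  have ts: "set ts \<subseteq> T" using assms(4) by (simp add: factorizations_def)
  note cl = T_word_closed[OF ts]
  {
    assume c: "concordant W S u (chain_of ts)"
    have "pos (act (u \<otimes> prd (take i ts)) (rt (ts ! i)))" if i: "i < length ts" for i
    proof -
      have "bruhat_le W S (u \<otimes> chain_of ts ! i) (u \<otimes> chain_of ts ! (i + 1))"
        using c i unfolding concordant_def by simp
      then have "bruhat_le W S (u \<otimes> prd (take i ts)) (u \<otimes> prd (take i ts) \<otimes> ts ! i)"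
        using i prd_take_Suc[OF cl i] prd_take_closed[OF cl, of i] nth_mem[OF i] ts assms(1)
        by (simp add: chain_of_nth m_assoc subset_iff)
      then show ?thesis using bruhat_step prd_take_closed[OF cl] assms(1) nth_mem[OF i] ts by blast
    qed
    then show "ts \<in> Conc bs u" using conc_nth[OF assms(1) ts] assms(4) by (simp add: Conc_def)
  }
  assume "ts \<in> Conc bs u"
  then have "saturated u ts" using Conc_saturated assms by blast
  then have "bruhat_le W S (u \<otimes> prd (take i ts)) (u \<otimes> prd (take (i + 1) ts))" if "i < length ts" for i
    using saturated_take[OF assms(1)] that by simp
  then show "concordant W S u (chain_of ts)" unfolding concordant_def by (simp add: chain_of_nth)
qed

text \<open>Equal labels are demanded only along covers of the first interval, so covers of the
  second have to be traced back to covers of the first.\<close>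

lemma reflection_isomorphic_sym:
  assumes "u1 \<in> carrier W" "u2 \<in> carrier W" "reflection_isomorphic W S u1 v1 u2 v2"
  shows "reflection_isomorphic W S u2 v2 u1 v1"
proof -
  let ?I1 = "bruhat_interval W S u1 v1" and ?I2 = "bruhat_interval W S u2 v2"
  obtain f where f: "bij_betw f ?I1 ?I2"
    and le: "\<And>x y. x \<in> ?I1 \<Longrightarrow> y \<in> ?I1 \<Longrightarrow> bruhat_le W S x y \<longleftrightarrow> bruhat_le W S (f x) (f y)"
    and cov: "\<And>x y. x \<in> ?I1 \<Longrightarrow> y \<in> ?I1 \<Longrightarrow> bruhat_cover W S x y \<Longrightarrow> inv x \<otimes> y = inv (f x) \<otimes> f y"
    using assms(3) unfolding reflection_isomorphic_def by blast
  define g where "g = inv_into ?I1 f"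
  have g: "bij_betw g ?I2 ?I1" unfolding g_def by (rule bij_betw_inv_into[OF f])
  have gI: "g x \<in> ?I1" "f (g x) = x" if "x \<in> ?I2" for x
    using bij_betwE[OF g] that bij_betw_inv_into_right[OF f that] by (auto simp: g_def)
  have I1: "x \<in> carrier W" if "x \<in> ?I1" for x using that by (simp add: bruhat_interval_def)
  have "bruhat_le W S x y \<longleftrightarrow> bruhat_le W S (g x) (g y)" if "x \<in> ?I2" "y \<in> ?I2" for x y
    using le[of "g x" "g y"] gI that by simp
  moreover have "inv x \<otimes> y = inv (g x) \<otimes> g y" if xy: "x \<in> ?I2" "y \<in> ?I2" and c: "bruhat_cover W S x y" for x y
  proof -
    have lxy: "len y = len x + 1" and xW: "x \<in> carrier W" using c by (auto simp: bruhat_cover_def)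
    have "bruhat_le W S x y" using c unfolding bruhat_le_def by blast
    then have gle: "bruhat_le W S (g x) (g y)" using le[of "g x" "g y"] gI xy by simp
    have gW: "g x \<in> carrier W" using gI I1 xy by blast
    obtain ts where ts: "saturated (g x) ts" "g y = g x \<otimes> prd ts" using gle bruhat_le_iff[OF gW] by blast
    have "ts \<noteq> []"
    proof
      assume "ts = []"
      then have "g y = g x" using ts(2) gW by simp
      then have "y = x" using gI(2)[OF xy(1)] gI(2)[OF xy(2)] by simp
      then show False using lxy by simp
    qed
    \<comment> \<open>\<open>m\<close> will be the first element above \<open>g x\<close> on a
      saturated chain to \<open>g y\<close>. Its image lies between \<open>x\<close> and
      \<open>y\<close> and differs from \<open>x\<close>, so it is \<open>y\<close>, and the chain
      has just one step.\<close>
    then obtain t rs where tr: "ts = [t] @ rs" by (cases ts) auto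
    have tT: "t \<in> T" "set rs \<subseteq> T" using ts(1) tr by (auto simp: saturated_def)
    define m where "m = g x \<otimes> t"
    have mW: "m \<in> carrier W" using gW tT by (simp add: m_def)
    have sat: "saturated (g x) [t]" "saturated m rs" using saturated_append[OF gW, of "[t]" rs] ts(1) tT unfolding tr by (auto simp: m_def)
    have gy: "g y = m \<otimes> prd rs" using ts(2) tr gW tT T_word_closed[OF tT(2)] by (simp add: m_def m_assoc)
    have c1: "bruhat_cover W S (g x) m" using bruhat_cover_iff[OF gW] sat by (auto simp: m_def)
    then have le1: "bruhat_le W S (g x) m" unfolding bruhat_le_def by blast
    have le2: "bruhat_le W S m (g y)" using bruhat_le_iff[OF mW] sat gy by blast
    have mI: "m \<in> ?I1" using mW gI(1)[OF xy(1)] gI(1)[OF xy(2)] le1 le2 bruhat_le_trans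
      unfolding bruhat_interval_def by blast
    have fm: "bruhat_le W S x (f m)" "bruhat_le W S (f m) y"
      using le[OF gI(1)[OF xy(1)] mI] le[OF mI gI(1)[OF xy(2)]] le1 le2 gI(2) xy by auto
    have fmW: "f m \<in> carrier W" using bruhat_le_len(1)[OF xW fm(1)] .
    have "f m \<noteq> x"
    proof
      assume "f m = x"
      then have "bruhat_le W S m (g x)" using le[OF mI gI(1)[OF xy(1)]] gI(2)[OF xy(1)] bruhat_le_refl by simp
      then have "len m \<le> len (g x)" using bruhat_le_len(2)[OF mW] by fastforce
      then show False using c1 by (simp add: bruhat_cover_def)
    qed
    then have "f m = y" using bruhat_le_len(2)[OF xW fm(1)] bruhat_le_len(2)[OF fmW fm(2)] lxy by fastforce
    then have "bruhat_le W S (g y) m" using le[OF gI(1)[OF xy(2)] mI] gI(2)[OF xy(2)] bruhat_le_refl by simp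
    then have "m = g y" using le2 bruhat_le_len(2)[OF mW le2] bruhat_le_len(2)[of "g y" m] gI(1)[OF xy(2)] I1 by fastforce
    then have "bruhat_cover W S (g x) (g y)" using c1 by simp
    then show ?thesis using cov[OF gI(1)[OF xy(1)] gI(1)[OF xy(2)]] gI(2) xy by simp
  qed
  ultimately show ?thesis unfolding reflection_isomorphic_def using g by blast
qed

text \<open>The isomorphism matches the bottom elements, and equal labels then carry a maximal chain
  over letter by letter.\<close>

lemma isomorphic_Conc_subset:
  assumes "coxeter_word bs" "u1 \<in> carrier W" "u2 \<in> carrier W" "Plus bs u1" "Plus bs u2"
    "reflection_isomorphic W S u1 (u1 \<otimes> prd (rev bs)) u2 (u2 \<otimes> prd (rev bs))"
  shows "Conc bs u1 \<subseteq> Conc bs u2"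
proof
  fix ts assume ts: "ts \<in> Conc bs u1"
  let ?I1 = "bruhat_interval W S u1 (u1 \<otimes> prd (rev bs))" and ?I2 = "bruhat_interval W S u2 (u2 \<otimes> prd (rev bs))"
  obtain f where f: "bij_betw f ?I1 ?I2"
    and le: "\<And>x y. x \<in> ?I1 \<Longrightarrow> y \<in> ?I1 \<Longrightarrow> bruhat_le W S x y \<longleftrightarrow> bruhat_le W S (f x) (f y)"
    and cov: "\<And>x y. x \<in> ?I1 \<Longrightarrow> y \<in> ?I1 \<Longrightarrow> bruhat_cover W S x y \<Longrightarrow> inv x \<otimes> y = inv (f x) \<otimes> f y"
    using assms(6) unfolding reflection_isomorphic_def by blast
  have sat: "saturated u1 ts" "u1 \<otimes> prd ts = u1 \<otimes> prd (rev bs)" using Conc_saturated assms ts by blast+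
  have tT: "set ts \<subseteq> T" "ts \<in> factorizations bs" using ts by (auto simp: Conc_def factorizations_def)
  note cl = T_word_closed[OF tT(1)]
  have p: "u1 \<otimes> prd (take i ts) \<in> ?I1" if "i \<le> length ts" for i
    using saturated_take[OF assms(2) sat(1), of 0 i] saturated_take[OF assms(2) sat(1), of i "length ts"] that
      prd_take_closed[OF cl, of i] assms(2) sat(2) by (simp add: bruhat_interval_def)
  have c: "prd (rev bs) \<in> carrier W" using assms(1) simple_word_closed by (auto simp: coxeter_word_def)
  \<comment> \<open>Any concordant factorization shows that \<open>u2\<close> lies below the top of
    its interval and so belongs to it.\<close>
  obtain ts2 where "ts2 \<in> Conc bs u2" using exists_acute assms by blast
  then have "bruhat_le W S u2 (u2 \<otimes> prd (rev bs))"
    using Conc_saturated[OF assms(3,1,5)] bruhat_le_iff[OF assms(3)] by metis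
  then have u2I: "u2 \<in> ?I2" using assms(3) bruhat_le_refl by (simp add: bruhat_interval_def)
  have u1I: "u1 \<in> ?I1" using p[of 0] assms(2) by simp
  obtain a where a: "a \<in> ?I1" "f a = u2" using u2I f unfolding bij_betw_def by (metis imageE)
  have "bruhat_le W S u1 a" using a by (simp add: bruhat_interval_def)
  then have l1: "bruhat_le W S (f u1) u2" using le[OF u1I a(1)] a(2) by simp
  have l2: "bruhat_le W S u2 (f u1)" "f u1 \<in> carrier W" using bij_betwE[OF f] u1I by (auto simp: bruhat_interval_def)
  have fu: "f u1 = u2" using bruhat_le_len(2)[OF l2(2) l1] bruhat_le_len(2)[OF assms(3) l2(1)] by auto
  have t: "ts ! i \<in> T" if "i < length ts" for i using that tT nth_mem by blast
  have fp: "f (u1 \<otimes> prd (take i ts)) = u2 \<otimes> prd (take i ts)" if "i \<le> length ts" for i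
    using that
  proof (induction i)
    case 0 then show ?case using fu assms(2,3) by simp
  next
    case (Suc i)
    define x where "x = u1 \<otimes> prd (take i ts)"
    define y where "y = u1 \<otimes> prd (take (Suc i) ts)"
    have i: "i < length ts" using Suc by simp
    have xW: "x \<in> carrier W" using prd_take_closed[OF cl] assms(2) by (simp add: x_def)
    have yx: "y = x \<otimes> ts ! i"
      using prd_take_Suc[OF cl i] prd_take_closed[OF cl, of i] t[OF i] assms(2) by (simp add: x_def y_def m_assoc)
    have lp: "len (u1 \<otimes> prd (take j ts)) = len u1 + j" if "j \<le> length ts" for j
    proof -
      have "saturated u1 (take j ts @ drop j ts)" using sat by simp
      moreover have "set (take j ts) \<subseteq> T" using tT set_take_subset by fast
      ultimately have "saturated u1 (take j ts)" using saturated_append[OF assms(2)] by blast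
      then show ?thesis using that by (simp add: saturated_def)
    qed
    have "bruhat_cover W S x y" unfolding bruhat_cover_def
      using xW yx t[OF i] lp[of i] lp[of "Suc i"] i by (auto simp: x_def[symmetric] y_def[symmetric] T_def[symmetric])
    then have "inv x \<otimes> y = inv (f x) \<otimes> f y" using cov p[of i] p[of "Suc i"] i by (simp add: x_def y_def)
    moreover have "inv x \<otimes> y = ts ! i" unfolding yx using xW t[OF i] by simp
    moreover have fx: "f x = u2 \<otimes> prd (take i ts)" using Suc i by (simp add: x_def)
    moreover have fW: "f x \<in> carrier W" "f y \<in> carrier W"
      using bij_betwE[OF f] p[of i] p[of "Suc i"] i by (auto simp: x_def y_def bruhat_interval_def)
    ultimately have "f x \<otimes> ts ! i = f x \<otimes> (inv (f x) \<otimes> f y)" by simp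
    then have "f y = f x \<otimes> ts ! i" using fW by simp
    then show ?case unfolding fx y_def
      using prd_take_Suc[OF cl i] prd_take_closed[OF cl, of i] t[OF i] assms(3) by (simp add: m_assoc)
  qed
  have "pos (act (u2 \<otimes> prd (take i ts)) (rt (ts ! i)))" if i: "i < length ts" for i
  proof -
    have "bruhat_le W S (u1 \<otimes> prd (take i ts)) (u1 \<otimes> prd (take (Suc i) ts))"
      using saturated_take[OF assms(2) sat(1), of i "Suc i"] i by simp
    then have "bruhat_le W S (u2 \<otimes> prd (take i ts)) (u2 \<otimes> prd (take (Suc i) ts))"
      using le[OF p[of i] p[of "Suc i"]] fp[of i] fp[of "Suc i"] i by simp
    then have "bruhat_le W S (u2 \<otimes> prd (take i ts)) (u2 \<otimes> prd (take i ts) \<otimes> ts ! i)"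
      using prd_take_Suc[OF cl i] prd_take_closed[OF cl, of i] t[OF i] assms(3) by (simp add: m_assoc)
    then show ?thesis using bruhat_step t[OF i] prd_take_closed[OF cl] assms(3) by blast
  qed
  then show "ts \<in> Conc bs u2" using conc_nth[OF assms(3) tT(1)] tT(2) by (simp add: Conc_def)
qed

text \<open>A relation inside the interval extends to a maximal chain, whose label word is
  concordant with \<open>u1\<close> and hence with \<open>u2\<close>. This makes left translation by
  \<open>u2 \<otimes> inv u1\<close> monotone, and that translation will be the isomorphism.\<close>

lemma Conc_eq_bruhat_le:
  assumes "coxeter_word bs" "u1 \<in> carrier W" "u2 \<in> carrier W" "Plus bs u1" "Plus bs u2" "Conc bs u1 = Conc bs u2"
    "x \<in> bruhat_interval W S u1 (u1 \<otimes> prd (rev bs))" "y \<in> bruhat_interval W S u1 (u1 \<otimes> prd (rev bs))"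
    "bruhat_le W S x y"
  shows "bruhat_le W S (u2 \<otimes> inv u1 \<otimes> x) (u2 \<otimes> inv u1 \<otimes> y)"
proof -
  have xy: "x \<in> carrier W" "y \<in> carrier W" "bruhat_le W S u1 x" "bruhat_le W S y (u1 \<otimes> prd (rev bs))"
    using assms by (auto simp: bruhat_interval_def)
  obtain as where as: "saturated u1 as" "x = u1 \<otimes> prd as" using bruhat_le_iff[OF assms(2)] xy by blast
  obtain ds where ds: "saturated x ds" "y = x \<otimes> prd ds" using bruhat_le_iff[OF xy(1)] assms(9) by blast
  obtain es where es: "saturated y es" "u1 \<otimes> prd (rev bs) = y \<otimes> prd es" using bruhat_le_iff[OF xy(2)] xy by blast
  have sub: "set as \<subseteq> T" "set ds \<subseteq> T" "set es \<subseteq> T" using as ds es by (auto simp: saturated_def)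
  have cl: "prd as \<in> carrier W" "prd ds \<in> carrier W" "prd es \<in> carrier W" using sub T_word_closed by auto
  have "saturated u1 (as @ ds @ es)"
    using saturated_append[OF assms(2) sub(1)] saturated_append[OF xy(1) sub(2)] as ds es by simp
  moreover have "u1 \<otimes> prd (as @ ds @ es) = u1 \<otimes> prd (rev bs)"
    unfolding es(2) ds(2) as(2) using sub cl T_word_closed assms(2) by (simp add: m_assoc)
  ultimately have "as @ ds @ es \<in> Conc bs u2" using Conc_saturated[OF assms(2,1,4)] assms(6) by blast
  then have "saturated u2 (as @ ds @ es)" using Conc_saturated[OF assms(3,1,5)] by blast
  then have s: "saturated (u2 \<otimes> prd as) ds"
    using saturated_append[OF assms(3) sub(1)] saturated_append[of "u2 \<otimes> prd as" ds es] sub cl assms(3) by simp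
  have "u2 \<otimes> inv u1 \<otimes> x = u2 \<otimes> prd as" "u2 \<otimes> inv u1 \<otimes> y = u2 \<otimes> prd as \<otimes> prd ds"
    unfolding ds(2) as(2) using assms(2,3) cl by (simp_all add: m_assoc)
  then show ?thesis using bruhat_le_iff[of "u2 \<otimes> prd as"] s cl assms(3) by auto
qed

lemma isomorphic_iff_Conc:
  assumes "coxeter_word bs" "u1 \<in> carrier W" "u2 \<in> carrier W" "Plus bs u1" "Plus bs u2"
  shows "reflection_isomorphic W S u1 (u1 \<otimes> prd (rev bs)) u2 (u2 \<otimes> prd (rev bs)) \<longleftrightarrow> Conc bs u1 = Conc bs u2"
proof
  assume i: "reflection_isomorphic W S u1 (u1 \<otimes> prd (rev bs)) u2 (u2 \<otimes> prd (rev bs))"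
  show "Conc bs u1 = Conc bs u2"
    using isomorphic_Conc_subset[OF assms i]
      isomorphic_Conc_subset[OF assms(1,3,2,5,4) reflection_isomorphic_sym[OF assms(2,3) i]] by blast
next
  assume eq: "Conc bs u1 = Conc bs u2"
  define c where "c = prd (rev bs)"
  define I where "I = (\<lambda>u. bruhat_interval W S u (u \<otimes> c))"
  define f where "f = (\<lambda>x. u2 \<otimes> inv u1 \<otimes> x)"
  define g where "g = (\<lambda>x. u1 \<otimes> inv u2 \<otimes> x)"
  have c: "c \<in> carrier W" using assms(1) simple_word_closed by (auto simp: coxeter_word_def c_def)
  have ends: "u \<in> I u" "u \<otimes> c \<in> I u" if u: "u \<in> carrier W" "Plus bs u" for u
  proof -
    obtain ts where "ts \<in> Conc bs u" using exists_acute[OF assms(1) u] by blast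
    then have "bruhat_le W S u (u \<otimes> c)"
      using Conc_saturated[OF u(1) assms(1) u(2)] bruhat_le_iff[OF u(1)] unfolding c_def by metis
    then show "u \<in> I u" "u \<otimes> c \<in> I u" using u c bruhat_le_refl by (auto simp: I_def bruhat_interval_def)
  qed
  have le_f: "bruhat_le W S (f x) (f y)" if "x \<in> I u1" "y \<in> I u1" "bruhat_le W S x y" for x y
    using Conc_eq_bruhat_le[OF assms eq] that by (simp add: I_def f_def c_def)
  have le_g: "bruhat_le W S (g x) (g y)" if "x \<in> I u2" "y \<in> I u2" "bruhat_le W S x y" for x y
    using Conc_eq_bruhat_le[OF assms(1,3,2,5,4) eq[symmetric]] that by (simp add: I_def g_def c_def)
  have W: "x \<in> carrier W" if "x \<in> I u" for x u using that by (simp add: I_def bruhat_interval_def)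
  have vals: "f u1 = u2" "f (u1 \<otimes> c) = u2 \<otimes> c" "g u2 = u1" "g (u2 \<otimes> c) = u1 \<otimes> c"
    using assms(2,3) c by (simp_all add: f_def g_def m_assoc)
  have fI: "f x \<in> I u2" if x: "x \<in> I u1" for x
    using le_f[OF ends(1)[OF assms(2,4)] x] le_f[OF x ends(2)[OF assms(2,4)]] x W[OF x] assms(2,3) vals
    by (simp add: I_def bruhat_interval_def f_def)
  have gI: "g x \<in> I u1" if x: "x \<in> I u2" for x
    using le_g[OF ends(1)[OF assms(3,5)] x] le_g[OF x ends(2)[OF assms(3,5)]] x W[OF x] assms(2,3) vals
    by (simp add: I_def bruhat_interval_def g_def)
  have gf: "g (f x) = x" "f (g x) = x" if "x \<in> carrier W" for x
    using that assms(2,3) by (simp_all add: f_def g_def m_assoc)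
  have "bij_betw f (I u1) (I u2)"
    by (rule bij_betw_byWitness[of _ g]) (use gf W fI gI in auto)
  moreover have "bruhat_le W S x y \<longleftrightarrow> bruhat_le W S (f x) (f y)" if "x \<in> I u1" "y \<in> I u1" for x y
    using le_f[OF that] le_g[OF fI[OF that(1)] fI[OF that(2)]] gf W that by auto
  moreover have "inv x \<otimes> y = inv (f x) \<otimes> f y" if "x \<in> I u1" "y \<in> I u1" for x y
    using W that assms(2,3) by (simp add: f_def inv_mult_group m_assoc)
  ultimately show "reflection_isomorphic W S u1 (u1 \<otimes> prd (rev bs)) u2 (u2 \<otimes> prd (rev bs))"
    unfolding reflection_isomorphic_def I_def c_def by blast
qed

section \<open>Decreasing factorizations are the acute ones\<close>

lemma sorting_word_longest:
  assumes "distinct cs" "set cs = S" shows "sorting_word W S cs w0 = projection_word cs w0"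
proof -
  have "coxeter_word cs" using assms by (simp add: coxeter_word_def)
  then show ?thesis using sorting_word_sortable[OF assms w0_closed] longest_projection assms by simp
qed

lemma longest_inversions:
  assumes "distinct cs" "set cs = S"
  shows "distinct (inversion_sequence W (projection_word cs w0))" "set (inversion_sequence W (projection_word cs w0)) = T"
proof -
  have cw: "coxeter_word cs" and sub: "set (projection_word cs w0) \<subseteq> S"
    using assms set_projection_word[of cs w0] by (simp_all add: coxeter_word_def)
  have p: "prd (projection_word cs w0) = w0" using longest_projection[OF cw assms(2)] .
  have "len (prd (projection_word cs w0)) = length (projection_word cs w0)"
    using projection_word_wle(2)[OF w0_closed, of cs] assms by simp
  then show "distinct (inversion_sequence W (projection_word cs w0))" using inversion_reduced[OF sub] by blast
  have "t \<in> set (inversion_sequence W (projection_word cs w0))" if t: "t \<in> T" for t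
  proof (rule inversion_mem[OF sub t])
    have "\<not> pos (act w0 (rt t))" using longest_flip[OF longest_w0] rt[OF t] Phi_not_both by blast
    then show "neg (act (inv (prd (projection_word cs w0))) (rt t))"
      unfolding p using Phi_sign[OF act_rt_Phi[OF w0_closed t]] by simp
  qed
  then show "set (inversion_sequence W (projection_word cs w0)) = T" using inversion_sequence_T[OF sub] by blast
qed

lemma reflection_le_before:
  assumes "distinct cs" "set cs = S" "reflection_le W S cs t t'"
  shows "t = t' \<or> before (inversion_sequence W (projection_word cs w0)) t t'"
proof -
  obtain i j where "i \<le> j" "j < length (inversion_sequence W (projection_word cs w0))"
    "inversion_sequence W (projection_word cs w0) ! i = t" "inversion_sequence W (projection_word cs w0) ! j = t'"
    using assms(3) commutation_equiv_refl unfolding reflection_le_def sorting_word_longest[OF assms(1,2)] by blast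
  then show ?thesis using before_iff_nth by (cases "i = j") force+
qed

lemma before_reflection_le:
  assumes "distinct cs" "set cs = S" "before (inversion_sequence W (projection_word cs w0)) t t'" "t \<otimes> t' \<noteq> t' \<otimes> t"
  shows "reflection_le W S cs t t'"
  unfolding reflection_le_def sorting_word_longest[OF assms(1,2)]
proof (intro allI impI)
  fix ws assume "commutation_equiv W (projection_word cs w0) ws"
  then have "before (inversion_sequence W ws) t t'"
    using before_commutation assms(2-4) set_projection_word by metis
  then show "\<exists>i j. i \<le> j \<and> j < length (inversion_sequence W ws) \<and> inversion_sequence W ws ! i = t \<and> inversion_sequence W ws ! j = t'"
    unfolding before_iff_nth using order.strict_implies_order by metis
qed

text \<open>One of the two Euler values of the pair vanishes, so the other equals twice the inner
  product and \<open>euler_order\<close> reads the position from its sign. For equal reflections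
  both values would vanish although they add up to 2.\<close>

lemma factorization_order:
  assumes "distinct cs" "set cs = S" "set ts \<subseteq> T" "length ts = length cs" "prd ts = prd cs" "before ts t t'"
  shows "t \<noteq> t'"
    "B (rt t) (rt t') < 0 \<Longrightarrow> before (inversion_sequence W (projection_word cs w0)) t t'"
    "0 < B (rt t) (rt t') \<Longrightarrow> before (inversion_sequence W (projection_word cs w0)) t' t"
proof -
  have T: "t \<in> T" "t' \<in> T" using before_in[OF assms(6)] assms(3) by auto
  have cw: "coxeter_word cs" using assms by (simp add: coxeter_word_def)
  have e: "euler cs (rt t) (rt t') = 0" using euler_factorization assms by blast
  then have e': "euler cs (rt t') (rt t) = 2 * B (rt t) (rt t')" using euler_B[OF assms(1,2), of "rt t" "rt t'"] by simp
  show "t \<noteq> t'" using e e' B_rt[OF T(1)] by auto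
  have "t \<in> set (inversion_sequence W (projection_word cs w0))" "t' \<in> set (inversion_sequence W (projection_word cs w0))"
    using longest_inversions[OF assms(1,2)] T by auto
  from euler_order[OF cw w0_closed this e]
  show "B (rt t) (rt t') < 0 \<Longrightarrow> before (inversion_sequence W (projection_word cs w0)) t t'"
    "0 < B (rt t) (rt t') \<Longrightarrow> before (inversion_sequence W (projection_word cs w0)) t' t"
    unfolding e' by auto
qed

text \<open>A negative inner product would put \<open>t\<close> before \<open>t'\<close> in the
  inversion sequence. The two do not commute, so this order persists in all equivalent words and
  \<open>reflection_le\<close> holds.\<close>

lemma decreasing_acute:
  assumes "distinct cs" "set cs = S" "set ts \<subseteq> T" "length ts = length cs" "prd ts = prd cs"
    "\<And>t t'. before ts t t' \<Longrightarrow> \<not> reflection_le W S cs t t'"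
  shows "acute ts"
proof -
  have *: "0 \<le> B (rt t) (rt t')" if b: "before ts t t'" for t t'
  proof (rule ccontr)
    assume n: "\<not> 0 \<le> B (rt t) (rt t')"
    have T: "t \<in> T" "t' \<in> T" using before_in[OF b] assms(3) by auto
    note fo = factorization_order[OF assms(1-5) b]
    have "t \<otimes> t' \<noteq> t' \<otimes> t" using commute_iff[OF T fo(1)] n by auto
    then show False using before_reflection_le[OF assms(1,2)] fo(2) n assms(6)[OF b] by auto
  qed
  have "before ts t t' \<or> before ts t' t \<or> t = t'" if "t \<in> set ts" "t' \<in> set ts" for t t'
    using that by (induction ts) auto
  then show ?thesis unfolding acute_def using * B_sym B_rt assms(3) by (metis subsetD zero_le_one)
qed

text \<open>The factorization is sorted by decreasing position in the inversion sequence of the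
  longest element. A pair standing in the wrong order cannot have positive inner product, so its
  roots are orthogonal and the swap is a commutation.\<close>

lemma acute_decreasing:
  assumes "distinct cs" "set cs = S" "set ts \<subseteq> T" "length ts = length cs" "prd ts = prd cs" "acute ts"
  shows "\<exists>ys. commutation_equiv W ts ys \<and> (\<forall>t t'. before ys t t' \<longrightarrow> \<not> reflection_le W S cs t t')"
proof -
  let ?I = "inversion_sequence W (projection_word cs w0)"
  note I = longest_inversions[OF assms(1,2)]
  define f where "f t = (SOME i. i < length ?I \<and> ?I ! i = t)" for t
  have f: "f t < length ?I \<and> ?I ! f t = t" if "t \<in> T" for t
  proof -
    have "t \<in> set ?I" using that I(2) by simp
    then have "\<exists>i. i < length ?I \<and> ?I ! i = t" by (simp only: in_set_conv_nth)
    then show ?thesis unfolding f_def by (rule someI_ex)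
  qed
  have bf: "f t < f t'" if b: "before ?I t t'" for t t'
  proof -
    obtain i j where ij: "i < j" "j < length ?I" "?I ! i = t" "?I ! j = t'"
      using b unfolding before_iff_nth by blast
    have T: "t \<in> T" "t' \<in> T" using before_in[OF b] I by auto
    have "f t = i" using nth_eq_iff_index_eq[OF I(1), of "f t" i] f[OF T(1)] ij by simp
    moreover have "f t' = j" using nth_eq_iff_index_eq[OF I(1), of "f t'" j] f[OF T(2)] ij by simp
    ultimately show ?thesis using ij by simp
  qed
  have "x \<otimes> y = y \<otimes> x" if b: "before ts x y" and l: "f x < f y" for x y
  proof -
    have T: "x \<in> T" "y \<in> T" using before_in[OF b] assms(3) by auto
    note fo = factorization_order[OF assms(1-5) b]
    have "0 \<le> B (rt x) (rt y)" using assms(6) before_in[OF b] by (simp add: acute_def)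
    moreover have "\<not> 0 < B (rt x) (rt y)"
    proof
      assume "0 < B (rt x) (rt y)"
      then show False using bf[OF fo(3)] l by simp
    qed
    ultimately show ?thesis using commute_iff[OF T fo(1)] by simp
  qed
  then obtain ys where ys: "commutation_equiv W ts ys" "sorted_wrt (\<lambda>a b. f b \<le> f a) ys"
    using commutation_equiv_sort[of ts f] by blast
  have ysf: "set ys \<subseteq> T" "length ys = length cs" "prd ys = prd cs"
    using commutation_equiv_set[OF ys(1)] commutation_equiv_length[OF ys(1)]
      commutation_equiv_prod[OF ys(1) T_word_closed[OF assms(3)]] assms by auto
  have "\<not> reflection_le W S cs t t'" if b: "before ys t t'" for t t'
  proof
    assume "reflection_le W S cs t t'"
    then have "before ?I t t'"
      using reflection_le_before[OF assms(1,2)] factorization_order(1)[OF assms(1,2) ysf b] by blast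
    then have "f t < f t'" using bf by blast
    moreover have "f t' \<le> f t" using b ys(2) by (induction ys) auto
    ultimately show False by simp
  qed
  then show ?thesis using ys(1) by blast
qed

lemma decreasing_chain_iff:
  "decreasing_chain W S cs p \<longleftrightarrow> (\<forall>t t'. before (chain_word W p) t t' \<longrightarrow> \<not> reflection_le W S cs t t')"
  unfolding decreasing_chain_def before_iff_nth by blast

section \<open>The equivalences\<close>

lemma concordant_class_iff:
  assumes "coxeter_word bs" "length bs = card S" "u \<in> carrier W" "Plus bs u" "p \<in> max_chains W S (prd (rev bs))"
  shows "concordant W S u p \<longleftrightarrow> chain_word W p \<in> Conc bs u"
  using concordant_iff[OF assms(3,1,4) max_chain_factorization(1)[OF assms(1,2,5)]]
    max_chain_factorization(2)[OF assms(1,2,5)] by simp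

lemma chain_class_eq_iff:
  assumes "p \<in> max_chains W S c" "q \<in> max_chains W S c"
  shows "chain_class W S c p = chain_class W S c q \<longleftrightarrow> commutation_equiv W (chain_word W p) (chain_word W q)"
proof
  assume e: "chain_class W S c p = chain_class W S c q"
  have "q \<in> chain_class W S c q" using assms by (simp add: chain_class_def)
  then have "q \<in> chain_class W S c p" unfolding e .
  then show "commutation_equiv W (chain_word W p) (chain_word W q)" by (simp add: chain_class_def)
next
  assume "commutation_equiv W (chain_word W p) (chain_word W q)"
  then show "chain_class W S c p = chain_class W S c q"
    unfolding chain_class_def using commutation_equiv_trans commutation_equiv_sym by blast
qed

lemma concordant_classes_eq_iff:
  assumes "coxeter_word bs" "length bs = card S" "u \<in> carrier W" "Plus bs u" "u' \<in> carrier W" "Plus bs u'"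
  shows "concordant_classes W S (prd (rev bs)) u = concordant_classes W S (prd (rev bs)) u' \<longleftrightarrow> Conc bs u = Conc bs u'"
proof
  let ?c = "prd (rev bs)"
  assume eq: "concordant_classes W S ?c u = concordant_classes W S ?c u'"
  have "ts \<in> Conc bs y" if eq: "concordant_classes W S ?c x = concordant_classes W S ?c y"
    and x: "x \<in> carrier W" "Plus bs x" and y: "y \<in> carrier W" "Plus bs y" and ts: "ts \<in> Conc bs x" for x y ts
  proof -
    have f: "ts \<in> factorizations bs" "set ts \<subseteq> T" using ts by (auto simp: Conc_def factorizations_def)
    have p: "chain_of ts \<in> max_chains W S ?c" using chain_of_max_chain assms f by blast
    have w: "chain_word W (chain_of ts) = ts" using chain_word_chain_of[OF T_word_closed[OF f(2)]] .
    have "concordant W S x (chain_of ts)" using concordant_class_iff[OF assms(1,2) x p] w ts by simp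
    then have "chain_class W S ?c (chain_of ts) \<in> concordant_classes W S ?c x"
      unfolding concordant_classes_def using p by blast
    then have "chain_class W S ?c (chain_of ts) \<in> concordant_classes W S ?c y" unfolding eq .
    then obtain q where q: "chain_class W S ?c (chain_of ts) = chain_class W S ?c q" "q \<in> max_chains W S ?c" "concordant W S y q"
      unfolding concordant_classes_def by blast
    have "commutation_equiv W (chain_word W q) ts"
      using q(1) chain_class_eq_iff[OF p q(2)] commutation_equiv_sym w by simp
    moreover have "chain_word W q \<in> Conc bs y" using concordant_class_iff[OF assms(1,2) y q(2)] q(3) by simp
    ultimately show ?thesis using Conc_commutation y(1) by blast
  qed
  from this[OF eq assms(3-6)] this[OF eq[symmetric] assms(5,6,3,4)] show "Conc bs u = Conc bs u'" by blast
next
  assume "Conc bs u = Conc bs u'"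
  then show "concordant_classes W S (prd (rev bs)) u = concordant_classes W S (prd (rev bs)) u'"
    unfolding concordant_classes_def
    using concordant_class_iff[OF assms(1-4)] concordant_class_iff[OF assms(1,2,5,6)] by blast
qed

text \<open>Resolves the definite description: the class of an acute factorization contains a
  decreasing chain, and any decreasing chain is acute, hence lies in that class by
  \<open>acute_unique\<close>.\<close>

lemma decreasing_class_acute:
  assumes "coxeter_word bs" "length bs = card S" "distinct cs" "set cs = S" "prd cs = prd (rev bs)"
    "u \<in> carrier W" "Plus bs u" "ts \<in> Conc bs u" "acute ts"
  shows "decreasing_class W S (prd (rev bs)) cs u = chain_class W S (prd (rev bs)) (chain_of ts)"
proof -
  let ?c = "prd (rev bs)"
  have lcs: "length cs = length bs" using assms(2-4) distinct_card by metis
  have f: "ts \<in> factorizations bs" "set ts \<subseteq> T" "length ts = length cs" "prd ts = prd cs"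
    using assms lcs by (auto simp: Conc_def factorizations_def)
  have p: "chain_of ts \<in> max_chains W S ?c" using chain_of_max_chain assms f by blast
  have w: "chain_word W (chain_of ts) = ts" using chain_word_chain_of[OF T_word_closed[OF f(2)]] .
  obtain ys where ys: "commutation_equiv W ts ys" "\<And>t t'. before ys t t' \<Longrightarrow> \<not> reflection_le W S cs t t'"
    using acute_decreasing[OF assms(3,4) f(2-4) assms(9)] by blast
  have "ys \<in> Conc bs u" using Conc_commutation[OF ys(1) assms(6,8)] .
  then have yf: "ys \<in> factorizations bs" "set ys \<subseteq> T" by (auto simp: Conc_def factorizations_def)
  have yp: "chain_of ys \<in> max_chains W S ?c" using chain_of_max_chain assms yf by blast
  have yw: "chain_word W (chain_of ys) = ys" using chain_word_chain_of[OF T_word_closed[OF yf(2)]] .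
  have in_cls: "chain_of ys \<in> chain_class W S ?c (chain_of ts)" using yp yw w ys(1) by (simp add: chain_class_def)
  have dec: "decreasing_chain W S cs (chain_of ys)" unfolding decreasing_chain_iff yw using ys(2) by blast
  show ?thesis unfolding decreasing_class_def
  proof (rule the_equality)
    have "concordant W S u (chain_of ts)" using concordant_class_iff[OF assms(1,2,6,7) p] w assms(8) by simp
    then show "chain_class W S ?c (chain_of ts) \<in> concordant_classes W S ?c u \<and>
        (\<exists>\<pi>\<in>chain_class W S ?c (chain_of ts). decreasing_chain W S cs \<pi>)"
      unfolding concordant_classes_def using p in_cls dec by blast
  next
    fix C assume "C \<in> concordant_classes W S ?c u \<and> (\<exists>\<pi>\<in>C. decreasing_chain W S cs \<pi>)"
    then obtain q r where q: "C = chain_class W S ?c q" "q \<in> max_chains W S ?c" "concordant W S u q"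
        and r: "r \<in> C" "decreasing_chain W S cs r" unfolding concordant_classes_def by blast
    have rm: "r \<in> max_chains W S ?c" "commutation_equiv W (chain_word W q) (chain_word W r)"
      using r(1) unfolding q(1) chain_class_def by auto
    have "chain_word W q \<in> Conc bs u" using concordant_class_iff[OF assms(1,2,6,7) q(2)] q(3) by simp
    then have rC: "chain_word W r \<in> Conc bs u" using Conc_commutation[OF rm(2) assms(6)] by blast
    have rf: "set (chain_word W r) \<subseteq> T" "length (chain_word W r) = length cs" "prd (chain_word W r) = prd cs"
      using rC lcs assms(5) by (auto simp: Conc_def factorizations_def)
    have "acute (chain_word W r)"
      using decreasing_acute[OF assms(3,4) rf] r(2) unfolding decreasing_chain_iff by blast
    then have "commutation_equiv W (chain_word W r) ts"
      using acute_unique[OF assms(1,6,7) rC _ assms(8,9)] by blast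
    then have "commutation_equiv W (chain_word W q) (chain_word W (chain_of ts))"
      using rm(2) commutation_equiv_trans unfolding w by blast
    then show "C = chain_class W S ?c (chain_of ts)" unfolding q(1) chain_class_eq_iff[OF q(2) p] .
  qed
qed

end

theorem theorem1p9:
  fixes W :: "('a, 'b) monoid_scheme" and S :: "'a set"
    and c u1 u2 :: 'a and cs cs' :: "'a list"
  assumes "coxeter_system W S"
    and "finite (carrier W)"
    and "standard_coxeter_element W S c"
    and "reduced_word W S c cs"
    and "reduced_word W S (inv\<^bsub>W\<^esub> c) cs'"
    and "u1 \<in> coxeter_plus W S c"
    and "u2 \<in> coxeter_plus W S c"
  shows "(decreasing_class W S c cs u1 = decreasing_class W S c cs u2
            \<longleftrightarrow> concordant_classes W S c u1 = concordant_classes W S c u2)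
       \<and> (concordant_classes W S c u1 = concordant_classes W S c u2
            \<longleftrightarrow> reflection_isomorphic W S u1 (u1 \<otimes>\<^bsub>W\<^esub> c) u2 (u2 \<otimes>\<^bsub>W\<^esub> c))
       \<and> (reflection_isomorphic W S u1 (u1 \<otimes>\<^bsub>W\<^esub> c) u2 (u2 \<otimes>\<^bsub>W\<^esub> c)
            \<longleftrightarrow> (\<exists>C\<in>cambrian_classes W S cs'. inv\<^bsub>W\<^esub> u1 \<in> C \<and> inv\<^bsub>W\<^esub> u2 \<in> C))"
proof -
  interpret finite_coxeter W S
    using assms(1,2) by (simp add: finite_coxeter_def finite_coxeter_axioms_def)
  obtain ws where ws: "distinct ws" "set ws = S" "prd ws = c" using assms(3) unfolding standard_coxeter_element_def by blast
  have cs: "distinct cs" "set cs = S" "prd cs = c"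
    using standard_coxeter_word[OF ws(1,2)] assms(4) ws(3) by (auto simp: reduced_word_def)
  have "inv\<^bsub>W\<^esub> c = prd (rev ws)" using word_rev_inv[of ws] ws by simp
  then have bs: "distinct cs'" "set cs' = S" "prd cs' = inv\<^bsub>W\<^esub> c"
    using standard_coxeter_word[of "rev ws" cs'] assms(5) ws by (auto simp: reduced_word_def)
  have cW: "c \<in> carrier W" using ws simple_word_closed[of ws] by auto
  \<comment> \<open>\<open>cs'\<close> spells the inverse of \<open>c\<close>, as the recursions
    expect; \<open>cs\<close> matters for the order on reflections.\<close>
  have c: "c = prd (rev cs')" using word_rev_inv[of cs'] bs cW by simp
  have cw: "coxeter_word cs'" "length cs' = card S" using bs distinct_card[of cs'] by (simp_all add: coxeter_word_def)
  have u: "u \<in> carrier W" "Plus cs' u" if "u \<in> coxeter_plus W S c" for u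
    using that Plus_iff_len[of u cs'] bs cw c by (auto simp: coxeter_plus_def)
  note u1 = u[OF assms(6)] and u2 = u[OF assms(7)]
  have classes: "concordant_classes W S c u1 = concordant_classes W S c u2 \<longleftrightarrow> Conc cs' u1 = Conc cs' u2"
    unfolding c by (rule concordant_classes_eq_iff[OF cw u1 u2])
  obtain ts1 where ts1: "ts1 \<in> Conc cs' u1" "acute ts1" using exists_acute cw u1 by blast
  obtain ts2 where ts2: "ts2 \<in> Conc cs' u2" "acute ts2" using exists_acute cw u2 by blast
  have word_iff: "projection_word cs' u1 = projection_word cs' u2 \<longleftrightarrow> Conc cs' u1 = Conc cs' u2"
    using Conc_projection_word[OF cw(1) u1(1) u2(1) u1(2) u2(2)]
      acute_projection_word[OF cw(1) u1(1) u2(1) u1(2) u2(2) ts1(1) _ ts1(2)] ts1 by blast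
  \<comment> \<open>Both decreasing classes are represented by acute factorizations. If they agree,
    the one for \<open>u1\<close> is concordant with \<open>u2\<close> as well, and a shared acute
    factorization determines the greedy word.\<close>
  have "Conc cs' u1 = Conc cs' u2" if "decreasing_class W S c cs u1 = decreasing_class W S c cs u2"
  proof -
    have f: "ts1 \<in> factorizations cs'" "ts2 \<in> factorizations cs'" "set ts1 \<subseteq> T" "set ts2 \<subseteq> T"
      using ts1 ts2 by (auto simp: Conc_def factorizations_def)
    have p: "chain_of ts1 \<in> max_chains W S c" "chain_of ts2 \<in> max_chains W S c"
      unfolding c using chain_of_max_chain[OF cw] f by blast+
    have "chain_class W S c (chain_of ts1) = chain_class W S c (chain_of ts2)"
      using that decreasing_class_acute[OF cw cs(1,2) _ u1 ts1] decreasing_class_acute[OF cw cs(1,2) _ u2 ts2] cs(3) c by simp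
    then have "commutation_equiv W ts2 ts1"
      using chain_class_eq_iff[OF p] chain_word_chain_of[OF T_word_closed[OF f(3)]]
        chain_word_chain_of[OF T_word_closed[OF f(4)]] commutation_equiv_sym by simp
    then have "ts1 \<in> Conc cs' u2" using Conc_commutation u2(1) ts2(1) by blast
    then show ?thesis
      using word_iff acute_projection_word[OF cw(1) u1(1) u2(1) u1(2) u2(2) ts1(1) _ ts1(2)] by blast
  qed
  moreover have "decreasing_class W S c cs u1 = decreasing_class W S c cs u2"
    if "concordant_classes W S c u1 = concordant_classes W S c u2"
    unfolding decreasing_class_def that ..
  moreover have "reflection_isomorphic W S u1 (u1 \<otimes>\<^bsub>W\<^esub> c) u2 (u2 \<otimes>\<^bsub>W\<^esub> c) \<longleftrightarrow> Conc cs' u1 = Conc cs' u2"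
    unfolding c by (rule isomorphic_iff_Conc[OF cw(1) u1(1) u2(1) u1(2) u2(2)])
  moreover have "(\<exists>C\<in>cambrian_classes W S cs'. inv\<^bsub>W\<^esub> u1 \<in> C \<and> inv\<^bsub>W\<^esub> u2 \<in> C) \<longleftrightarrow> Conc cs' u1 = Conc cs' u2"
    using same_cambrian_class_iff[OF bs(1,2) u1 u2] word_iff by simp
  ultimately show ?thesis using classes by blast
qed

end
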